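(* Let $n\ge 1$ and let $p$ be a positive integer. Let $V_p$ be the irreducible $q(n+1)$-module described in the context. The decomposition of $V_p$ into irreducible $gl(n+1)$-modules, where $gl(n+1)=\mathrm{span}\{e_{ij}^{\bar 0}\}\subset q(n+1)$ and each irreducible $gl(n+1)$-module is denoted by its highest weight, is $$V_p \cong (p,0,\ldots,0)\oplus(p-1,1,0,\ldots,0)\oplus(p-2,1,1,0,\ldots,0)\oplus\cdots\oplus(p-n,1,1,\ldots,1),$$ where the $i$-th summand ($i=0,1,\ldots,n$) is $(p-i,\underbrace{1,\ldots,1}_{i},0,\ldots,0)$, and summands with $i\ge p$ (whose label is not a dominant weight) are omitted. The dimension of $V_p$ is $$\dim V_p=\sum_{i=0}^n\binom{p-1}{i}\binom{p+n-i}{n-i}.$$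
   Context: The Lie superalgebra $G=q(n+1)$ over $\mathbb{C}$ has even basis elements $e_{ij}^{\bar 0}$ and odd basis elements $e_{ij}^{\bar 1}$ ($i,j=0,1,\ldots,n$) with superbracket $[\![ e_{ij}^\sigma, e_{kl}^\theta ]\!] = \delta_{jk} e_{il}^{\sigma+\theta} - (-1)^{\sigma\theta}\delta_{il} e_{kj}^{\sigma+\theta}$, $\sigma,\theta\in\mathbb{Z}_2=\{\bar 0,\bar 1\}$. A $G$-module is a complex vector space $V$ (not required to be $\mathbb{Z}_2$-graded) with a linear map $\rho:G\to \mathrm{End}(V)$ such that $\rho([\![x,y]\!])=\rho(x)\rho(y)-(-1)^{\sigma\theta}\rho(y)\rho(x)$ for $x\in G_\sigma$, $y\in G_\theta$; submodules are likewise not required to be graded. Let $q(1)=\mathrm{span}\{e_{00}^{\bar 0},e_{00}^{\bar 1}\}$, $q(n)=\mathrm{span}\{e_{ij}^{\sigma}: 1\le i,j\le n,\ \sigma\in\mathbb{Z}_2\}$, $\tilde G=q(1)\oplus q(n)$, and $P=\mathrm{span}\{e_{0i}^{\bar 0},e_{0i}^{\bar 1}: 1\le i\le n\}$; $\tilde G+P$ is a subalgebra of $G$. Let $\mathbb{C}v_0$ be the one-dimensional $(\tilde G+P)$-module with $e_{00}^{\bar 0}v_0=p\,v_0$, $e_{00}^{\bar 1}v_0=\sqrt{p}\,v_0$, and $xv_0=0$ for $x\in q(n)$ and $x\in P$. Define $\bar V_p=\mathrm{Ind}_{\tilde G+P}^{G}\mathbb{C}v_0 = U(G)\otimes_{U(\tilde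 G+P)}\mathbb{C}v_0$. $M_p$ denotes the maximal $G$-submodule of $\bar V_p$ different from $\bar V_p$ (so $v\in M_p$ if and only if $v_0\notin U(G)v$), and $V_p=\bar V_p/M_p$. Weights $(\lambda_0,\ldots,\lambda_n)$ are the eigenvalues of $(e_{00}^{\bar 0},\ldots,e_{nn}^{\bar 0})$, and highest weights are taken with respect to the positive root vectors $e_{ij}^{\bar 0}$, $i<j$. *)

theory Defs
  imports
    Complex_Main
    "HOL-Library.Poly_Mapping"
    "HOL-Library.Z2"
    "HOL-Algebra.QuotRing"
    "Jordan_Normal_Form.VS_Connect"
begin

section \<open>The Lie superalgebra \<open>q(n+1)\<close>\<close>

text \<open>
  Finitely supported functions \<open>'a \<Rightarrow>\<^sub>0 complex\<close> serve as the complex vector space with basis \<open>'a\<close>.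
  The triple \<open>(i, j, \<sigma>)\<close> stands for the basis element \<open>e\<^bsub>ij\<^esub>\<^sup>\<sigma>\<close>, where \<open>\<sigma> = 0\<close> is even and
  \<open>\<sigma> = 1\<close> is odd; addition on \<^typ>\<open>bit\<close> is addition modulo 2.
\<close>

definition pscale :: "complex \<Rightarrow> ('a \<Rightarrow>\<^sub>0 complex) \<Rightarrow> ('a \<Rightarrow>\<^sub>0 complex)" where
  "pscale c f = Poly_Mapping.map (\<lambda>z. c * z) f"

type_synonym qidx = "nat \<times> nat \<times> bit"
type_synonym qelt = "qidx \<Rightarrow>\<^sub>0 complex"

definition q_e :: "nat \<Rightarrow> nat \<Rightarrow> bit \<Rightarrow> qelt" where
  "q_e i j \<sigma> = Poly_Mapping.single (i, j, \<sigma>) 1"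

definition koszul :: "bit \<Rightarrow> bit \<Rightarrow> complex" where
  "koszul \<sigma> \<theta> = (if \<sigma> = 1 \<and> \<theta> = 1 then - 1 else 1)"

fun basis_bracket :: "qidx \<Rightarrow> qidx \<Rightarrow> qelt" where
  "basis_bracket (i, j, \<sigma>) (k, l, \<theta>) =
     (if j = k then q_e i l (\<sigma> + \<theta>) else 0)
     - pscale (koszul \<sigma> \<theta>) (if i = l then q_e k j (\<sigma> + \<theta>) else 0)"

definition sbracket :: "qelt \<Rightarrow> qelt \<Rightarrow> qelt" where
  "sbracket x y = (\<Sum>a\<in>Poly_Mapping.keys x. \<Sum>b\<in>Poly_Mapping.keys y. pscale (Poly_Mapping.lookup x a * Poly_Mapping.lookup y b) (basis_bracket a b))"

definition qspan :: "(nat \<times> nat) set \<Rightarrow> qelt set" where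
  "qspan S = {x. \<forall>(i, j, \<sigma>)\<in>Poly_Mapping.keys x. (i, j) \<in> S}"

definition homogeneous :: "qelt set \<Rightarrow> bit \<Rightarrow> qelt set" where
  "homogeneous L \<sigma> = {x \<in> L. \<forall>(i, j, \<tau>)\<in>Poly_Mapping.keys x. \<tau> = \<sigma>}"

text \<open>\<open>q_alg n\<close> is \<open>q(n+1)\<close>, with indices \<open>0, \<dots>, n\<close>.\<close>

definition q_alg :: "nat \<Rightarrow> qelt set" where
  "q_alg n = qspan ({0..n} \<times> {0..n})"

definition gl_alg :: "nat \<Rightarrow> qelt set" where
  "gl_alg n = homogeneous (q_alg n) 0"

text \<open>\<open>G_tilde n = q(1) \<oplus> q(n)\<close>, and \<open>parabolic n\<close> is the subalgebra \<open>G_tilde n + P_alg n\<close>.\<close>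

definition G_tilde :: "nat \<Rightarrow> qelt set" where
  "G_tilde n = {x + y | x y. x \<in> qspan ({0} \<times> {0}) \<and> y \<in> qspan ({1..n} \<times> {1..n})}"

definition P_alg :: "nat \<Rightarrow> qelt set" where
  "P_alg n = qspan ({0} \<times> {1..n})"

definition parabolic :: "nat \<Rightarrow> qelt set" where
  "parabolic n = {x + y | x y. x \<in> G_tilde n \<and> y \<in> P_alg n}"

section \<open>Tensor algebra and universal enveloping algebra\<close>

text \<open>
  Finitely supported functions on the free monoid of words in the basis elements, with the
  convolution product, form the free associative unital algebra on the basis elements.
\<close>

datatype 'a word = Word (letters: "'a list")

instantiation word :: (type) monoid_add
begin

definition zero_word :: "'a word" where
  "0 = Word []"

definition plus_word :: "'a word \<Rightarrow> 'a word \<Rightarrow> 'a word" where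
  "v + w = Word (letters v @ letters w)"

instance
  by standard (simp_all add: zero_word_def plus_word_def)

end

type_synonym free_alg = "qidx word \<Rightarrow>\<^sub>0 complex"

definition scalar :: "complex \<Rightarrow> free_alg" where
  "scalar c = Poly_Mapping.single 0 c"

definition embed :: "qelt \<Rightarrow> free_alg" where
  "embed x = (\<Sum>a\<in>Poly_Mapping.keys x. Poly_Mapping.single (Word [a]) (Poly_Mapping.lookup x a))"

text \<open>
  For a linear subspace \<open>L\<close>, the unital subalgebra generated by \<open>L\<close> is the tensor algebra \<open>T(L)\<close>.
\<close>

inductive_set tensor_alg :: "qelt set \<Rightarrow> free_alg set" for L where
  "scalar c \<in> tensor_alg L"
| "x \<in> L \<Longrightarrow> embed x \<in> tensor_alg L"
| "f \<in> tensor_alg L \<Longrightarrow> g \<in> tensor_alg L \<Longrightarrow> f + g \<in> tensor_alg L"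
| "f \<in> tensor_alg L \<Longrightarrow> g \<in> tensor_alg L \<Longrightarrow> f * g \<in> tensor_alg L"

definition tensor_ring :: "qelt set \<Rightarrow> free_alg ring" where
  "tensor_ring L = \<lparr>carrier = tensor_alg L, monoid.mult = (*), one = 1, zero = 0, add = (+)\<rparr>"

definition env_ideal :: "qelt set \<Rightarrow> free_alg set" where
  "env_ideal L = genideal (tensor_ring L)
     {embed x * embed y - scalar (koszul \<sigma> \<theta>) * (embed y * embed x) - embed (sbracket x y) | x y \<sigma> \<theta>.
        x \<in> homogeneous L \<sigma> \<and> y \<in> homogeneous L \<theta>}"

definition env :: "qelt set \<Rightarrow> free_alg set ring" where
  "env L = tensor_ring L Quot env_ideal L"

definition env_class :: "qelt set \<Rightarrow> free_alg \<Rightarrow> free_alg set" where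
  "env_class L f = env_ideal L +>\<^bsub>tensor_ring L\<^esub> f"

section \<open>Vector spaces over \<open>\<complex>\<close>\<close>

text \<open>
  Vector spaces are module records over \<^term>\<open>class_ring :: complex ring\<close>.
  The fields \<open>mult\<close> and \<open>one\<close> of such a record have no meaning.
\<close>

definition free_vs :: "'a set \<Rightarrow> (complex, 'a \<Rightarrow>\<^sub>0 complex) module" where
  "free_vs S = \<lparr>carrier = {f. Poly_Mapping.keys f \<subseteq> S}, monoid.mult = (\<lambda>f g. 0), one = 0,
     zero = 0, add = (+), smult = pscale\<rparr>"

definition quot_vs :: "(complex, 'a) module \<Rightarrow> 'a set \<Rightarrow> (complex, 'a set) module" where
  "quot_vs V N = \<lparr>carrier = a_rcosets\<^bsub>V\<^esub> N, monoid.mult = (\<lambda>X Y. N), one = N,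
     zero = N, add = set_add V, smult = (\<lambda>c X. \<Union>x\<in>X. N +>\<^bsub>V\<^esub> (c \<odot>\<^bsub>V\<^esub> x))\<rparr>"

definition quot_map :: "(complex, 'a) module \<Rightarrow> 'a set \<Rightarrow> ('a \<Rightarrow> 'a) \<Rightarrow> 'a set \<Rightarrow> 'a set" where
  "quot_map V N f X = (\<Union>x\<in>X. N +>\<^bsub>V\<^esub> f x)"

definition invariant_subspace ::
    "qelt set \<Rightarrow> (complex, 'v) module \<Rightarrow> (qelt \<Rightarrow> 'v \<Rightarrow> 'v) \<Rightarrow> 'v set \<Rightarrow> bool" where
  "invariant_subspace L V \<rho> W \<longleftrightarrow>
     subspace class_ring W V \<and> (\<forall>x\<in>L. \<forall>w\<in>W. \<rho> x w \<in> W)"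

definition internal_direct_sum :: "(complex, 'v) module \<Rightarrow> 'i set \<Rightarrow> ('i \<Rightarrow> 'v set) \<Rightarrow> bool" where
  "internal_direct_sum V I W \<longleftrightarrow>
     (\<forall>i\<in>I. subspace class_ring (W i) V) \<and>
     (\<forall>v\<in>carrier V. \<exists>!f. f \<in> (\<Pi>\<^sub>E i\<in>I. W i) \<and> v = (\<Oplus>\<^bsub>V\<^esub>i\<in>I. f i))"

section \<open>The induced module and its irreducible quotient\<close>

text \<open>
  The linear functional by which \<open>parabolic n\<close> acts on \<open>\<complex>v\<^sub>0\<close>, and its extension to an algebra
  homomorphism on the tensor algebra; the latter gives the action of the enveloping algebra.
\<close>

definition v0_char :: "nat \<Rightarrow> qelt \<Rightarrow> complex" where
  "v0_char p x = of_nat p * Poly_Mapping.lookup x (0, 0, 0) + of_real (sqrt (real p)) * Poly_Mapping.lookup x (0, 0, 1)"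

definition tensor_char :: "(qelt \<Rightarrow> complex) \<Rightarrow> free_alg \<Rightarrow> complex" where
  "tensor_char \<chi> f =
     (\<Sum>w\<in>Poly_Mapping.keys f. Poly_Mapping.lookup f w * prod_list (map (\<lambda>(i, j, \<sigma>). \<chi> (q_e i j \<sigma>)) (letters w)))"

text \<open>
  \<open>U(G) \<otimes>\<^bsub>U(H)\<^esub> \<complex>\<close>, where \<open>H\<close> acts on \<open>\<complex>\<close> by \<open>\<chi>\<close>: the free vector space on \<open>U(G) \<times> \<complex>\<close> modulo
  bilinearity and \<open>(u h) \<otimes> z = u \<otimes> (h z)\<close> for \<open>h \<in> U(H)\<close>. Every \<open>h \<in> U(H)\<close> is the class of some
  \<open>f \<in> T(H)\<close>; it acts on \<open>U(G)\<close> from the right as multiplication by the class of \<open>f\<close> in \<open>U(G)\<close>, and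
  on \<open>\<complex>\<close> as \<open>tensor_char \<chi> f\<close>.
\<close>

definition pure_tensor :: "free_alg set \<Rightarrow> complex \<Rightarrow> (free_alg set \<times> complex) \<Rightarrow>\<^sub>0 complex" where
  "pure_tensor u z = Poly_Mapping.single (u, z) 1"

definition tensor_relations ::
    "qelt set \<Rightarrow> qelt set \<Rightarrow> (qelt \<Rightarrow> complex) \<Rightarrow> ((free_alg set \<times> complex) \<Rightarrow>\<^sub>0 complex) set" where
  "tensor_relations G H \<chi> =
     {pure_tensor (u \<oplus>\<^bsub>env G\<^esub> u') z - pure_tensor u z - pure_tensor u' z | u u' z.
        u \<in> carrier (env G) \<and> u' \<in> carrier (env G)}
   \<union> {pure_tensor u (z + z') - pure_tensor u z - pure_tensor u z' | u z z'. u \<in> carrier (env G)}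
   \<union> {pure_tensor (env_class G (scalar c) \<otimes>\<^bsub>env G\<^esub> u) z - pscale c (pure_tensor u z) | c u z. u \<in> carrier (env G)}
   \<union> {pure_tensor u (c * z) - pscale c (pure_tensor u z) | c u z. u \<in> carrier (env G)}
   \<union> {pure_tensor (u \<otimes>\<^bsub>env G\<^esub> env_class G f) z - pure_tensor u (tensor_char \<chi> f * z) | u f z.
        u \<in> carrier (env G) \<and> f \<in> tensor_alg H}"

definition tensor_free ::
    "qelt set \<Rightarrow> (complex, (free_alg set \<times> complex) \<Rightarrow>\<^sub>0 complex) module" where
  "tensor_free G = free_vs (carrier (env G) \<times> UNIV)"

definition tensor_kernel ::
    "qelt set \<Rightarrow> qelt set \<Rightarrow> (qelt \<Rightarrow> complex) \<Rightarrow> ((free_alg set \<times> complex) \<Rightarrow>\<^sub>0 complex) set" where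
  "tensor_kernel G H \<chi> =
     LinearCombinations.module.span class_ring (tensor_free G) (tensor_relations G H \<chi>)"

type_synonym ind = "((free_alg set \<times> complex) \<Rightarrow>\<^sub>0 complex) set"

definition induced :: "qelt set \<Rightarrow> qelt set \<Rightarrow> (qelt \<Rightarrow> complex) \<Rightarrow> (complex, ind) module" where
  "induced G H \<chi> = quot_vs (tensor_free G) (tensor_kernel G H \<chi>)"

definition induced_act ::
    "qelt set \<Rightarrow> qelt set \<Rightarrow> (qelt \<Rightarrow> complex) \<Rightarrow> qelt \<Rightarrow> ind \<Rightarrow> ind" where
  "induced_act G H \<chi> x = quot_map (tensor_free G) (tensor_kernel G H \<chi>)
     (\<lambda>f. \<Sum>(u, z)\<in>Poly_Mapping.keys f. pscale (Poly_Mapping.lookup f (u, z)) (pure_tensor (env_class G (embed x) \<otimes>\<^bsub>env G\<^esub> u) z))"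

definition Vbar :: "nat \<Rightarrow> nat \<Rightarrow> (complex, ind) module" where
  "Vbar n p = induced (q_alg n) (parabolic n) (v0_char p)"

definition Vbar_act :: "nat \<Rightarrow> nat \<Rightarrow> qelt \<Rightarrow> ind \<Rightarrow> ind" where
  "Vbar_act n p = induced_act (q_alg n) (parabolic n) (v0_char p)"

text \<open>
  The maximal proper submodule is unique: \<open>e\<^bsub>00\<^esub>\<close> (even) acts diagonalisably, and its eigenvalue \<open>p\<close>
  has an eigenspace spanned by the generator, so the sum of all proper submodules is proper.
\<close>

definition M_max :: "nat \<Rightarrow> nat \<Rightarrow> ind set" where
  "M_max n p = (THE M. maximal M
     (\<lambda>N. invariant_subspace (q_alg n) (Vbar n p) (Vbar_act n p) N \<and> N \<noteq> carrier (Vbar n p)))"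

definition V_irr :: "nat \<Rightarrow> nat \<Rightarrow> (complex, ind set) module" where
  "V_irr n p = quot_vs (Vbar n p) (M_max n p)"

definition V_act :: "nat \<Rightarrow> nat \<Rightarrow> qelt \<Rightarrow> ind set \<Rightarrow> ind set" where
  "V_act n p x = quot_map (Vbar n p) (M_max n p) (Vbar_act n p x)"

section \<open>Irreducible \<open>gl(n+1)\<close>-modules and highest weights\<close>

definition irreducible_gl_submodule ::
    "nat \<Rightarrow> (complex, 'v) module \<Rightarrow> (qelt \<Rightarrow> 'v \<Rightarrow> 'v) \<Rightarrow> 'v set \<Rightarrow> bool" where
  "irreducible_gl_submodule n V \<rho> W \<longleftrightarrow>
     invariant_subspace (gl_alg n) V \<rho> W \<and> W \<noteq> {\<zero>\<^bsub>V\<^esub>} \<and>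
     (\<forall>N. invariant_subspace (gl_alg n) V \<rho> N \<and> N \<subseteq> W \<longrightarrow> N = {\<zero>\<^bsub>V\<^esub>} \<or> N = W)"

definition has_highest_weight ::
    "nat \<Rightarrow> (complex, 'v) module \<Rightarrow> (qelt \<Rightarrow> 'v \<Rightarrow> 'v) \<Rightarrow> 'v set \<Rightarrow> (nat \<Rightarrow> int) \<Rightarrow> bool" where
  "has_highest_weight n V \<rho> W \<mu> \<longleftrightarrow>
     (\<exists>v\<in>W. v \<noteq> \<zero>\<^bsub>V\<^esub> \<and>
        (\<forall>i j. i < j \<and> j \<le> n \<longrightarrow> \<rho> (q_e i j 0) v = \<zero>\<^bsub>V\<^esub>) \<and>
        (\<forall>i\<le>n. \<rho> (q_e i i 0) v = of_int (\<mu> i) \<odot>\<^bsub>V\<^esub> v))"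

text \<open>The weight \<open>(p - i, 1, \<dots>, 1, 0, \<dots>, 0)\<close> with \<open>i\<close> ones, as a function of the position \<open>k\<close>.\<close>

definition hook_weight :: "nat \<Rightarrow> nat \<Rightarrow> nat \<Rightarrow> int" where
  "hook_weight p i k = (if k = 0 then int p - int i else if k \<le> i then 1 else 0)"

end

theory Submission
  imports Defs "HOL-Library.Function_Algebras" "HOL-Computational_Algebra.Formal_Power_Series"
begin

text \<open>
  The universal module is compared with polynomials in commuting variables \<open>x\<^sub>0, \<dots>, x\<^sub>n\<close> and
  anticommuting variables \<open>\<xi>\<^sub>0, \<dots>, \<xi>\<^sub>n\<close>. There \<open>q(n+1)\<close> acts by the first-order operators
  \<open>e\<^sub>i\<^sub>j\<^sup>0 = x\<^sub>i \<partial>\<^sub>x\<^sub>j + \<xi>\<^sub>i \<partial>\<^sub>\<xi>\<^sub>j\<close> and \<open>e\<^sub>i\<^sub>j\<^sup>1 = x\<^sub>i \<partial>\<^sub>\<xi>\<^sub>j + \<xi>\<^sub>i \<partial>\<^sub>x\<^sub>j\<close>.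
  The operator \<open>J = d - \<delta>\<close>, with the de Rham differential \<open>d = \<Sum> \<xi>\<^sub>k \<partial>\<^sub>x\<^sub>k\<close> and the Koszul differential
  \<open>\<delta> = \<Sum> x\<^sub>k \<partial>\<^sub>\<xi>\<^sub>k\<close>, anticommutes with the odd operators and satisfies \<open>J\<^sup>2 = - p\<close> in total degree \<open>p\<close>.
  Replacing \<open>e\<^sub>i\<^sub>j\<^sup>1\<close> by \<open>p\<^bsup>-1/2\<^esup> e\<^sub>i\<^sub>j\<^sup>1 J\<close> preserves the brackets and the parity, so the even
  part in degree \<open>p\<close> is an ungraded module; its element \<open>x\<^sub>0\<^sup>p\<close> satisfies the relations defining \<open>v\<^sub>0\<close>.

  For the Fischer inner product the adjoint of \<open>e\<^sub>i\<^sub>j\<close> is \<open>e\<^sub>j\<^sub>i\<close>, so orthogonal complements of submodules are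
  submodules, and a space in which every nonzero submodule contains the same nonzero vector is irreducible. Such
  a vector is \<open>x\<^sub>0\<^sup>p\<close> for \<open>q(n+1)\<close>, and for \<open>gl(n+1)\<close> it is the highest weight vector of each of the summands
  \<open>ker \<delta>\<close> and \<open>ker d\<close> of fixed \<open>\<xi>\<close>-degree, into which \<open>d \<delta> + \<delta> d = p\<close> splits the module.

  The kernel of the resulting map from the induced module is the maximal submodule: a vector with nonzero image
  generates one with image \<open>x\<^sub>0\<^sup>p\<close>, and a polynomial in \<open>e\<^sub>0\<^sub>0\<^sup>0\<close> that kills the weights below \<open>p\<close> sends this one
  to a nonzero multiple of \<open>v\<^sub>0\<close>. Only an upper bound for the weights of the induced module enters, not the
  Poincare-Birkhoff-Witt theorem.
\<close>

section \<open>Operators on the Fock space\<close>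

text \<open>The line of v_0 is not graded: e_00^1 acts by the scalar sqrt p, forced up to sign
  because its square is e_00^0. The plain odd operators exchange the two parities of the Fock space,
  so they have no such eigenvector of pure parity. The degree-p Fock space is the graded object of
  twice the size with the odd symmetry J, and composing with J folds it onto its even half. Hence
  every hook appears once: (p-i, 1^i) occurs as the kernel of the Koszul differential in xi-degree i
  and as the kernel of the de Rham differential in xi-degree i+1, and exactly one of these degrees
  is even. Likewise the dimension is half the coefficient of t^p in ((1+t)/(1-t))^(n+1). The
  enveloping algebra is given only by generators and relations: equalities in the induced module
  come from the relations, inequalities from an action. Therefore everything is computed on
  representatives in the free algebra, with \<open>\<Theta> f\<close> for f v_0 and
  \<open>\<Phi> f\<close> for its image f x_0^p.\<close>

text \<open>The pair \<open>(\<alpha>, S)\<close> stands for the monomial \<open>x\<^sup>\<alpha> \<xi>\<^sub>S\<close>, with the factors of \<open>\<xi>\<^sub>S\<close> in increasing order.\<close>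

type_synonym mon = "(nat \<Rightarrow> nat) \<times> nat set"

type_synonym fock = "mon \<Rightarrow> complex"

text \<open>Multiplication by x_k, written on coefficient functions: the coefficient at \<alpha>
  comes from the exponent one lower. Accordingly \<open>ban\<close> is the derivative in x_k, while
  \<open>fcr\<close> and \<open>fan\<close> are left multiplication by xi_k and the left derivative
  in xi_k.\<close>

definition bcr :: "nat \<Rightarrow> fock \<Rightarrow> fock" where
  "bcr k f = (\<lambda>(\<alpha>, S). if \<alpha> k = 0 then 0 else f (\<alpha>(k := \<alpha> k - 1), S))"

definition ban :: "nat \<Rightarrow> fock \<Rightarrow> fock" where
  "ban k f = (\<lambda>(\<alpha>, S). of_nat (Suc (\<alpha> k)) * f (\<alpha>(k := Suc (\<alpha> k)), S))"

text \<open>The sign of moving xi_k past the factors of smaller index, which restores increasing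
  order.\<close>

definition fsgn :: "nat \<Rightarrow> nat set \<Rightarrow> complex" where
  "fsgn k S = (- 1) ^ card {j \<in> S. j < k}"

definition fcr :: "nat \<Rightarrow> fock \<Rightarrow> fock" where
  "fcr k f = (\<lambda>(\<alpha>, S). if k \<in> S then fsgn k S * f (\<alpha>, S - {k}) else 0)"

definition fan :: "nat \<Rightarrow> fock \<Rightarrow> fock" where
  "fan k f = (\<lambda>(\<alpha>, S). if k \<in> S then 0 else fsgn k S * f (\<alpha>, insert k S))"

definition sc :: "complex \<Rightarrow> ('a \<Rightarrow> complex) \<Rightarrow> 'a \<Rightarrow> complex" where
  "sc c f = (\<lambda>m. c * f m)"

lemma sc_apply: "sc c f m = c * f m"
  by (simp add: sc_def)

lemma sc_simps [simp]: "sc 0 f = 0" "sc c 0 = 0" "sc 1 f = f" "sc a (sc b f) = sc (a * b) f"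
  by (auto simp: sc_def fun_eq_iff)

lemma sc_add: "sc c (f + g) = sc c f + sc c g" "sc (a + b) f = sc a f + sc b f"
  by (auto simp: sc_def fun_eq_iff algebra_simps)

lemma sc_diff: "sc c (f - g) = sc c f - sc c g" "sc (a - b) f = sc a f - sc b f"
  by (auto simp: sc_def fun_eq_iff algebra_simps)

lemma sc_minus: "sc c (- f) = - sc c f" "sc (- c) f = - sc c f"
  by (auto simp: sc_def fun_eq_iff)

lemma sum_fun_apply: "(\<Sum>i\<in>A. f i) x = (\<Sum>i\<in>A. f i x)" for f :: "_ \<Rightarrow> _ \<Rightarrow> complex"
  by (induction A rule: infinite_finite_induct) auto

definition linop :: "(('a \<Rightarrow> complex) \<Rightarrow> ('b \<Rightarrow> complex)) \<Rightarrow> bool" where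
  "linop T \<longleftrightarrow> (\<forall>f g. T (f + g) = T f + T g) \<and> (\<forall>c f. T (sc c f) = sc c (T f))"

lemma linopI: "(\<And>f g. T (f + g) = T f + T g) \<Longrightarrow> (\<And>c f. T (sc c f) = sc c (T f)) \<Longrightarrow> linop T"
  by (auto simp: linop_def)

lemma
  assumes "linop T"
  shows linop_add: "T (f + g) = T f + T g"
    and linop_sc: "T (sc c f) = sc c (T f)"
    and linop_zero: "T 0 = 0"
    and linop_minus: "T (- f) = - T f"
    and linop_diff: "T (f - g) = T f - T g"
proof -
  show a: "T (f + g) = T f + T g" and s: "T (sc c f) = sc c (T f)" for f g c
    using assms by (auto simp: linop_def)
  show "T 0 = 0"
    using s[of 0 0] by simp
  show m: "T (- f) = - T f" for f
    using s[of "-1" f] by (simp add: sc_minus)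
  show "T (f - g) = T f - T g"
    using a[of f "- g"] m[of g] by simp
qed

lemma linop_sum:
  assumes "linop T"
  shows "T (sum h I) = (\<Sum>i\<in>I. T (h i))"
  by (induction I rule: infinite_finite_induct) (simp_all only: sum.infinite sum.empty sum.insert linop_add[OF assms] linop_zero[OF assms] not_False_eq_True)

lemma linop_setsum: "(\<And>i. i \<in> I \<Longrightarrow> linop (T i)) \<Longrightarrow> linop (\<lambda>f. \<Sum>i\<in>I. T i f)"
  by (induction I rule: infinite_finite_induct)
    (auto simp: linop_def sc_add algebra_simps)

lemma linop_fock: "linop (bcr k)" "linop (ban k)" "linop (fcr k)" "linop (fan k)"
  by (auto simp: linop_def bcr_def ban_def fcr_def fan_def sc_def fun_eq_iff algebra_simps)

lemmas fock_lin [simp] =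
  linop_fock[THEN linop_add] linop_fock[THEN linop_sc] linop_fock[THEN linop_zero]
  linop_fock[THEN linop_minus] linop_fock[THEN linop_diff]

lemma fsgn_square: "fsgn k S * fsgn k S = 1"
  by (simp add: fsgn_def flip: power_mult_distrib)

lemma fsgn_square': "fsgn k S * (fsgn k S * c) = c"
  by (simp add: fsgn_square flip: mult.assoc)

lemma fsgn_nonzero [simp]: "fsgn k S \<noteq> 0"
  by (simp add: fsgn_def)

lemma fsgn_self [simp]: "fsgn k (insert k S) = fsgn k S" "fsgn k (S - {k}) = fsgn k S"
proof -
  have "{j \<in> insert k S. j < k} = {j \<in> S. j < k}" "{j \<in> S - {k}. j < k} = {j \<in> S. j < k}"
    by auto
  then show "fsgn k (insert k S) = fsgn k S" "fsgn k (S - {k}) = fsgn k S"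
    by (simp_all add: fsgn_def)
qed

lemma fsgn_insert:
  assumes "j \<notin> S"
  shows "fsgn k (insert j S) = (if j < k then - fsgn k S else fsgn k S)"
proof -
  have "{i \<in> insert j S. i < k} = (if j < k then insert j {i \<in> S. i < k} else {i \<in> S. i < k})"
    by auto
  then show ?thesis
    using assms by (simp add: fsgn_def)
qed

lemma fsgn_remove:
  assumes "j \<in> S"
  shows "fsgn k (S - {j}) = (if j < k then - fsgn k S else fsgn k S)"
  using fsgn_insert[of j "S - {j}" k] assms by (auto simp: insert_absorb split: if_splits)

lemma ban_bcr: "ban i (bcr j f) = bcr j (ban i f) + (if i = j then f else 0)"
  by (rule ext) (auto simp: ban_def bcr_def fun_upd_twist algebra_simps)

lemma bcr_bcr: "bcr i (bcr j f) = bcr j (bcr i f)"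
  by (rule ext) (auto simp: bcr_def fun_upd_twist)

lemma ban_ban: "ban i (ban j f) = ban j (ban i f)"
  by (rule ext, cases "i = j") (auto simp: ban_def fun_upd_twist)

lemma fcr_fcr: "fcr i (fcr j f) = - fcr j (fcr i f)"
proof (rule ext)
  fix m :: "mon"
  obtain \<alpha> S where m: "m = (\<alpha>, S)" by (cases m)
  have "S - {i} - {j} = S - {j} - {i}" by auto
  then show "fcr i (fcr j f) m = (- fcr j (fcr i f)) m"
    by (cases "i = j") (auto simp: m fcr_def fsgn_remove)
qed

lemma fan_fan: "fan i (fan j f) = - fan j (fan i f)"
  by (rule ext, cases "i = j") (auto simp: fan_def fsgn_insert insert_commute)

lemma fan_fcr: "fan i (fcr j f) = (if i = j then f else 0) - fcr j (fan i f)"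
proof (rule ext)
  fix m :: "mon"
  obtain \<alpha> S where m: "m = (\<alpha>, S)" by (cases m)
  have "i \<noteq> j \<Longrightarrow> insert i S - {j} = insert i (S - {j})" by auto
  then show "fan i (fcr j f) m = ((if i = j then f else 0) - fcr j (fan i f)) m"
    by (auto simp: m fan_def fcr_def fsgn_insert fsgn_remove fsgn_square' insert_absorb)
qed

lemma fermi_bose:
  "fcr i (bcr j f) = bcr j (fcr i f)" "fcr i (ban j f) = ban j (fcr i f)"
  "fan i (bcr j f) = bcr j (fan i f)" "fan i (ban j f) = ban j (fan i f)"
  by (rule ext; auto simp: bcr_def ban_def fcr_def fan_def)+

section \<open>The operators of q(n+1) and the two differentials\<close>

definition E0 :: "nat \<Rightarrow> nat \<Rightarrow> fock \<Rightarrow> fock" where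
  "E0 i j f = bcr i (ban j f) + fcr i (fan j f)"

definition E1 :: "nat \<Rightarrow> nat \<Rightarrow> fock \<Rightarrow> fock" where
  "E1 i j f = bcr i (fan j f) + fcr i (ban j f)"

lemma linop_E: "linop (E0 i j)" "linop (E1 i j)"
  by (simp_all add: linop_def E0_def E1_def sc_add)

lemmas E_lin [simp] =
  linop_E[THEN linop_add] linop_E[THEN linop_sc] linop_E[THEN linop_zero]
  linop_E[THEN linop_minus] linop_E[THEN linop_diff]

lemma E0_comm:
  "E0 i j (bcr k f) = bcr k (E0 i j f) + (if j = k then bcr i f else 0)"
  "E0 i j (fcr k f) = fcr k (E0 i j f) + (if j = k then fcr i f else 0)"
  "E0 i j (ban k f) = ban k (E0 i j f) - (if i = k then ban j f else 0)"
  "E0 i j (fan k f) = fan k (E0 i j f) - (if i = k then fan j f else 0)"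
  by (simp_all add: E0_def ban_bcr fermi_bose fan_fcr bcr_bcr[of i k] ban_ban[of j k] fcr_fcr[of i k] fan_fan[of j k])

lemma E1_comm:
  "E1 i j (bcr k f) = bcr k (E1 i j f) + (if j = k then fcr i f else 0)"
  "E1 i j (fcr k f) = - fcr k (E1 i j f) + (if j = k then bcr i f else 0)"
  "E1 i j (ban k f) = ban k (E1 i j f) - (if i = k then fan j f else 0)"
  "E1 i j (fan k f) = - fan k (E1 i j f) + (if i = k then ban j f else 0)"
  by (simp_all add: E1_def ban_bcr fermi_bose fan_fcr bcr_bcr[of i k] ban_ban[of j k] fcr_fcr[of i k] fan_fan[of j k])

lemma E0_E0: "E0 i j (E0 k l f) - E0 k l (E0 i j f) =
    (if j = k then E0 i l f else 0) - (if i = l then E0 k j f else 0)"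
  by (subst (2) E0_def) (auto simp: E0_comm, auto simp: E0_def)

lemma E0_E1: "E0 i j (E1 k l f) - E1 k l (E0 i j f) =
    (if j = k then E1 i l f else 0) - (if i = l then E1 k j f else 0)"
  by (subst (1) E1_def) (auto simp: E0_comm, auto simp: E1_def)

lemma E1_E0: "E1 i j (E0 k l f) - E0 k l (E1 i j f) =
    (if j = k then E1 i l f else 0) - (if i = l then E1 k j f else 0)"
proof -
  have "E1 i j (E0 k l f) - E0 k l (E1 i j f) = - (E0 k l (E1 i j f) - E1 i j (E0 k l f))"
    by (simp only: minus_diff_eq)
  also have "\<dots> = (if j = k then E1 i l f else 0) - (if i = l then E1 k j f else 0)"
    unfolding E0_E1 minus_diff_eq eq_commute[of k j] eq_commute[of l i] ..
  finally show ?thesis .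
qed

lemma E1_E1: "E1 i j (E1 k l f) + E1 k l (E1 i j f) =
    (if j = k then E0 i l f else 0) + (if i = l then E0 k j f else 0)"
  by (subst (2) E1_def) (auto simp: E1_comm, auto simp: E1_def E0_def)

definition dd :: "nat \<Rightarrow> fock \<Rightarrow> fock" where
  "dd n f = (\<Sum>k\<le>n. fcr k (ban k f))"

definition dl :: "nat \<Rightarrow> fock \<Rightarrow> fock" where
  "dl n f = (\<Sum>k\<le>n. bcr k (fan k f))"

definition Deg :: "nat \<Rightarrow> fock \<Rightarrow> fock" where
  "Deg n f = (\<Sum>k\<le>n. bcr k (ban k f) + fcr k (fan k f))"

lemma linop_dd: "linop (dd n)" "linop (dl n)"
  unfolding dd_def dl_def by (rule linop_setsum; simp add: linop_def)+

lemmas dd_lin [simp] =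
  linop_dd[THEN linop_add] linop_dd[THEN linop_sc] linop_dd[THEN linop_zero]
  linop_dd[THEN linop_minus] linop_dd[THEN linop_diff]

lemma sum_delta_fun:
  fixes n k :: nat and g :: fock
  assumes "k \<le> n"
  shows "(\<Sum>l\<le>n. if l = k then g else 0) = g"
  using assms by (subst sum.delta) simp_all

text \<open>The commutator yields one term at \<open>k = j\<close> and the same term with the
  opposite sign at \<open>k = i\<close>. The bounds on \<open>i\<close> and \<open>j\<close> put
  both indices into the range of summation.\<close>

lemma E0_dd:
  assumes "i \<le> n" "j \<le> n"
  shows "E0 i j (dd n f) = dd n (E0 i j f)" (is ?dd) "E0 i j (dl n f) = dl n (E0 i j f)" (is ?dl)
proof -
  have 1: "E0 i j (fcr k (ban k f)) = fcr k (ban k (E0 i j f)) +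
      ((if k = j then fcr i (ban j f) else 0) - (if k = i then fcr i (ban j f) else 0))" for k
    by (auto simp: E0_comm)
  show ?dd
    unfolding dd_def linop_sum[OF linop_E(1)] 1 sum.distrib sum_subtractf
      sum_delta_fun[OF assms(1)] sum_delta_fun[OF assms(2)] by simp
  have 2: "E0 i j (bcr k (fan k f)) = bcr k (fan k (E0 i j f)) +
      ((if k = j then bcr i (fan j f) else 0) - (if k = i then bcr i (fan j f) else 0))" for k
    by (auto simp: E0_comm)
  show ?dl
    unfolding dl_def linop_sum[OF linop_E(1)] 2 sum.distrib sum_subtractf
      sum_delta_fun[OF assms(1)] sum_delta_fun[OF assms(2)] by simp
qed

text \<open>The anticommutator collects the two halves of \<open>E0 i j\<close>, one at
  \<open>k = i\<close> and one at \<open>k = j\<close>, and it is the same for \<open>dd\<close> and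
  \<open>dl\<close>. Hence the difference \<open>JJ\<close> anticommutes with \<open>E1 i j\<close>,
  whereas the sum would not.\<close>

lemma E1_dd:
  assumes "i \<le> n" "j \<le> n"
  shows "E1 i j (dd n f) = E0 i j f - dd n (E1 i j f)" (is ?dd)
    and "E1 i j (dl n f) = E0 i j f - dl n (E1 i j f)" (is ?dl)
proof -
  have 1: "E1 i j (fcr k (ban k f)) = (if k = i then fcr i (fan j f) else 0)
      + (if k = j then bcr i (ban j f) else 0) - fcr k (ban k (E1 i j f))" for k
    by (auto simp: E1_comm)
  show ?dd
    unfolding dd_def linop_sum[OF linop_E(2)] 1 sum.distrib sum_subtractf
      sum_delta_fun[OF assms(1)] sum_delta_fun[OF assms(2)] by (simp add: E0_def)
  have 2: "E1 i j (bcr k (fan k f)) = (if k = i then bcr i (ban j f) else 0)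
      + (if k = j then fcr i (fan j f) else 0) - bcr k (fan k (E1 i j f))" for k
    by (auto simp: E1_comm)
  show ?dl
    unfolding dl_def linop_sum[OF linop_E(2)] 2 sum.distrib sum_subtractf
      sum_delta_fun[OF assms(1)] sum_delta_fun[OF assms(2)] by (simp add: E0_def)
qed

lemma dd_comm:
  shows "dd n (fcr k f) = - fcr k (dd n f)"
    and "dd n (ban k f) = ban k (dd n f)"
    and "k \<le> n \<Longrightarrow> dd n (bcr k f) = bcr k (dd n f) + fcr k f"
    and "k \<le> n \<Longrightarrow> dd n (fan k f) = ban k f - fan k (dd n f)"
proof -
  have 1: "fcr l (ban l (fcr k f)) = - fcr k (fcr l (ban l f))" for l
    by (simp add: fcr_fcr[of l k] flip: fermi_bose)
  show "dd n (fcr k f) = - fcr k (dd n f)"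
    unfolding dd_def linop_sum[OF linop_fock(3)] 1 sum_negf ..
  have 2: "fcr l (ban l (ban k f)) = ban k (fcr l (ban l f))" for l
    by (simp add: ban_ban[of l k] fermi_bose)
  show "dd n (ban k f) = ban k (dd n f)"
    unfolding dd_def linop_sum[OF linop_fock(2)] 2 ..
  have 3: "fcr l (ban l (bcr k f)) = bcr k (fcr l (ban l f)) + (if l = k then fcr k f else 0)" for l
    by (auto simp: ban_bcr fermi_bose)
  show "dd n (bcr k f) = bcr k (dd n f) + fcr k f" if "k \<le> n"
    unfolding dd_def linop_sum[OF linop_fock(1)] 3 sum.distrib sum_delta_fun[OF that] ..
  have 4: "fcr l (ban l (fan k f)) = (if l = k then ban k f else 0) - fan k (fcr l (ban l f))" for l
    by (auto simp: fan_fcr fermi_bose)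
  show "dd n (fan k f) = ban k f - fan k (dd n f)" if "k \<le> n"
    unfolding dd_def linop_sum[OF linop_fock(4)] 4 sum_subtractf sum_delta_fun[OF that] ..
qed

lemma dl_comm:
  shows "dl n (bcr k f) = bcr k (dl n f)"
    and "dl n (fan k f) = - fan k (dl n f)"
proof -
  have 1: "bcr l (fan l (bcr k f)) = bcr k (bcr l (fan l f))" for l
    by (simp add: bcr_bcr[of l k] fermi_bose)
  show "dl n (bcr k f) = bcr k (dl n f)"
    unfolding dl_def linop_sum[OF linop_fock(1)] 1 ..
  have 2: "bcr l (fan l (fan k f)) = - fan k (bcr l (fan l f))" for l
    by (simp add: fan_fan[of l k] fermi_bose)
  show "dl n (fan k f) = - fan k (dl n f)"
    unfolding dl_def linop_sum[OF linop_fock(4)] 2 sum_negf ..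
qed

lemma fock_self_neg: "f = - f \<Longrightarrow> f = 0" for f :: fock
  by (auto simp: fun_eq_iff)

text \<open>\<open>dd n\<close> anticommutes with each of its own summands, so its square equals its
  own negative.\<close>

lemma dd_dd: "dd n (dd n f) = 0"
proof (rule fock_self_neg)
  show "dd n (dd n f) = - dd n (dd n f)"
    by (subst (2) dd_def) (simp only: linop_sum[OF linop_dd(1)] dd_comm sum_negf dd_def[of n "dd n f"])
qed

lemma dl_dl: "dl n (dl n f) = 0"
proof (rule fock_self_neg)
  show "dl n (dl n f) = - dl n (dl n f)"
    by (subst (2) dl_def)
      (simp only: linop_sum[OF linop_dd(2)] dl_comm sum_negf dl_def[of n "dl n f"] fock_lin)
qed

text \<open>Cartan's formula for the Euler field: carrying \<open>dd n\<close> past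
  \<open>bcr k\<close> and \<open>fan k\<close> leaves the number operators of x_k and xi_k.\<close>

lemma dd_dl: "dd n (dl n f) + dl n (dd n f) = Deg n f"
proof -
  have "dd n (bcr k (fan k f)) = (bcr k (ban k f) + fcr k (fan k f)) - bcr k (fan k (dd n f))"
    if "k \<in> {..n}" for k
    using that by (simp add: dd_comm)
  then have "dd n (dl n f) = Deg n f - dl n (dd n f)"
    unfolding Deg_def dl_def linop_sum[OF linop_dd(1)] by (simp only: sum_subtractf cong: sum.cong)
  then show ?thesis by simp
qed

definition JJ :: "nat \<Rightarrow> fock \<Rightarrow> fock" where
  "JJ n f = dd n f - dl n f"

lemma linop_JJ: "linop (JJ n)"
  by (simp add: linop_def JJ_def sc_diff)

lemmas JJ_lin [simp] =
  linop_JJ[THEN linop_add] linop_JJ[THEN linop_sc] linop_JJ[THEN linop_zero]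
  linop_JJ[THEN linop_minus] linop_JJ[THEN linop_diff]

lemma JJ_JJ: "JJ n (JJ n f) = - Deg n f"
  unfolding JJ_def by (simp add: dd_dd dl_dl flip: dd_dl)

lemma E_JJ:
  assumes "i \<le> n" "j \<le> n"
  shows "E0 i j (JJ n f) = JJ n (E0 i j f)" "E1 i j (JJ n f) = - JJ n (E1 i j f)"
  using assms by (simp_all add: JJ_def E0_dd E1_dd)

section \<open>Homogeneous components and the action of the superalgebra\<close>

definition mons :: "nat \<Rightarrow> nat \<Rightarrow> nat set \<Rightarrow> mon set" where
  "mons n p B = {(\<alpha>, S). (\<forall>k>n. \<alpha> k = 0) \<and> S \<subseteq> {..n} \<and> (\<Sum>k\<le>n. \<alpha> k) + card S = p \<and> card S \<in> B}"

definition Fk :: "nat \<Rightarrow> nat \<Rightarrow> nat set \<Rightarrow> fock set" where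
  "Fk n p B = {f. \<forall>m. f m \<noteq> 0 \<longrightarrow> m \<in> mons n p B}"

lemma FkI: "(\<And>m. f m \<noteq> 0 \<Longrightarrow> m \<in> mons n p B) \<Longrightarrow> f \<in> Fk n p B"
  by (auto simp: Fk_def)

lemma FkD: "f \<in> Fk n p B \<Longrightarrow> f m \<noteq> 0 \<Longrightarrow> m \<in> mons n p B"
  unfolding Fk_def by blast

lemma mons_mono: "B \<subseteq> B' \<Longrightarrow> mons n p B \<subseteq> mons n p B'"
  by (auto simp: mons_def)

lemma Fk_mono: "B \<subseteq> B' \<Longrightarrow> Fk n p B \<subseteq> Fk n p B'"
  using mons_mono[of B B' n p] by (blast intro: FkI dest: FkD)

lemma sum_upd:
  fixes \<alpha> :: "nat \<Rightarrow> nat"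
  assumes "i \<le> n"
  shows "(\<Sum>k\<le>n. (\<alpha>(i := x)) k) + \<alpha> i = (\<Sum>k\<le>n. \<alpha> k) + x"
proof -
  have "(\<Sum>k\<le>n. (\<alpha>(i := x)) k) = x + (\<Sum>k\<in>{..n} - {i}. (\<alpha>(i := x)) k)"
    using assms by (subst sum.remove[of _ i]) auto
  also have "(\<Sum>k\<in>{..n} - {i}. (\<alpha>(i := x)) k) = (\<Sum>k\<in>{..n} - {i}. \<alpha> k)"
    by (rule sum.cong) auto
  finally show ?thesis
    using assms by (subst sum.remove[of "{..n}" i \<alpha>]) auto
qed

lemma mons_bump:
  assumes "i \<le> n"
  shows "(\<alpha>(i := Suc (\<alpha> i)), S) \<in> mons n (Suc p) B \<longleftrightarrow> (\<alpha>, S) \<in> mons n p B"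
  using sum_upd[OF assms, of \<alpha> "Suc (\<alpha> i)"] assms by (auto simp: mons_def)

lemma mons_drop:
  assumes "i \<le> n" "\<alpha> i \<noteq> 0"
  shows "(\<alpha>(i := \<alpha> i - 1), S) \<in> mons n p B \<longleftrightarrow> (\<alpha>, S) \<in> mons n (Suc p) B"
  using mons_bump[OF assms(1), of "\<alpha>(i := \<alpha> i - 1)" S p B] assms(2) by simp

lemma mons_insert:
  assumes "i \<le> n" "i \<notin> S"
  shows "(\<alpha>, insert i S) \<in> mons n (Suc p) B \<longleftrightarrow> (\<alpha>, S) \<in> mons n p {b. Suc b \<in> B}"
proof -
  have "S \<subseteq> {..n} \<Longrightarrow> card (insert i S) = Suc (card S)"
    using assms(2) finite_subset[of S "{..n}"] by auto
  then show ?thesis using assms by (auto simp: mons_def)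
qed

lemma mons_remove:
  assumes "i \<le> n" "i \<in> S"
  shows "(\<alpha>, S - {i}) \<in> mons n p {b. Suc b \<in> B} \<longleftrightarrow> (\<alpha>, S) \<in> mons n (Suc p) B"
  using mons_insert[OF assms(1), of "S - {i}" \<alpha> p B] assms(2) by (simp add: insert_absorb)

lemma bcr_Fk:
  assumes "f \<in> Fk n p B" "i \<le> n"
  shows "bcr i f \<in> Fk n (Suc p) B"
proof (rule FkI)
  fix m assume m: "bcr i f m \<noteq> 0"
  obtain \<alpha> S where [simp]: "m = (\<alpha>, S)" by (cases m)
  have "\<alpha> i \<noteq> 0" "f (\<alpha>(i := \<alpha> i - 1), S) \<noteq> 0"
    using m by (auto simp: bcr_def split: if_splits)
  then show "m \<in> mons n (Suc p) B"
    using FkD[OF assms(1)] mons_drop[OF assms(2), of \<alpha> S p B] by simp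
qed

lemma ban_Fk:
  assumes "f \<in> Fk n (Suc p) B" "i \<le> n"
  shows "ban i f \<in> Fk n p B"
proof (rule FkI)
  fix m assume m: "ban i f m \<noteq> 0"
  obtain \<alpha> S where [simp]: "m = (\<alpha>, S)" by (cases m)
  have "f (\<alpha>(i := Suc (\<alpha> i)), S) \<noteq> 0"
    using m by (auto simp: ban_def)
  then show "m \<in> mons n p B"
    using FkD[OF assms(1)] mons_bump[OF assms(2), of \<alpha> S p B] by simp
qed

lemma fan_Fk:
  assumes "f \<in> Fk n (Suc p) B" "i \<le> n"
  shows "fan i f \<in> Fk n p {b. Suc b \<in> B}"
proof (rule FkI)
  fix m assume m: "fan i f m \<noteq> 0"
  obtain \<alpha> S where [simp]: "m = (\<alpha>, S)" by (cases m)
  have "i \<notin> S" "f (\<alpha>, insert i S) \<noteq> 0"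
    using m by (auto simp: fan_def split: if_splits)
  then show "m \<in> mons n p {b. Suc b \<in> B}"
    using FkD[OF assms(1)] mons_insert[OF assms(2), of S \<alpha> p B] by simp
qed

lemma fcr_Fk:
  assumes "f \<in> Fk n p B" "i \<le> n"
  shows "fcr i f \<in> Fk n (Suc p) (Suc ` B)"
proof (rule FkI)
  fix m assume m: "fcr i f m \<noteq> 0"
  obtain \<alpha> S where [simp]: "m = (\<alpha>, S)" by (cases m)
  have "i \<in> S" "f (\<alpha>, S - {i}) \<noteq> 0"
    using m by (auto simp: fcr_def split: if_splits)
  moreover have "{b. Suc b \<in> Suc ` B} = B" by auto
  ultimately show "m \<in> mons n (Suc p) (Suc ` B)"
    using FkD[OF assms(1)] mons_remove[OF assms(2), of S \<alpha> p "Suc ` B"] by simp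
qed

definition subsp :: "('a \<Rightarrow> complex) set \<Rightarrow> bool" where
  "subsp N \<longleftrightarrow> 0 \<in> N \<and> (\<forall>f\<in>N. \<forall>g\<in>N. f + g \<in> N) \<and> (\<forall>c. \<forall>f\<in>N. sc c f \<in> N)"

lemma
  assumes "subsp N"
  shows subsp_zero: "0 \<in> N"
    and subsp_add: "f \<in> N \<Longrightarrow> g \<in> N \<Longrightarrow> f + g \<in> N"
    and subsp_sc: "f \<in> N \<Longrightarrow> sc c f \<in> N"
    and subsp_minus: "f \<in> N \<Longrightarrow> - f \<in> N"
    and subsp_diff: "f \<in> N \<Longrightarrow> g \<in> N \<Longrightarrow> f - g \<in> N"
    and subsp_sum: "(\<And>i. i \<in> I \<Longrightarrow> h i \<in> N) \<Longrightarrow> sum h I \<in> N"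
proof -
  show z: "0 \<in> N" and a: "f \<in> N \<Longrightarrow> g \<in> N \<Longrightarrow> f + g \<in> N" and s: "f \<in> N \<Longrightarrow> sc c f \<in> N" for f g c
    using assms by (auto simp: subsp_def)
  show m: "f \<in> N \<Longrightarrow> - f \<in> N" for f
    using s[of f "-1"] by (simp add: sc_minus)
  show "f \<in> N \<Longrightarrow> g \<in> N \<Longrightarrow> f - g \<in> N"
    using a[of f "- g"] m[of g] by simp
  show "(\<And>i. i \<in> I \<Longrightarrow> h i \<in> N) \<Longrightarrow> sum h I \<in> N"
    by (induction I rule: infinite_finite_induct) (simp_all only: sum.infinite sum.empty sum.insert z a insertI1 insertI2 not_False_eq_True)
qed

lemma subsp_Fk: "subsp (Fk n p B)"
  unfolding subsp_def
proof (intro conjI ballI allI)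
  show "0 \<in> Fk n p B" by (rule FkI) simp
next
  fix f g assume "f \<in> Fk n p B" "g \<in> Fk n p B"
  then show "f + g \<in> Fk n p B"
    by (intro FkI) (metis FkD add.right_neutral plus_fun_apply)
next
  fix c f assume "f \<in> Fk n p B"
  then show "sc c f \<in> Fk n p B"
    by (intro FkI) (metis FkD mult_zero_right sc_apply)
qed

text \<open>The degree is a successor because each operator first removes one factor, landing in
  degree \<open>q\<close>, and then restores one. Only the mixed products change the
  xi-degree.\<close>

lemma E_Fk:
  assumes "f \<in> Fk n (Suc q) B" "i \<le> n" "j \<le> n"
  shows "bcr i (ban j f) \<in> Fk n (Suc q) B" "fcr i (fan j f) \<in> Fk n (Suc q) B"
    and "bcr i (fan j f) \<in> Fk n (Suc q) {b. Suc b \<in> B}" "fcr i (ban j f) \<in> Fk n (Suc q) (Suc ` B)"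
proof -
  show "bcr i (ban j f) \<in> Fk n (Suc q) B" "bcr i (fan j f) \<in> Fk n (Suc q) {b. Suc b \<in> B}"
    "fcr i (ban j f) \<in> Fk n (Suc q) (Suc ` B)"
    using assms by (auto intro!: bcr_Fk fcr_Fk ban_Fk fan_Fk)
  have "fcr i (fan j f) \<in> Fk n (Suc q) (Suc ` {b. Suc b \<in> B})"
    using assms by (intro fcr_Fk fan_Fk)
  then show "fcr i (fan j f) \<in> Fk n (Suc q) B"
    using Fk_mono[of "Suc ` {b. Suc b \<in> B}" B] by auto
qed

lemma E0_Fk: "f \<in> Fk n (Suc q) B \<Longrightarrow> i \<le> n \<Longrightarrow> j \<le> n \<Longrightarrow> E0 i j f \<in> Fk n (Suc q) B"
  unfolding E0_def by (intro subsp_add[OF subsp_Fk] E_Fk)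

lemma dd_Fk: "f \<in> Fk n (Suc q) B \<Longrightarrow> dd n f \<in> Fk n (Suc q) (Suc ` B)"
  unfolding dd_def by (intro subsp_sum[OF subsp_Fk] E_Fk) auto

lemma dl_Fk: "f \<in> Fk n (Suc q) B \<Longrightarrow> dl n f \<in> Fk n (Suc q) {b. Suc b \<in> B}"
  unfolding dl_def by (intro subsp_sum[OF subsp_Fk] E_Fk) auto

lemma E1_Fk:
  assumes "f \<in> Fk n (Suc q) B" "i \<le> n" "j \<le> n" "Suc ` B \<subseteq> C" "{b. Suc b \<in> B} \<subseteq> C"
  shows "E1 i j f \<in> Fk n (Suc q) C"
  unfolding E1_def
  using E_Fk[OF assms(1-3)] Fk_mono[OF assms(4)] Fk_mono[OF assms(5)]
  by (intro subsp_add[OF subsp_Fk]) blast+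

lemma JJ_Fk:
  assumes "f \<in> Fk n (Suc q) B" "Suc ` B \<subseteq> C" "{b. Suc b \<in> B} \<subseteq> C"
  shows "JJ n f \<in> Fk n (Suc q) C"
  unfolding JJ_def
  using dd_Fk[OF assms(1)] dl_Fk[OF assms(1)] Fk_mono[OF assms(2)] Fk_mono[OF assms(3)]
  by (intro subsp_diff[OF subsp_Fk]) blast+

lemma number_ops:
  "bcr k (ban k f) (\<alpha>, S) = of_nat (\<alpha> k) * f (\<alpha>, S)"
  "fcr k (fan k f) (\<alpha>, S) = (if k \<in> S then f (\<alpha>, S) else 0)"
  by (auto simp: bcr_def ban_def fcr_def fan_def fsgn_square' insert_absorb simp del: of_nat_Suc)

lemma sum_indicator:
  fixes n :: nat and c :: complex
  shows "S \<subseteq> {..n} \<Longrightarrow> (\<Sum>k\<le>n. if k \<in> S then c else 0) = of_nat (card S) * c"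
  by (simp add: sum.If_cases Int_absorb1 Int_def[symmetric])

lemma Deg_Fk:
  assumes "f \<in> Fk n p B"
  shows "Deg n f = sc (of_nat p) f"
proof
  fix m :: "mon"
  obtain \<alpha> S where m: "m = (\<alpha>, S)" by (cases m)
  have "Deg n f m = (\<Sum>k\<le>n. of_nat (\<alpha> k) * f m + (if k \<in> S then f m else 0))"
    by (simp add: Deg_def sum_fun_apply number_ops m cong: if_cong)
  also have "\<dots> = sc (of_nat p) f m"
  proof (cases "f m = 0")
    case False
    then have "m \<in> mons n p B" using FkD[OF assms] by blast
    then have S: "S \<subseteq> {..n}" and p: "(\<Sum>k\<le>n. \<alpha> k) + card S = p"
      by (auto simp: mons_def m)
    show ?thesis
      by (simp add: sum.distrib sum_indicator[OF S] sc_def flip: sum_distrib_right p)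
        (simp add: algebra_simps)
  qed (simp add: sc_def)
  finally show "Deg n f m = sc (of_nat p) f m" .
qed

lemma JJ_JJ_Fk: "f \<in> Fk n p B \<Longrightarrow> JJ n (JJ n f) = sc (- of_nat p) f"
  by (simp add: JJ_JJ Deg_Fk sc_minus)

definition csq :: "nat \<Rightarrow> complex" where
  "csq p = of_real (sqrt (real p))"

lemma csq_square: "csq p * csq p = of_nat p"
  by (simp add: csq_def flip: of_real_mult)

lemma csq_nonzero: "p > 0 \<Longrightarrow> csq p \<noteq> 0"
  by (simp add: csq_def)

definition rho :: "nat \<Rightarrow> nat \<Rightarrow> qidx \<Rightarrow> fock \<Rightarrow> fock" where
  "rho n p = (\<lambda>(i, j, \<sigma>) f. if \<sigma> = 0 then E0 i j f else sc (1 / csq p) (E1 i j (JJ n f)))"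

lemma rho_simps: "rho n p (i, j, 0) f = E0 i j f" "rho n p (i, j, 1) f = sc (1 / csq p) (E1 i j (JJ n f))"
  by (simp_all add: rho_def)

lemma linop_rho: "linop (rho n p a)"
  by (cases a) (auto simp: linop_def rho_def sc_add mult.commute)

lemmas rho_lin [simp] =
  linop_rho[THEN linop_add] linop_rho[THEN linop_sc] linop_rho[THEN linop_zero]
  linop_rho[THEN linop_minus] linop_rho[THEN linop_diff]

lemma rho_Fk:
  assumes "f \<in> Fk n (Suc q) (Collect even)" "i \<le> n" "j \<le> n"
  shows "rho n p (i, j, \<sigma>) f \<in> Fk n (Suc q) (Collect even)"
proof -
  have "JJ n f \<in> Fk n (Suc q) (Collect odd)"
    by (rule JJ_Fk[OF assms(1)]) auto
  then have "E1 i j (JJ n f) \<in> Fk n (Suc q) (Collect even)"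
    using assms(2,3) by (rule E1_Fk) auto
  then show ?thesis
    using assms by (cases "\<sigma> = 0") (simp_all add: rho_def E0_Fk subsp_sc[OF subsp_Fk])
qed

lemma rho_bracket:
  assumes "f \<in> Fk n p B" "p > 0" "i \<le> n" "j \<le> n" "k \<le> n" "l \<le> n"
  shows "rho n p (i, j, \<sigma>) (rho n p (k, l, \<theta>) f) - sc (koszul \<sigma> \<theta>) (rho n p (k, l, \<theta>) (rho n p (i, j, \<sigma>) f))
    = (if j = k then rho n p (i, l, \<sigma> + \<theta>) f else 0)
      - sc (koszul \<sigma> \<theta>) (if i = l then rho n p (k, j, \<sigma> + \<theta>) f else 0)"
proof -
  note E = E_JJ[where n = n]
  have nz': "1 / (csq p * csq p) * (csq p * csq p) = 1" using csq_nonzero[OF assms(2)] by simp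
  \<comment> \<open>Two odd operators bring two factors \<open>JJ\<close> together: exchanging one
    with \<open>E1 c d\<close> costs a sign, the square of \<open>JJ\<close> is \<open>- p\<close>,
    and the normalisation removes \<open>p\<close>.\<close>
  have sq: "sc (1 / (csq p * csq p)) (E1 a b (JJ n (E1 c d (JJ n f)))) = E1 a b (E1 c d f)"
    if "a \<le> n" "b \<le> n" "c \<le> n" "d \<le> n" for a b c d
  proof -
    have "E1 a b (JJ n (E1 c d (JJ n f))) = - E1 a b (E1 c d (JJ n (JJ n f)))"
      using E(2)[OF that(3,4), of "JJ n f"] by simp
    also have "\<dots> = sc (csq p * csq p) (E1 a b (E1 c d f))"
      by (simp only: JJ_JJ_Fk[OF assms(1)] sc_minus E_lin csq_square minus_minus)
    finally show ?thesis using nz' by (simp only: sc_simps)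
  qed
  consider "\<sigma> = 0" "\<theta> = 0" | "\<sigma> = 0" "\<theta> = 1" | "\<sigma> = 1" "\<theta> = 0" | "\<sigma> = 1" "\<theta> = 1"
    by (cases \<sigma>; cases \<theta>) auto
  then show ?thesis
  proof cases
    case 1
    then show ?thesis
      by (simp only: rho_simps koszul_def add_0 E0_E0 if_False zero_neq_one conj_absorb sc_simps)
  next
    case 2
    have "rho n p (i, j, 0) (rho n p (k, l, 1) f) - rho n p (k, l, 1) (rho n p (i, j, 0) f)
        = sc (1 / csq p) (E0 i j (E1 k l (JJ n f)) - E1 k l (E0 i j (JJ n f)))"
      by (simp only: rho_simps E(1)[OF assms(3,4)] E_lin sc_diff)
    also have "\<dots> = (if j = k then rho n p (i, l, 1) f else 0) - (if i = l then rho n p (k, j, 1) f else 0)"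
      by (cases "j = k"; cases "i = l") (simp_all only: E0_E1 rho_simps simp_thms if_False if_True sc_diff sc_simps)
    finally show ?thesis
      by (simp only: 2 koszul_def add_0 zero_neq_one simp_thms if_False sc_simps)
  next
    case 3
    have "rho n p (i, j, 1) (rho n p (k, l, 0) f) - rho n p (k, l, 0) (rho n p (i, j, 1) f)
        = sc (1 / csq p) (E1 i j (E0 k l (JJ n f)) - E0 k l (E1 i j (JJ n f)))"
      by (simp only: rho_simps E(1)[OF assms(5,6)] E_lin sc_diff)
    also have "\<dots> = (if j = k then rho n p (i, l, 1) f else 0) - (if i = l then rho n p (k, j, 1) f else 0)"
      by (cases "j = k"; cases "i = l") (simp_all only: E1_E0 rho_simps simp_thms if_False if_True sc_diff sc_simps)
    finally show ?thesis
      by (simp only: 3 koszul_def add_0_right zero_neq_one simp_thms if_False sc_simps)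
  next
    case 4
    have "rho n p (i, j, 1) (rho n p (k, l, 1) f) = E1 i j (E1 k l f)"
      "rho n p (k, l, 1) (rho n p (i, j, 1) f) = E1 k l (E1 i j f)"
      using assms by (simp_all add: rho_simps sq)
    moreover have "(1 :: bit) + 1 = 0" by simp
    ultimately show ?thesis
      by (cases "j = k"; cases "i = l")
        (simp_all only: 4 E1_E1 koszul_def rho_simps simp_thms if_False if_True
          sc_minus sc_simps diff_minus_eq_add diff_zero add_0_right)
  qed
qed

section \<open>Unitarity and irreducibility\<close>

lemma finite_mons: "finite (mons n p B)"
proof (rule finite_subset)
  show "mons n p B \<subseteq> (\<lambda>(g, S). (\<lambda>k. if k \<le> n then g k else 0, S)) ` (PiE {..n} (\<lambda>_. {..p}) \<times> Pow {..n})"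
  proof
    fix m assume "m \<in> mons n p B"
    moreover obtain \<alpha> S where m: "m = (\<alpha>, S)" by (cases m)
    ultimately have z: "\<And>k. k > n \<Longrightarrow> \<alpha> k = 0" and S: "S \<subseteq> {..n}" and p: "(\<Sum>k\<le>n. \<alpha> k) + card S = p"
      by (auto simp: mons_def)
    have "\<alpha> k \<le> p" if "k \<le> n" for k
      using member_le_sum[of k "{..n}" \<alpha>] that p by simp
    then have "restrict \<alpha> {..n} \<in> PiE {..n} (\<lambda>_. {..p})" by auto
    moreover have "(\<lambda>k. if k \<le> n then restrict \<alpha> {..n} k else 0) = \<alpha>"
      using z by (auto simp: fun_eq_iff)
    ultimately show "m \<in> (\<lambda>(g, S). (\<lambda>k. if k \<le> n then g k else 0, S)) ` (PiE {..n} (\<lambda>_. {..p}) \<times> Pow {..n})"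
      using S m by (intro image_eqI[of _ _ "(restrict \<alpha> {..n}, S)"]) auto
  qed
  show "finite ((\<lambda>(g, S). (\<lambda>k. if k \<le> n then g k else 0, S)) ` (PiE {..n} (\<lambda>_. {..p}) \<times> Pow {..n}))"
    by (intro finite_imageI finite_cartesian_product finite_PiE) auto
qed

text \<open>The squared Fischer norm of a monomial: the factorials make multiplication by x_k
  adjoint to its derivative, and xi-factors have norm 1.\<close>

definition wgt :: "nat \<Rightarrow> mon \<Rightarrow> real" where
  "wgt n = (\<lambda>(\<alpha>, S). \<Prod>k\<le>n. fact (\<alpha> k))"

definition ip :: "nat \<Rightarrow> nat \<Rightarrow> fock \<Rightarrow> fock \<Rightarrow> complex" where
  "ip n p f g = (\<Sum>m\<in>mons n p UNIV. of_real (wgt n m) * cnj (f m) * g m)"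

lemma wgt_pos: "wgt n m > 0"
  by (cases m) (simp add: wgt_def prod_pos)

lemma wgt_bump:
  assumes "i \<le> n"
  shows "wgt n (\<alpha>(i := Suc (\<alpha> i)), S) = of_nat (Suc (\<alpha> i)) * wgt n (\<alpha>, S)"
proof -
  have "(\<Prod>k\<in>{..n} - {i}. fact ((\<alpha>(i := Suc (\<alpha> i))) k)) = (\<Prod>k\<in>{..n} - {i}. fact (\<alpha> k) :: real)"
    by (rule prod.cong) auto
  then show ?thesis
    using assms by (simp add: wgt_def prod.remove[of "{..n}" i] algebra_simps)
qed

lemma ip_linear:
  "ip n p f (g + h) = ip n p f g + ip n p f h" "ip n p (f + g) h = ip n p f h + ip n p g h"
  "ip n p f (g - h) = ip n p f g - ip n p f h" "ip n p (f - g) h = ip n p f h - ip n p g h"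
  "ip n p f (sc c g) = c * ip n p f g" "ip n p (sc c f) g = cnj c * ip n p f g"
  "ip n p f (- g) = - ip n p f g" "ip n p (- f) g = - ip n p f g"
  "ip n p f 0 = 0" "ip n p 0 g = 0"
  by (simp_all add: ip_def sc_def algebra_simps sum.distrib sum_subtractf sum_negf sum_distrib_left)

lemma ip_sum: "ip n p f (sum g I) = (\<Sum>i\<in>I. ip n p f (g i))" "ip n p (sum g I) f = (\<Sum>i\<in>I. ip n p (g i) f)"
  by (induction I rule: infinite_finite_induct) (simp_all only: sum.infinite sum.empty sum.insert ip_linear not_False_eq_True)

lemma ip_cnj: "ip n p g f = cnj (ip n p f g)"
  by (simp add: ip_def mult_ac)

lemma ip_pos:
  assumes "f \<in> Fk n p B" "ip n p f f = 0"
  shows "f = 0"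
proof -
  have "ip n p f f = of_real (\<Sum>m\<in>mons n p UNIV. wgt n m * (cmod (f m))\<^sup>2)"
    unfolding ip_def of_real_sum
    by (rule sum.cong) (simp_all add: complex_norm_square[symmetric] mult.assoc mult.commute[of "cnj _"] del: of_real_power)
  then have "(\<Sum>m\<in>mons n p UNIV. wgt n m * (cmod (f m))\<^sup>2) = 0"
    using assms(2) by (metis of_real_eq_0_iff)
  then have "\<forall>m\<in>mons n p UNIV. wgt n m * (cmod (f m))\<^sup>2 = 0"
    by (subst (asm) sum_nonneg_eq_0_iff) (auto simp: finite_mons wgt_pos less_imp_le)
  then have "f m = 0" if "m \<in> mons n p UNIV" for m
    using that wgt_pos[of n m] by auto
  moreover have "f m = 0" if "m \<notin> mons n p UNIV" for m
    using that FkD[OF assms(1), of m] mons_mono[of B UNIV n p] by auto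
  ultimately show ?thesis by (auto simp: fun_eq_iff)
qed

text \<open>Reindexing along multiplication by x_i: monomials outside its image have exponent 0 and
  do not contribute, and the ratio of the factorial weights is the factor produced by the
  derivative.\<close>

lemma ip_bcr:
  assumes "i \<le> n"
  shows "ip n (Suc p) (bcr i f) g = ip n p f (ban i g)"
proof -
  let ?h = "\<lambda>(\<alpha>, S). (\<alpha>(i := Suc (\<alpha> i)), S :: nat set)"
  have inj: "inj_on ?h (mons n p UNIV)"
  proof (rule inj_on_inverseI)
    show "(\<lambda>(\<alpha>, S). (\<alpha>(i := \<alpha> i - 1), S)) (?h m) = m" for m by (cases m) simp
  qed
  have "ip n (Suc p) (bcr i f) g = (\<Sum>m\<in>?h ` mons n p UNIV. of_real (wgt n m) * cnj (bcr i f m) * g m)"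
    unfolding ip_def
  proof (rule sum.mono_neutral_right[OF finite_mons])
    show "?h ` mons n p UNIV \<subseteq> mons n (Suc p) UNIV"
      using mons_bump[OF assms] by auto
    show "\<forall>m\<in>mons n (Suc p) UNIV - ?h ` mons n p UNIV. of_real (wgt n m) * cnj (bcr i f m) * g m = 0"
    proof
      fix m assume m: "m \<in> mons n (Suc p) UNIV - ?h ` mons n p UNIV"
      obtain \<alpha> S where [simp]: "m = (\<alpha>, S)" by (cases m)
      have "\<alpha> i = 0"
      proof (rule ccontr)
        assume "\<alpha> i \<noteq> 0"
        moreover from this have "(\<alpha>(i := \<alpha> i - 1), S) \<in> mons n p UNIV"
          using m mons_drop[OF assms, of \<alpha> S p UNIV] by simp
        ultimately have "m \<in> ?h ` mons n p UNIV"
          by (intro image_eqI[of _ _ "(\<alpha>(i := \<alpha> i - 1), S)"]) auto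
        then show False using m by simp
      qed
      then show "of_real (wgt n m) * cnj (bcr i f m) * g m = 0"
        by (simp add: bcr_def)
    qed
  qed
  also have "\<dots> = ip n p f (ban i g)"
    unfolding ip_def sum.reindex[OF inj]
    by (rule sum.cong) (auto simp: bcr_def ban_def wgt_bump[OF assms] simp del: of_nat_Suc)
  finally show ?thesis .
qed

lemma cnj_fsgn: "cnj (fsgn k S) = fsgn k S"
  by (simp add: fsgn_def)

lemma ip_fcr:
  assumes "i \<le> n"
  shows "ip n (Suc p) (fcr i f) g = ip n p f (fan i g)"
proof -
  let ?h = "\<lambda>(\<alpha> :: nat \<Rightarrow> nat, S). (\<alpha>, insert i S)"
  let ?M = "{m \<in> mons n p UNIV. i \<notin> snd m}"
  have inj: "inj_on ?h ?M"
    by (rule inj_onI) (auto simp: insert_ident)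
  have "ip n (Suc p) (fcr i f) g = (\<Sum>m\<in>?h ` ?M. of_real (wgt n m) * cnj (fcr i f m) * g m)"
    unfolding ip_def
  proof (rule sum.mono_neutral_right[OF finite_mons])
    show "?h ` ?M \<subseteq> mons n (Suc p) UNIV"
      using mons_insert[OF assms, of _ _ p UNIV] by auto
    show "\<forall>m\<in>mons n (Suc p) UNIV - ?h ` ?M. of_real (wgt n m) * cnj (fcr i f m) * g m = 0"
    proof
      fix m assume m: "m \<in> mons n (Suc p) UNIV - ?h ` ?M"
      obtain \<alpha> S where [simp]: "m = (\<alpha>, S)" by (cases m)
      have "i \<notin> S"
      proof
        assume "i \<in> S"
        moreover from this have "(\<alpha>, S - {i}) \<in> ?M"
          using m mons_remove[OF assms, of S \<alpha> p UNIV] by simp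
        ultimately have "m \<in> ?h ` ?M"
          by (intro image_eqI[of _ _ "(\<alpha>, S - {i})"]) auto
        then show False using m by simp
      qed
      then show "of_real (wgt n m) * cnj (fcr i f m) * g m = 0"
        by (simp add: fcr_def)
    qed
  qed
  also have "\<dots> = (\<Sum>m\<in>?M. of_real (wgt n m) * cnj (f m) * fan i g m)"
    unfolding sum.reindex[OF inj]
    by (rule sum.cong) (auto simp: fcr_def fan_def wgt_def cnj_fsgn)
  also have "\<dots> = ip n p f (fan i g)"
    unfolding ip_def by (rule sum.mono_neutral_left[OF finite_mons]) (auto simp: fan_def)
  finally show ?thesis .
qed

lemma ip_ban: "i \<le> n \<Longrightarrow> ip n p (ban i f) g = ip n (Suc p) f (bcr i g)"
  using ip_bcr[of i n p g f] by (metis ip_cnj)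

lemma ip_fan: "i \<le> n \<Longrightarrow> ip n p (fan i f) g = ip n (Suc p) f (fcr i g)"
  using ip_fcr[of i n p g f] by (metis ip_cnj)

lemma ip_E:
  assumes "i \<le> n" "j \<le> n"
  shows "ip n (Suc q) (E0 i j f) g = ip n (Suc q) f (E0 j i g)"
    and "ip n (Suc q) (E1 i j f) g = ip n (Suc q) f (E1 j i g)"
  using assms by (simp_all add: E0_def E1_def ip_linear ip_bcr ip_fcr ip_ban ip_fan fermi_bose)

lemma ip_dd: "ip n (Suc q) (dd n f) g = ip n (Suc q) f (dl n g)"
  unfolding dd_def dl_def ip_sum
  by (rule sum.cong) (simp_all add: ip_fcr ip_ban)

lemma ip_dl: "ip n (Suc q) (dl n f) g = ip n (Suc q) f (dd n g)"
  using ip_dd[of n q g f] by (metis ip_cnj)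

lemma ip_JJ: "ip n (Suc q) (JJ n f) g = - ip n (Suc q) f (JJ n g)"
  by (simp add: JJ_def ip_linear ip_dd ip_dl)

text \<open>In the odd case \<open>JJ\<close> is skew-adjoint and anticommutes with the odd
  operator, so two signs cancel; the factor \<open>1 / csq p\<close> is real.\<close>

lemma ip_rho:
  assumes "i \<le> n" "j \<le> n"
  shows "ip n (Suc q) (rho n p (i, j, \<sigma>) f) g = ip n (Suc q) f (rho n p (j, i, \<sigma>) g)"
proof (cases "\<sigma> = 0")
  case False
  then have s: "\<sigma> = 1" by simp
  have "cnj (1 / csq p) = 1 / csq p" by (simp add: csq_def)
  then show ?thesis
    unfolding s rho_simps ip_linear ip_E(2)[OF assms] ip_JJ E_JJ(2)[OF assms(2,1)] by simp
qed (simp add: rho_def ip_E[OF assms])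

text \<open>Gram-Schmidt by induction on a finite set \<open>M\<close> of coordinates that supports
  \<open>N\<close>: the vectors vanishing at one coordinate form a smaller subspace, and at most one
  further vector spans the rest. Definiteness is asked on \<open>N0\<close> only, because the form
  \<open>ip\<close> ignores all coordinates outside a finite set.\<close>

lemma orth_proj:
  assumes M: "finite M"
    and B_add: "\<And>f g h. b f (g - h) = b f g - b f h" "\<And>f g h. b (f - g) h = b f h - b g h"
    and B_sc: "\<And>f g c. b f (sc c g) = c * b f g" "\<And>f g c. b (sc c f) g = cnj c * b f g"
    and B_cnj: "\<And>f g. b g f = cnj (b f g)"
    and B_pos: "\<And>f. f \<in> N0 \<Longrightarrow> b f f = 0 \<Longrightarrow> f = 0"
    and N: "subsp N" "N \<subseteq> N0" "\<And>f m. f \<in> N \<Longrightarrow> f m \<noteq> 0 \<Longrightarrow> m \<in> M"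
  shows "\<exists>w\<in>N. \<forall>x\<in>N. b x (v - w) = 0"
  using M N
proof (induction M arbitrary: N v rule: finite_induct)
  case empty
  then have "x = 0" if "x \<in> N" for x using that by (auto simp: fun_eq_iff)
  then show ?case
    using B_sc(2)[of 0 0] subsp_zero[OF empty(1)] by (intro bexI[of _ 0]) auto
next
  case (insert m0 M)
  note sN = \<open>subsp N\<close>
  define N' where "N' = {f \<in> N. f m0 = 0}"
  have N': "subsp N'" "N' \<subseteq> N0" "\<And>f m. f \<in> N' \<Longrightarrow> f m \<noteq> 0 \<Longrightarrow> m \<in> M"
    using insert.prems(2,3) sN unfolding N'_def subsp_def by (auto simp: sc_def)
  have IH: "\<exists>w\<in>N'. \<forall>x\<in>N'. b x (u - w) = 0" for u
    by (rule insert.IH[OF N'(1,2)]) (rule N'(3))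
  show ?case
  proof (cases "N = N'")
    case True
    show ?thesis by (subst (1 2) True) (rule IH)
  next
    case False
    then obtain c where c: "c \<in> N" "c m0 \<noteq> 0" by (auto simp: N'_def)
    obtain w0 where w0: "w0 \<in> N'" "\<forall>x\<in>N'. b x (c - w0) = 0" using IH by blast
    \<comment> \<open>\<open>c\<close> made orthogonal to \<open>N'\<close>; as \<open>w0\<close>
      vanishes at \<open>m0\<close>, the coordinate there stays nonzero.\<close>
    define e where "e = c - w0"
    have e: "e \<in> N" "e m0 \<noteq> 0" "\<forall>x\<in>N'. b x e = 0"
      using c w0 subsp_diff[OF sN] by (auto simp: e_def N'_def)
    have "e \<noteq> 0" using e(2) by auto
    then have be: "b e e \<noteq> 0" using B_pos e(1) insert.prems(2) by blast
    obtain w1 where w1: "w1 \<in> N'" "\<forall>x\<in>N'. b x (v - w1) = 0" using IH by blast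
    \<comment> \<open>The projection to \<open>N'\<close> plus the projection to the line of
      \<open>e\<close>, written as a difference to match closure under subtraction.\<close>
    define w where "w = w1 - sc (- (b e (v - w1) / b e e)) e"
    have vw: "b x (v - w) = b x (v - w1) - b e (v - w1) / b e e * b x e" for x
    proof -
      have "v - w = (v - w1) - sc (b e (v - w1) / b e e) e"
        by (simp add: w_def sc_minus)
      then show ?thesis by (simp only: B_add B_sc)
    qed
    have wN: "w \<in> N"
      unfolding w_def using w1(1) by (intro subsp_diff[OF sN] subsp_sc[OF sN] e(1)) (simp add: N'_def)
    have "b x (v - w) = 0" if x: "x \<in> N" for x
    proof -
      \<comment> \<open>Removing the multiple of \<open>e\<close> that cancels the coordinate at
        \<open>m0\<close> leaves a vector of \<open>N'\<close>.\<close>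
      define y where "y = x - sc (x m0 / e m0) e"
      have "y \<in> N'"
        unfolding y_def N'_def
        using subsp_diff[OF sN x subsp_sc[OF sN e(1)]] e(2) by (simp add: sc_apply)
      then have "b y (v - w) = 0"
        using w1 e by (simp add: vw)
      moreover have "b e (v - w) = 0" using be by (simp add: vw)
      moreover have "b y (v - w) = b x (v - w) - cnj (x m0 / e m0) * b e (v - w)"
        unfolding y_def by (simp only: B_add(2) B_sc(2))
      ultimately show ?thesis by simp
    qed
    then show ?thesis using wN by blast
  qed
qed

text \<open>If \<open>N\<close> were proper, its complement \<open>P\<close> in \<open>W\<close>
  would be nonzero and, by adjointness, invariant. Then \<open>gen\<close> puts \<open>s\<close>
  into both, and \<open>s\<close> would be orthogonal to itself.\<close>

lemma unitary_simple:
  assumes W: "subsp W" "W \<subseteq> Fk n p B"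
    and inv: "\<And>a f. a \<in> A \<Longrightarrow> f \<in> W \<Longrightarrow> T a f \<in> W"
    and adj: "\<And>a f g. a \<in> A \<Longrightarrow> ip n p (T a f) g = ip n p f (T (ad a) g)" "\<And>a. a \<in> A \<Longrightarrow> ad a \<in> A"
    and s: "s \<noteq> 0"
    and gen: "\<And>N. subsp N \<Longrightarrow> N \<subseteq> W \<Longrightarrow> (\<And>a f. a \<in> A \<Longrightarrow> f \<in> N \<Longrightarrow> T a f \<in> N) \<Longrightarrow> N \<noteq> {0} \<Longrightarrow> s \<in> N"
    and N: "subsp N" "N \<subseteq> W" "\<And>a f. a \<in> A \<Longrightarrow> f \<in> N \<Longrightarrow> T a f \<in> N" "N \<noteq> {0}"
  shows "N = W"
proof (rule ccontr)
  assume "N \<noteq> W"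
  then obtain v where v: "v \<in> W" "v \<notin> N" using N(2) by blast
  have "\<exists>w\<in>N. \<forall>x\<in>N. ip n p x (v - w) = 0"
  proof (rule orth_proj[OF finite_mons[of n p B], where b = "ip n p" and ?N0.0 = W])
    show "m \<in> mons n p B" if "f \<in> N" "f m \<noteq> 0" for f m
      using that N(2) W(2) FkD by blast
    show "f = 0" if "f \<in> W" "ip n p f f = 0" for f
      using that W(2) ip_pos by blast
    show "ip n p g f = cnj (ip n p f g)" for f g by (rule ip_cnj)
  qed (use N in \<open>simp_all add: ip_linear\<close>)
  then obtain w where w: "w \<in> N" "\<forall>x\<in>N. ip n p x (v - w) = 0" by blast
  define P where "P = {u \<in> W. \<forall>x\<in>N. ip n p x u = 0}"
  have "subsp P"
    using W(1) by (auto simp: P_def subsp_def ip_linear)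
  moreover have "T a f \<in> P" if "a \<in> A" "f \<in> P" for a f
  proof -
    have "ip n p x (T a f) = cnj (ip n p f (T (ad a) x))" for x
      using adj(1)[OF that(1), of f x] ip_cnj by metis
    moreover have "ip n p f (T (ad a) x) = 0" if "x \<in> N" for x
      using N(3)[OF adj(2)[OF \<open>a \<in> A\<close>] that] \<open>f \<in> P\<close> ip_cnj[of n p f "T (ad a) x"] by (simp add: P_def)
    ultimately show ?thesis using inv that by (auto simp: P_def)
  qed
  moreover have "v - w \<in> P" using v w N(2) subsp_diff[OF W(1)] by (auto simp: P_def)
  moreover have "v - w \<noteq> 0" using v w by auto
  moreover have "P \<subseteq> W" by (auto simp: P_def)
  ultimately have "s \<in> P" by (intro gen) blast+
  moreover have "s \<in> N" by (rule gen[OF N(1,2) N(3) N(4)])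
  ultimately have "ip n p s s = 0" "s \<in> W" by (auto simp: P_def)
  then show False using s W(2) ip_pos by blast
qed

text \<open>
  The subscript sum \<open>ht\<close> drops under \<open>e\<^sub>i\<^sub>j\<close> for \<open>i < j\<close>, which provides vectors killed by all of these operators.
\<close>

definition ht :: "nat \<Rightarrow> mon \<Rightarrow> nat" where
  "ht n = (\<lambda>(\<alpha>, S). (\<Sum>k\<le>n. k * \<alpha> k) + \<Sum>S)"

text \<open>A strict integer bound can be shifted by signed amounts, and for
  \<open>h \<le> 0\<close> only the zero function remains. Finiteness of \<open>S\<close> is
  demanded because a sum over an infinite set is 0 by convention, which would break the additivity
  of \<open>ht\<close>.\<close>

definition Vh :: "nat \<Rightarrow> int \<Rightarrow> fock set" where
  "Vh n h = {f. \<forall>\<alpha> S. f (\<alpha>, S) \<noteq> 0 \<longrightarrow> finite S \<and> int (ht n (\<alpha>, S)) < h}"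

lemma sum_mult_upd:
  fixes \<alpha> :: "nat \<Rightarrow> nat"
  assumes "i \<le> n"
  shows "(\<Sum>k\<le>n. k * (\<alpha>(i := x)) k) + i * \<alpha> i = (\<Sum>k\<le>n. k * \<alpha> k) + i * x"
proof -
  have "(\<Sum>k\<in>{..n} - {i}. k * (\<alpha>(i := x)) k) = (\<Sum>k\<in>{..n} - {i}. k * \<alpha> k)"
    by (rule sum.cong) auto
  then show ?thesis
    using assms by (simp add: sum.remove[of "{..n}" i])
qed

lemma VhD: "f \<in> Vh n h \<Longrightarrow> f (\<alpha>, S) \<noteq> 0 \<Longrightarrow> finite S \<and> int (ht n (\<alpha>, S)) < h"
  unfolding Vh_def by blast

lemma Vh_mono: "h \<le> h' \<Longrightarrow> Vh n h \<subseteq> Vh n h'"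
  by (force simp: Vh_def)

lemma subsp_Vh: "subsp (Vh n h)"
  unfolding subsp_def
proof (intro conjI ballI allI)
  fix f g assume "f \<in> Vh n h" "g \<in> Vh n h"
  moreover have "f m \<noteq> 0 \<or> g m \<noteq> 0" if "(f + g) m \<noteq> 0" for m
    using that by auto
  ultimately show "f + g \<in> Vh n h" unfolding Vh_def by blast
qed (auto simp: Vh_def sc_def)

lemma bcr_Vh:
  assumes "f \<in> Vh n h" "i \<le> n"
  shows "bcr i f \<in> Vh n (h + int i)"
  unfolding Vh_def
proof (intro CollectI allI impI)
  fix \<alpha> S assume "bcr i f (\<alpha>, S) \<noteq> 0"
  then have a: "\<alpha> i \<noteq> 0" and "f (\<alpha>(i := \<alpha> i - 1), S) \<noteq> 0"
    by (auto simp: bcr_def split: if_splits)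
  then have "finite S" "int (ht n (\<alpha>(i := \<alpha> i - 1), S)) < h"
    using assms(1) by (auto simp: Vh_def)
  moreover have "ht n (\<alpha>(i := \<alpha> i - 1), S) + i * \<alpha> i = ht n (\<alpha>, S) + i * (\<alpha> i - 1)"
    using sum_mult_upd[OF assms(2), of \<alpha> "\<alpha> i - 1"] by (simp add: ht_def)
  moreover have "i * \<alpha> i = i * (\<alpha> i - 1) + i"
    using a by (cases "\<alpha> i") auto
  ultimately show "finite S \<and> int (ht n (\<alpha>, S)) < h + int i"
    by linarith
qed

lemma ban_Vh:
  assumes "f \<in> Vh n h" "i \<le> n"
  shows "ban i f \<in> Vh n (h - int i)"
  unfolding Vh_def
proof (intro CollectI allI impI)
  fix \<alpha> S assume "ban i f (\<alpha>, S) \<noteq> 0"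
  then have "f (\<alpha>(i := Suc (\<alpha> i)), S) \<noteq> 0"
    by (auto simp: ban_def)
  then have "finite S" "int (ht n (\<alpha>(i := Suc (\<alpha> i)), S)) < h"
    using assms(1) by (auto simp: Vh_def)
  moreover have "ht n (\<alpha>(i := Suc (\<alpha> i)), S) = ht n (\<alpha>, S) + i"
    using sum_mult_upd[OF assms(2), of \<alpha> "Suc (\<alpha> i)"] by (simp add: ht_def)
  ultimately show "finite S \<and> int (ht n (\<alpha>, S)) < h - int i"
    by linarith
qed

lemma fcr_Vh:
  assumes "f \<in> Vh n h"
  shows "fcr i f \<in> Vh n (h + int i)"
  unfolding Vh_def
proof (intro CollectI allI impI)
  fix \<alpha> S assume "fcr i f (\<alpha>, S) \<noteq> 0"
  then have i: "i \<in> S" and "f (\<alpha>, S - {i}) \<noteq> 0"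
    by (auto simp: fcr_def split: if_splits)
  then have "finite (S - {i})" "int (ht n (\<alpha>, S - {i})) < h"
    using VhD[OF assms] by blast+
  moreover from this i have "ht n (\<alpha>, S) = ht n (\<alpha>, S - {i}) + i"
    by (simp add: ht_def sum.remove[of S i])
  ultimately show "finite S \<and> int (ht n (\<alpha>, S)) < h + int i"
    by simp
qed

lemma fan_Vh:
  assumes "f \<in> Vh n h"
  shows "fan i f \<in> Vh n (h - int i)"
  unfolding Vh_def
proof (intro CollectI allI impI)
  fix \<alpha> S assume "fan i f (\<alpha>, S) \<noteq> 0"
  then have i: "i \<notin> S" and "f (\<alpha>, insert i S) \<noteq> 0"
    by (auto simp: fan_def split: if_splits)
  then have "finite (insert i S) \<and> int (ht n (\<alpha>, insert i S)) < h"
    by (intro VhD[OF assms])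
  moreover from this i have "ht n (\<alpha>, insert i S) = ht n (\<alpha>, S) + i"
    by (simp add: ht_def)
  ultimately show "finite S \<and> int (ht n (\<alpha>, S)) < h - int i"
    by simp
qed

lemma E_Vh:
  assumes "f \<in> Vh n h" "i \<le> n" "j \<le> n" "h + int i - int j \<le> h'"
  shows "E0 i j f \<in> Vh n h'" "E1 i j f \<in> Vh n h'"
proof -
  have e: "h - int j + int i = h + int i - int j" by simp
  have "Vh n (h - int j + int i) \<subseteq> Vh n h'" using Vh_mono[OF assms(4)] unfolding e .
  moreover have "bcr i (ban j f) \<in> Vh n (h - int j + int i)" "fcr i (fan j f) \<in> Vh n (h - int j + int i)"
    "bcr i (fan j f) \<in> Vh n (h - int j + int i)" "fcr i (ban j f) \<in> Vh n (h - int j + int i)"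
    using assms(1-3) by (simp_all add: bcr_Vh ban_Vh fcr_Vh fan_Vh)
  ultimately show "E0 i j f \<in> Vh n h'" "E1 i j f \<in> Vh n h'"
    unfolding E0_def E1_def by (blast intro: subsp_add[OF subsp_Vh])+
qed

lemma JJ_Vh: "f \<in> Vh n h \<Longrightarrow> JJ n f \<in> Vh n h"
proof -
  assume f: "f \<in> Vh n h"
  have "fcr k (ban k f) \<in> Vh n h" "bcr k (fan k f) \<in> Vh n h" if "k \<le> n" for k
    using fcr_Vh[OF ban_Vh[OF f that], of k] bcr_Vh[OF fan_Vh[OF f, of k] that] by simp_all
  then show ?thesis
    unfolding JJ_def dd_def dl_def
    by (intro subsp_diff[OF subsp_Vh] subsp_sum[OF subsp_Vh]) auto
qed

text \<open>A nonzero vector of \<open>N\<close> with the least possible height bound works: its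
  images under \<open>R\<close> lie in \<open>N\<close> and satisfy a smaller bound, so they
  vanish.\<close>

lemma exists_lowest:
  assumes "N \<subseteq> Fk n p B" "f \<in> N" "f \<noteq> 0"
    and "\<And>r f. r \<in> R \<Longrightarrow> f \<in> N \<Longrightarrow> r f \<in> N"
    and "\<And>r f h. r \<in> R \<Longrightarrow> f \<in> Vh n h \<Longrightarrow> r f \<in> Vh n (h - 1)"
  shows "\<exists>g\<in>N. g \<noteq> 0 \<and> (\<forall>r\<in>R. r g = 0)"
proof -
  define P where "P h \<longleftrightarrow> (\<exists>g\<in>N. g \<noteq> 0 \<and> g \<in> Vh n (int h))" for h
  have "finite (ht n ` mons n p B)" using finite_mons by blast
  then obtain b where b: "\<forall>x\<in>ht n ` mons n p B. x < b"
    using finite_nat_set_iff_bounded by blast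
  have "f \<in> Vh n (int b)"
    unfolding Vh_def
  proof (intro CollectI allI impI)
    fix \<alpha> S assume "f (\<alpha>, S) \<noteq> 0"
    then have "(\<alpha>, S) \<in> mons n p B" using assms(1,2) FkD by blast
    then show "finite S \<and> int (ht n (\<alpha>, S)) < int b"
      using b finite_subset[of S "{..n}"] by (auto simp: mons_def)
  qed
  then have "P b" using assms(2,3) by (auto simp: P_def)
  define h where "h = (LEAST h. P h)"
  have "P h" using \<open>P b\<close> unfolding h_def by (rule LeastI)
  then obtain g where g: "g \<in> N" "g \<noteq> 0" "g \<in> Vh n (int h)" by (auto simp: P_def)
  have "r g = 0" if r: "r \<in> R" for r
  proof (rule ccontr)
    assume nz: "r g \<noteq> 0"
    have rg: "r g \<in> N" "r g \<in> Vh n (int h - 1)" using assms(4,5) r g by auto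
    obtain \<alpha> S where "r g (\<alpha>, S) \<noteq> 0" using nz by (auto simp: fun_eq_iff)
    then have "int (ht n (\<alpha>, S)) < int h - 1" using VhD[OF rg(2)] by blast
    \<comment> \<open>Heights are natural numbers, so \<open>h\<close> is positive; this keeps
      \<open>h - 1\<close> from truncating.\<close>
    then have "h > 0" by simp
    then have "int h - 1 = int (h - 1)" by simp
    then have "P (h - 1)" using rg nz unfolding P_def by metis
    then show False using \<open>h > 0\<close> not_less_Least[of "h - 1" P] by (simp add: h_def)
  qed
  then show ?thesis using g by blast
qed

definition EV :: "nat \<Rightarrow> nat \<Rightarrow> fock set" where
  "EV n p = Fk n p (Collect even)"

definition basis_fn :: "mon \<Rightarrow> fock" where
  "basis_fn m = (\<lambda>m'. if m' = m then 1 else 0)"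

definition v0 :: "nat \<Rightarrow> fock" where
  "v0 p = basis_fn (\<lambda>k. if k = 0 then p else 0, {})"

lemma basis_fn_Fk: "m \<in> mons n p B \<Longrightarrow> basis_fn m \<in> Fk n p B"
  by (auto simp: Fk_def basis_fn_def split: if_splits)

lemma v0_EV: "v0 p \<in> EV n p"
proof -
  have "(\<Sum>k\<le>n. if k = 0 then p else 0) = p" by simp
  then show ?thesis unfolding EV_def v0_def by (intro basis_fn_Fk) (auto simp: mons_def)
qed

lemma v0_nonzero: "v0 p \<noteq> 0"
proof
  assume "v0 p = 0"
  then have "v0 p (\<lambda>k. if k = 0 then p else 0, {}) = 0" by simp
  then show False by (simp add: v0_def basis_fn_def)
qed

lemma bcr_inj: "bcr i f = 0 \<Longrightarrow> f = 0"
proof (rule ext)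
  fix m :: "mon"
  assume "bcr i f = 0"
  obtain \<alpha> S where m: "m = (\<alpha>, S)" by (cases m)
  have "bcr i f (\<alpha>(i := Suc (\<alpha> i)), S) = 0" using \<open>bcr i f = 0\<close> by simp
  then show "f m = 0 m" by (simp add: bcr_def m)
qed

lemma ban_zeroD: "ban i f = 0 \<Longrightarrow> \<alpha> i \<noteq> 0 \<Longrightarrow> f (\<alpha>, S) = 0"
proof -
  assume "ban i f = 0" "\<alpha> i \<noteq> 0"
  then have "ban i f (\<alpha>(i := \<alpha> i - 1), S) = 0" by simp
  then show ?thesis using \<open>\<alpha> i \<noteq> 0\<close> by (simp add: ban_def del: of_nat_Suc)
qed

lemma fan_zeroD: "fan i f = 0 \<Longrightarrow> i \<in> S \<Longrightarrow> f (\<alpha>, S) = 0"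
proof -
  assume "fan i f = 0" "i \<in> S"
  then have "fan i f (\<alpha>, S - {i}) = 0" by simp
  then show ?thesis using \<open>i \<in> S\<close> by (simp add: fan_def insert_absorb)
qed

text \<open>Combining the two equations turns x_i^2 times the derivative of f in x_j into xi_i^2
  times it. Since xi_i^2 = 0 and multiplication by x_i is injective, that derivative is zero, and
  then so is the one in xi_j.\<close>

lemma E_zero_imp:
  assumes "E0 i j f = 0" "E1 i j f = 0"
  shows "ban j f = 0" "fan j f = 0"
proof -
  have 0: "fcr i (fcr i g) = 0" for g
    using fock_self_neg[OF fcr_fcr[of i i g]] .
  have 1: "bcr i (ban j f) = - fcr i (fan j f)" "bcr i (fan j f) = - fcr i (ban j f)"
    using assms unfolding E0_def E1_def by (simp_all only: add_eq_0_iff2)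
  have "bcr i (bcr i (ban j f)) = - fcr i (bcr i (fan j f))"
    by (simp only: 1(1) fock_lin fermi_bose)
  also have "\<dots> = 0" by (simp only: 1(2) fock_lin 0 minus_zero)
  finally show "ban j f = 0" using bcr_inj by blast
  then have "bcr i (fan j f) = 0" by (simp only: 1(2) fock_lin minus_zero)
  then show "fan j f = 0" using bcr_inj by blast
qed

lemma sc_eq_zero: "c \<noteq> 0 \<Longrightarrow> sc c f = 0 \<Longrightarrow> f = 0"
  by (auto simp: sc_def fun_eq_iff)

lemma q_singular:
  assumes f: "f \<in> EV n p" and p: "p > 0"
    and z: "\<And>j \<sigma>. 1 \<le> j \<Longrightarrow> j \<le> n \<Longrightarrow> rho n p (0, j, \<sigma>) f = 0"
  shows "f = sc (f (\<lambda>k. if k = 0 then p else 0, {})) (v0 p)"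
proof -
  obtain q where q: "p = Suc q" using p by (cases p) auto
  have ban0: "ban j f = 0" and fan0: "fan j f = 0" if j: "1 \<le> j" "j \<le> n" for j
  proof -
    have e0: "E0 0 j f = 0" using z[OF j, of 0] by (simp only: rho_simps)
    have "sc (1 / csq p) (E1 0 j (JJ n f)) = 0" using z[OF j, of 1] by (simp only: rho_simps)
    then have "E1 0 j (JJ n f) = 0"
      by (rule sc_eq_zero[rotated]) (simp add: csq_nonzero p)
    then have "- JJ n (E1 0 j f) = 0" using E_JJ(2)[of 0 n j f] j by simp
    \<comment> \<open>In degree \<open>p\<close> the square of \<open>JJ\<close> is the nonzero
      scalar \<open>- p\<close>, so \<open>JJ\<close> can be cancelled.\<close>
    then have "JJ n (JJ n (E1 0 j f)) = 0" by (simp only: neg_equal_0_iff_equal JJ_lin)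
    moreover have "E1 0 j f \<in> Fk n p UNIV"
      using f j unfolding EV_def q by (intro E1_Fk) auto
    ultimately have "sc (- of_nat p) (E1 0 j f) = 0" using JJ_JJ_Fk by metis
    then have "E1 0 j f = 0"
      by (rule sc_eq_zero[rotated]) (simp add: p)
    then show "ban j f = 0" "fan j f = 0" using E_zero_imp e0 by blast+
  qed
  show ?thesis
  proof (rule ext, rule ccontr)
    fix m assume m: "f m \<noteq> sc (f (\<lambda>k. if k = 0 then p else 0, {})) (v0 p) m"
    obtain \<alpha> S where mm: "m = (\<alpha>, S)" by (cases m)
    show False
    proof (cases "f m = 0")
      case True
      then show ?thesis using m by (auto simp: sc_def v0_def basis_fn_def split: if_splits)
    next
      case False
      then have M: "m \<in> mons n p (Collect even)" using f FkD unfolding EV_def by blast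
      have a: "\<alpha> j = 0" if "j \<noteq> 0" for j
      proof (cases "j \<le> n")
        case True
        then show ?thesis using ban_zeroD[OF ban0, of j \<alpha> S] that False mm by auto
      qed (use M mm in \<open>auto simp: mons_def\<close>)
      have "j = 0" if "j \<in> S" for j
      proof (rule ccontr)
        assume "j \<noteq> 0"
        moreover have "j \<le> n" using that M mm by (auto simp: mons_def)
        ultimately show False using fan_zeroD[OF fan0, of j S \<alpha>] that False mm by auto
      qed
      then have "S \<subseteq> {0}" by auto
      \<comment> \<open>Parity enters here: x_0^(p-1) xi_0 is also killed by all derivatives of
        positive index, but its xi-degree is odd.\<close>
      moreover have "S \<noteq> {0}" using M mm by (auto simp: mons_def)
      ultimately have S: "S = {}" by auto
      have "(\<Sum>k\<le>n. \<alpha> k) = \<alpha> 0" using a by (subst sum.remove[of _ 0]) auto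
      then have "\<alpha> 0 = p" using M mm S by (auto simp: mons_def)
      then have "\<alpha> = (\<lambda>k. if k = 0 then p else 0)" using a by (auto simp: fun_eq_iff)
      then show ?thesis using m S mm by (simp add: sc_def v0_def basis_fn_def)
    qed
  qed
qed

definition qidx_set :: "nat \<Rightarrow> qidx set" where
  "qidx_set n = {(i, j, \<sigma>). i \<le> n \<and> j \<le> n}"

lemma subsp_EV: "subsp (EV n p)"
  unfolding EV_def by (rule subsp_Fk)

lemma rho_EV: "p > 0 \<Longrightarrow> a \<in> qidx_set n \<Longrightarrow> f \<in> EV n p \<Longrightarrow> rho n p a f \<in> EV n p"
  unfolding EV_def using rho_Fk[of f n "p - 1"] by (auto simp: qidx_set_def)

lemma EV_simple:
  assumes p: "p > 0"
    and N: "subsp N" "N \<subseteq> EV n p" "\<And>a f. a \<in> qidx_set n \<Longrightarrow> f \<in> N \<Longrightarrow> rho n p a f \<in> N" "N \<noteq> {0}"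
  shows "N = EV n p"
proof (rule unitary_simple[where p = p and A = "qidx_set n" and T = "rho n p" and
      ad = "\<lambda>(i, j, \<sigma>). (j, i, \<sigma>)" and s = "v0 p"])
  show "subsp (EV n p)" "EV n p \<subseteq> Fk n p (Collect even)"
    by (auto simp: EV_def subsp_Fk)
  show "ip n p (rho n p a f) g = ip n p f (rho n p ((\<lambda>(i, j, \<sigma>). (j, i, \<sigma>)) a) g)" if "a \<in> qidx_set n" for a f g
    using ip_rho[of _ n _ "p - 1" p] that p by (auto simp: qidx_set_def)
  show "v0 p \<noteq> 0" by (rule v0_nonzero)
  fix N assume N: "subsp N" "N \<subseteq> EV n p" "\<And>a f. a \<in> qidx_set n \<Longrightarrow> f \<in> N \<Longrightarrow> rho n p a f \<in> N" "N \<noteq> {0}"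
  obtain f where f: "f \<in> N" "f \<noteq> 0" using N(4) subsp_zero[OF N(1)] by blast
  \<comment> \<open>Row 0 suffices: the common kernel of these operators in \<open>EV n p\<close> is
    the line of \<open>v0 p\<close>, and each lowers the height by at least 1.\<close>
  let ?R = "{rho n p (0, j, \<sigma>) | j \<sigma>. 1 \<le> j \<and> j \<le> n}"
  have "\<exists>g\<in>N. g \<noteq> 0 \<and> (\<forall>r\<in>?R. r g = 0)"
  proof (rule exists_lowest[OF _ f])
    show "N \<subseteq> Fk n p (Collect even)" using N(2) by (simp add: EV_def)
    show "r f \<in> N" if "r \<in> ?R" "f \<in> N" for r f
      using that N(3) by (auto simp: qidx_set_def)
    show "r f \<in> Vh n (h - 1)" if rR: "r \<in> ?R" and fV: "f \<in> Vh n h" for r f h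
    proof -
      obtain j \<sigma> where j: "1 \<le> j" "j \<le> n" and r: "r = rho n p (0, j, \<sigma>)" using rR by blast
      show ?thesis
        using E_Vh[of f n h 0 j "h - 1"] E_Vh[of "JJ n f" n h 0 j "h - 1"] JJ_Vh[of f n h] fV j
        by (cases "\<sigma> = 0") (simp_all add: r rho_def subsp_sc[OF subsp_Vh])
    qed
  qed
  then obtain g where g: "g \<in> N" "g \<noteq> 0" "\<And>j \<sigma>. 1 \<le> j \<Longrightarrow> j \<le> n \<Longrightarrow> rho n p (0, j, \<sigma>) g = 0"
    by blast
  obtain c where c: "g = sc c (v0 p)" using q_singular[OF _ p g(3)] g(1) N(2) by blast
  then have "c \<noteq> 0" using g(2) by auto
  then have "v0 p = sc (1 / c) g" by (simp add: c)
  then show "v0 p \<in> N" using subsp_sc[OF N(1) g(1)] by simp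
next
  show "rho n p a f \<in> EV n p" if "a \<in> qidx_set n" "f \<in> EV n p" for a f
    using rho_EV[OF p] that by blast
  show "(case a of (i, j, \<sigma>) \<Rightarrow> (j, i, \<sigma>)) \<in> qidx_set n" if "a \<in> qidx_set n" for a
    using that by (auto simp: qidx_set_def)
qed (fact N)+

section \<open>The decomposition under the even part\<close>

text \<open>The component of highest weight (p-i, 1^i). Degree \<open>p\<close> contains it twice,
  as the kernel of \<open>dl\<close> in xi-degree \<open>i\<close> and as the kernel of
  \<open>dd\<close> in xi-degree \<open>i + 1\<close>; the parity of \<open>i\<close> selects the
  copy of even xi-degree.\<close>

definition Wm :: "nat \<Rightarrow> nat \<Rightarrow> nat \<Rightarrow> fock set" where
  "Wm n p i = (if even i then {f \<in> Fk n p {i}. dl n f = 0} else {f \<in> Fk n p {Suc i}. dd n f = 0})"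

lemma subsp_Wm: "subsp (Wm n p i)"
  using subsp_Fk[of n p] by (auto simp: Wm_def subsp_def)

lemma Wm_EV: "Wm n p i \<subseteq> EV n p"
  using Fk_mono[of "{i}" "Collect even" n p] Fk_mono[of "{Suc i}" "Collect even" n p]
  by (auto simp: Wm_def EV_def)

lemma E0_Wm:
  assumes "p > 0" "f \<in> Wm n p i" "k \<le> n" "l \<le> n"
  shows "E0 k l f \<in> Wm n p i"
  using assms E0_Fk[of f n "p - 1" _ k l] E0_dd[OF assms(3,4), symmetric]
  by (auto simp: Wm_def split: if_splits)

definition hwm :: "nat \<Rightarrow> nat \<Rightarrow> mon" where
  "hwm a b = (\<lambda>k. if k = 0 then a else 0, {1..b})"

lemma initial_segment:
  assumes "finite S" "0 \<notin> S" "\<And>k l. 1 \<le> k \<Longrightarrow> k < l \<Longrightarrow> l \<in> S \<Longrightarrow> k \<in> S"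
  shows "S = {1..card S}"
proof (cases "S = {}")
  case False
  have "S = {1..Max S}"
  proof
    show "S \<subseteq> {1..Max S}" using assms(1,2) by (auto simp: Suc_le_eq intro: gr0I)
    have "Max S \<in> S" using assms(1) False by simp
    then show "{1..Max S} \<subseteq> S" using assms(3)[of _ "Max S"] by (auto simp: le_less)
  qed
  then show ?thesis by (metis card_atLeastAtMost diff_Suc_1)
qed simp

text \<open>A singular vector in the kernel of \<open>dl\<close> is determined by its coefficient at
  x_0^(p-b) xi_1 ... xi_b. Among monomials whose x-part is a power of x_0, the others are excluded
  by \<open>dl\<close> and by the operators \<open>E0 k l\<close> with 1 \<le> k < l. Every further
  coefficient reduces, through \<open>E0 0 j\<close>, to coefficients with a higher power of
  x_0.\<close>

lemma singular_zero:
  assumes f: "f \<in> Fk n p {b}" and d: "dl n f = 0"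
    and s: "\<And>i j. i < j \<Longrightarrow> j \<le> n \<Longrightarrow> E0 i j f = 0"
    and z: "f (hwm (p - b) b) = 0"
  shows "f = 0"
proof -
  let ?a = "\<lambda>k :: nat. if k = 0 then p - b else 0"
  have top: "f (?a, S) = 0" for S
  proof (rule ccontr)
    assume nz: "f (?a, S) \<noteq> 0"
    then have M: "(?a, S) \<in> mons n p {b}" using f FkD by blast
    then have S: "S \<subseteq> {..n}" "card S = b" "finite S" by (auto simp: mons_def finite_subset)
    have "0 \<notin> S"
    proof
      assume 0: "0 \<in> S"
      \<comment> \<open>At this exponent only x_0 occurs, so \<open>dl\<close> receives a
        contribution from \<open>k = 0\<close> alone, which isolates the coefficient in
        question.\<close>
      let ?a' = "\<lambda>k :: nat. if k = 0 then Suc (p - b) else 0"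
      have "?a'(0 := p - b) = ?a" by auto
      then have t: "bcr k (fan k f) (?a', S - {0}) = (if k = 0 then fsgn 0 S * f (?a, S) else 0)" for k
        using 0 by (auto simp: bcr_def fan_def insert_absorb)
      have "0 = dl n f (?a', S - {0})" using d by simp
      also have "\<dots> = fsgn 0 S * f (?a, S)"
        by (simp only: dl_def sum_fun_apply t sum.delta finite_atMost atMost_iff if_True le0)
      finally show False using nz by simp
    qed
    moreover have "k \<in> S" if "1 \<le> k" "k < l" "l \<in> S" for k l
    proof (rule ccontr)
      assume k: "k \<notin> S"
      \<comment> \<open>\<open>E0 k l\<close> trades xi_l for xi_k. Its bosonic part vanishes at
        this monomial, where x_k is absent.\<close>
      let ?T = "insert k (S - {l})"
      have "E0 k l f (?a, ?T) = 0" using s[OF that(2)] that S by auto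
      moreover have "?T - {k} = S - {l}" using k by auto
      ultimately have "fsgn k ?T * (fsgn l (S - {l}) * f (?a, S)) = 0"
        using that by (simp add: E0_def bcr_def fcr_def fan_def insert_absorb)
      then show False using nz by simp
    qed
    ultimately have "S = {1..b}" using initial_segment[of S] S by blast
    then show False using z nz by (simp add: hwm_def)
  qed
  have "f (\<alpha>, S) = 0" for \<alpha> S
  proof (induction "p - \<alpha> 0" arbitrary: \<alpha> S rule: less_induct)
    case less
    show ?case
    proof (rule ccontr)
      assume nz: "f (\<alpha>, S) \<noteq> 0"
      then have M: "(\<alpha>, S) \<in> mons n p {b}" using f FkD by blast
      show False
      proof (cases "\<exists>j\<ge>1. \<alpha> j \<noteq> 0")
        case False
        then have a: "\<alpha> k = 0" if "k \<noteq> 0" for k using that by (metis One_nat_def Suc_leI neq0_conv)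
        then have "(\<Sum>k\<le>n. \<alpha> k) = \<alpha> 0" by (subst sum.remove[of _ 0]) auto
        then have "\<alpha> 0 = p - b" using M by (auto simp: mons_def)
        then have "\<alpha> = ?a" using a by (auto simp: fun_eq_iff)
        then show False using top nz by metis
      next
        case True
        then obtain j where j: "j \<ge> 1" "\<alpha> j \<noteq> 0" by blast
        have jn: "j \<le> n" using M j by (auto simp: mons_def not_less[symmetric])
        have "(\<Sum>k\<in>{0, j}. \<alpha> k) \<le> (\<Sum>k\<le>n. \<alpha> k)"
          using jn by (intro sum_mono2) auto
        then have lt: "\<alpha> 0 < p" using M j by (auto simp: mons_def)
        \<comment> \<open>One x_j is traded for x_0. The xi-part of \<open>E0 0 j f\<close> at
          \<beta> involves only coefficients with exponent \<beta>, which vanish by induction, so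
          the bosonic part must vanish too.\<close>
        define \<beta> where "\<beta> = (\<alpha>(j := \<alpha> j - 1))(0 := Suc (\<alpha> 0))"
        have b0: "\<beta> 0 = Suc (\<alpha> 0)" and bb: "(\<beta>(0 := \<alpha> 0))(j := Suc ((\<beta>(0 := \<alpha> 0)) j)) = \<alpha>"
          using j by (auto simp: \<beta>_def)
        have "f (\<beta>, T) = 0" for T
          using less[of \<beta> T] lt b0 by simp
        then have "fcr 0 (fan j f) (\<beta>, S) = 0"
          by (simp add: fcr_def fan_def)
        moreover have "E0 0 j f (\<beta>, S) = 0" using s[of 0 j] j jn by simp
        ultimately have "bcr 0 (ban j f) (\<beta>, S) = 0" by (simp add: E0_def)
        then have "f ((\<beta>(0 := \<alpha> 0))(j := Suc ((\<beta>(0 := \<alpha> 0)) j)), S) = 0"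
          by (simp add: bcr_def ban_def b0 del: of_nat_Suc)
        then show False using nz by (simp only: bb)
      qed
    qed
  qed
  then show ?thesis by (auto simp: fun_eq_iff)
qed

text \<open>
  For odd \<open>i\<close> the map \<open>dl\<close> embeds \<open>Wm n p i\<close> into the kernel of \<open>dl\<close> in \<open>\<xi>\<close>-degree \<open>i\<close>, so both parities
  reduce to \<open>singular_zero\<close>.
\<close>

definition core :: "nat \<Rightarrow> nat \<Rightarrow> fock \<Rightarrow> fock" where
  "core n i f = (if even i then f else dl n f)"

lemma linop_core: "linop (core n i)"
  by (simp add: linop_def core_def)

lemma core_Wm:
  assumes "p > 0" "f \<in> Wm n p i"
  shows "core n i f \<in> Fk n p {i}" "dl n (core n i f) = 0" "core n i f = 0 \<Longrightarrow> f = 0"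
proof -
  have "{b. Suc b = Suc i} = {i}" by auto
  then show "core n i f \<in> Fk n p {i}" "dl n (core n i f) = 0"
    using assms dl_Fk[of f n "p - 1" "{Suc i}"] by (auto simp: core_def Wm_def dl_dl split: if_splits)
  show "f = 0" if "core n i f = 0"
  proof (cases "even i")
    case False
    \<comment> \<open>A vector killed by both differentials is killed by their anticommutator, the
      scalar \<open>p\<close>.\<close>
    then have "dl n f = 0" "dd n f = 0" "f \<in> Fk n p {Suc i}"
      using that assms(2) by (auto simp: core_def Wm_def)
    then have "sc (of_nat p) f = 0"
      using dd_dl[of n f] Deg_Fk[of f n p] by simp
    then show ?thesis by (rule sc_eq_zero[rotated]) (use assms(1) in simp)
  qed (use that in \<open>simp add: core_def\<close>)
qed

text \<open>Subtracting the multiple of \<open>g\<close> that cancels the leading coefficient of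
  \<open>core\<close> leaves a singular vector to which \<open>singular_zero\<close>
  applies.\<close>

lemma singular_proportional:
  assumes p: "p > 0" and g: "g \<in> Wm n p i" "g \<noteq> 0" "\<And>k l. k < l \<Longrightarrow> l \<le> n \<Longrightarrow> E0 k l g = 0"
    and h: "h \<in> Wm n p i" "\<And>k l. k < l \<Longrightarrow> l \<le> n \<Longrightarrow> E0 k l h = 0"
  shows "\<exists>c. h = sc c g"
proof -
  let ?m = "hwm (p - i) i"
  have key: "u = 0" if u: "u \<in> Wm n p i" "\<And>k l. k < l \<Longrightarrow> l \<le> n \<Longrightarrow> E0 k l u = 0" "core n i u ?m = 0" for u
  proof (rule core_Wm(3)[OF p u(1)])
    show "core n i u = 0"
    proof (rule singular_zero[OF core_Wm(1,2)[OF p u(1)]])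
      show "E0 k l (core n i u) = 0" if "k < l" "l \<le> n" for k l
        using u(2)[OF that] E0_dd(2)[of k n l u] that by (simp add: core_def)
    qed (rule u(3))
  qed
  let ?c = "core n i h ?m / core n i g ?m"
  have nz: "core n i g ?m \<noteq> 0" using key[OF g(1) g(3)] g(2) by blast
  have "h - sc ?c g = 0"
  proof (rule key)
    show "h - sc ?c g \<in> Wm n p i"
      by (intro subsp_diff[OF subsp_Wm] subsp_sc[OF subsp_Wm] g h)
    show "E0 k l (h - sc ?c g) = 0" if "k < l" "l \<le> n" for k l
      by (simp add: g(3)[OF that] h(2)[OF that])
    show "core n i (h - sc ?c g) ?m = 0"
      using nz by (simp add: linop_diff[OF linop_core] linop_sc[OF linop_core] sc_apply)
  qed
  then have "h = sc ?c g" by (simp only: right_minus_eq)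
  then show ?thesis by blast
qed

text \<open>The monomial x_0^(p-i-1) xi_0 ... xi_i, whose factor xi_0 restores the weight p - i at
  position 0. It is closed under \<open>dd\<close> and has xi-degree \<open>i + 1\<close>; its image
  under \<open>dl\<close> has the same weight in xi-degree \<open>i\<close>.\<close>

definition etop :: "nat \<Rightarrow> nat \<Rightarrow> fock" where
  "etop p i = basis_fn (\<lambda>k. if k = 0 then p - Suc i else 0, {..i})"

definition hwv :: "nat \<Rightarrow> nat \<Rightarrow> nat \<Rightarrow> fock" where
  "hwv n p i = (if even i then dl n (etop p i) else etop p i)"

context
  fixes n p i :: nat
  assumes i: "i \<le> n" "i < p"
begin

lemma etop_Fk: "etop p i \<in> Fk n p {Suc i}"
proof -
  have "(\<Sum>k\<le>n. if k = 0 then p - Suc i else 0) = p - Suc i" by simp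
  then show ?thesis unfolding etop_def using i by (intro basis_fn_Fk) (auto simp: mons_def)
qed

lemma etop_ban: "k \<noteq> 0 \<Longrightarrow> ban k (etop p i) = 0"
proof (rule ext)
  fix m :: mon assume "k \<noteq> 0"
  obtain \<alpha> S where m: "m = (\<alpha>, S)" by (cases m)
  have "\<alpha>(k := Suc (\<alpha> k)) \<noteq> (\<lambda>k. if k = 0 then p - Suc i else 0)"
  proof
    assume "\<alpha>(k := Suc (\<alpha> k)) = (\<lambda>k. if k = 0 then p - Suc i else 0)"
    from fun_cong[OF this, of k] show False using \<open>k \<noteq> 0\<close> by simp
  qed
  then show "ban k (etop p i) m = 0 m" by (simp add: m ban_def etop_def basis_fn_def)
qed

lemma etop_fcr: "k \<le> i \<Longrightarrow> fcr k (etop p i) = 0"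
  by (rule ext) (auto simp: fcr_def etop_def basis_fn_def)

lemma etop_fan: "k > i \<Longrightarrow> fan k (etop p i) = 0"
proof -
  assume "k > i"
  then have "insert k S \<noteq> {..i}" for S by (metis atMost_iff insertI1 not_less)
  then show ?thesis by (auto simp: fan_def etop_def basis_fn_def fun_eq_iff)
qed

text \<open>For \<open>l \<le> i\<close> the factor xi_k is already present, as
  \<open>k < l\<close>; for larger \<open>l\<close> there is no xi_l to differentiate. In either
  case x_l is absent.\<close>

lemma etop_singular:
  assumes "k < l"
  shows "E0 k l (etop p i) = 0"
proof -
  have "fcr k (fan l (etop p i)) = 0"
  proof (cases "l \<le> i")
    case True
    have "fcr k (fan l (etop p i)) = - fan l (fcr k (etop p i))"
      using fan_fcr[of l k "etop p i"] assms by simp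
    then show ?thesis using etop_fcr[of k] True assms by simp
  qed (simp add: etop_fan)
  then show ?thesis using etop_ban[of l] assms by (simp add: E0_def)
qed

lemma etop_dd: "dd n (etop p i) = 0"
  unfolding dd_def
proof (intro sum.neutral ballI)
  fix k
  show "fcr k (ban k (etop p i)) = 0"
    by (cases "k = 0") (simp_all add: etop_ban fermi_bose etop_fcr)
qed

lemma etop_weight: "E0 k k (etop p i) = sc (of_int (hook_weight p i k)) (etop p i)"
proof (rule ext)
  fix m :: mon
  obtain \<alpha> S where m: "m = (\<alpha>, S)" by (cases m)
  show "E0 k k (etop p i) m = sc (of_int (hook_weight p i k)) (etop p i) m"
  proof (cases "m = (\<lambda>k. if k = 0 then p - Suc i else 0, {..i})")
    case True
    then have "\<alpha> = (\<lambda>k. if k = 0 then p - Suc i else 0)" "S = {..i}" by (simp_all add: m)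
    then show ?thesis
      using i by (auto simp: E0_def number_ops sc_apply m hook_weight_def etop_def basis_fn_def of_nat_diff)
  next
    case False
    then have "etop p i m = 0" by (simp add: etop_def basis_fn_def)
    then show ?thesis by (simp add: E0_def number_ops sc_apply m)
  qed
qed

lemma etop_nonzero: "etop p i \<noteq> 0"
proof
  assume "etop p i = 0"
  then have "etop p i (\<lambda>k. if k = 0 then p - Suc i else 0, {..i}) = 0" by simp
  then show False by (simp add: etop_def basis_fn_def)
qed

text \<open>As \<open>dd\<close> kills \<open>etop p i\<close>, the composite of \<open>dl\<close>
  followed by \<open>dd\<close> acts on it as the scalar \<open>p\<close>.\<close>

lemma dl_etop_nonzero: "dl n (etop p i) \<noteq> 0"
proof
  assume "dl n (etop p i) = 0"
  then have "sc (of_nat p) (etop p i) = 0"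
    using dd_dl[of n "etop p i"] Deg_Fk[OF etop_Fk] etop_dd by simp
  then have "etop p i = 0" by (rule sc_eq_zero[rotated]) (use i in simp)
  then show False using etop_nonzero by simp
qed

lemma hwv_Wm: "hwv n p i \<in> Wm n p i"
proof -
  have "{b. Suc b = Suc i} = {i}" by auto
  then show ?thesis
    using dl_Fk[of "etop p i" n "p - 1" "{Suc i}"] etop_Fk i
    by (auto simp: hwv_def Wm_def dl_dl etop_dd)
qed

lemma hwv_nonzero: "hwv n p i \<noteq> 0"
  by (simp add: hwv_def etop_nonzero dl_etop_nonzero)

lemma hwv_singular: "k < l \<Longrightarrow> l \<le> n \<Longrightarrow> E0 k l (hwv n p i) = 0"
  using E0_dd(2)[of k n l "etop p i"] by (simp add: hwv_def etop_singular)

lemma hwv_weight: "k \<le> n \<Longrightarrow> E0 k k (hwv n p i) = sc (of_int (hook_weight p i k)) (hwv n p i)"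
  using E0_dd(2)[of k n k "etop p i"] by (simp add: hwv_def etop_weight)

lemma hwv_in_submodule:
  assumes N: "subsp N" "N \<subseteq> Wm n p i" "\<And>k l f. k \<le> n \<Longrightarrow> l \<le> n \<Longrightarrow> f \<in> N \<Longrightarrow> E0 k l f \<in> N" "N \<noteq> {0}"
  shows "hwv n p i \<in> N"
proof -
  obtain f where f: "f \<in> N" "f \<noteq> 0" using N(4) subsp_zero[OF N(1)] by blast
  let ?R = "{E0 k l | k l. k < l \<and> l \<le> n}"
  have "\<exists>g\<in>N. g \<noteq> 0 \<and> (\<forall>r\<in>?R. r g = 0)"
  proof (rule exists_lowest[OF _ f])
    show "N \<subseteq> Fk n p (Collect even)" using N(2) Wm_EV unfolding EV_def by blast
    show "r f \<in> N" if "r \<in> ?R" "f \<in> N" for r f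
      using that N(3) by auto
    show "r f \<in> Vh n (h - 1)" if "r \<in> ?R" "f \<in> Vh n h" for r f h
      using that by (auto intro!: E_Vh)
  qed
  then obtain g where g: "g \<in> N" "g \<noteq> 0" "\<And>k l. k < l \<Longrightarrow> l \<le> n \<Longrightarrow> E0 k l g = 0"
    by blast
  have "g \<in> Wm n p i" using g(1) N(2) by blast
  then obtain c where "hwv n p i = sc c g"
    using singular_proportional[OF _ _ g(2) g(3) hwv_Wm hwv_singular] i by auto
  then show ?thesis using subsp_sc[OF N(1) g(1)] by metis
qed

lemma Wm_irreducible:
  assumes N: "subsp N" "N \<subseteq> Wm n p i" "\<And>k l f. k \<le> n \<Longrightarrow> l \<le> n \<Longrightarrow> f \<in> N \<Longrightarrow> E0 k l f \<in> N" "N \<noteq> {0}"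
  shows "N = Wm n p i"
proof (rule unitary_simple[where p = p and A = "{..n} \<times> {..n}" and T = "\<lambda>(k, l). E0 k l" and
      ad = "\<lambda>(k, l). (l, k)" and s = "hwv n p i"])
  have p: "p > 0" using i by simp
  show "Wm n p i \<subseteq> Fk n p (Collect even)"
    using Wm_EV unfolding EV_def .
  show "(case a of (k, l) \<Rightarrow> E0 k l) f \<in> Wm n p i" if "a \<in> {..n} \<times> {..n}" "f \<in> Wm n p i" for a f
    using that E0_Wm[OF p] by auto
  show "ip n p ((case a of (k, l) \<Rightarrow> E0 k l) f) g = ip n p f ((case (case a of (k, l) \<Rightarrow> (l, k)) of (k, l) \<Rightarrow> E0 k l) g)"
    if "a \<in> {..n} \<times> {..n}" for a f g
    using ip_E(1)[of _ n _ "p - 1"] that p by auto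
  show "hwv n p i \<in> N'" if N': "subsp N'" "N' \<subseteq> Wm n p i"
    "\<And>a f. a \<in> {..n} \<times> {..n} \<Longrightarrow> f \<in> N' \<Longrightarrow> (case a of (k, l) \<Rightarrow> E0 k l) f \<in> N'" "N' \<noteq> {0}" for N'
  proof (rule hwv_in_submodule[OF N'(1,2) _ N'(4)])
    show "E0 k l f \<in> N'" if "k \<le> n" "l \<le> n" "f \<in> N'" for k l f
      using N'(3)[of "(k, l)" f] that by simp
  qed
  show "(case a of (k, l) \<Rightarrow> E0 k l) f \<in> N" if "a \<in> {..n} \<times> {..n}" "f \<in> N" for a f
    using that N(3) by auto
  show "(case a of (k, l) \<Rightarrow> (l, k)) \<in> {..n} \<times> {..n}" if "a \<in> {..n} \<times> {..n}" for a
    using that by auto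
qed (rule N subsp_Wm hwv_nonzero)+

end

section \<open>Projections onto the components\<close>

definition restr :: "nat \<Rightarrow> fock \<Rightarrow> fock" where
  "restr c f = (\<lambda>(\<alpha>, S). if card S = c then f (\<alpha>, S) else 0)"

text \<open>Both differentials square to zero and their anticommutator is \<open>p\<close>, so their
  two products divided by \<open>p\<close> are complementary projections. On the even part one of
  the two terms is zero by parity; keeping both makes the formula uniform in
  \<open>i\<close>.\<close>

definition comp :: "nat \<Rightarrow> nat \<Rightarrow> nat \<Rightarrow> fock \<Rightarrow> fock" where
  "comp n p i f = sc (1 / of_nat p) (dl n (dd n (restr i f)) + dd n (dl n (restr (Suc i) f)))"

lemma linop_restr: "linop (restr c)"
  by (auto simp: linop_def restr_def sc_def fun_eq_iff)

lemma linop_comp_proj: "linop (comp n p i)"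
  by (simp add: linop_def comp_def linop_add[OF linop_restr] linop_sc[OF linop_restr] sc_add mult.commute)

lemma restr_Fk: "f \<in> Fk n p B \<Longrightarrow> restr c f \<in> Fk n p {c}"
proof (rule FkI)
  fix m :: mon assume f: "f \<in> Fk n p B" and "restr c f m \<noteq> 0"
  moreover obtain \<alpha> S where m: "m = (\<alpha>, S)" by (cases m)
  ultimately have "card S = c" "f (\<alpha>, S) \<noteq> 0" by (auto simp: restr_def split: if_splits)
  then show "m \<in> mons n p {c}" using FkD[OF f, of m] m by (auto simp: mons_def)
qed

lemma restr_same: "f \<in> Fk n p {c} \<Longrightarrow> restr c f = f"
proof (rule ext)
  fix m :: mon assume f: "f \<in> Fk n p {c}"
  obtain \<alpha> S where m: "m = (\<alpha>, S)" by (cases m)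
  show "restr c f m = f m" using FkD[OF f, of m] by (auto simp: restr_def m mons_def)
qed

lemma restr_other:
  assumes f: "f \<in> Fk n p B" and "c \<notin> B"
  shows "restr c f = 0"
proof (rule ext)
  fix m :: mon
  obtain \<alpha> S where m: "m = (\<alpha>, S)" by (cases m)
  show "restr c f m = 0 m" using FkD[OF f, of m] assms(2) by (auto simp: restr_def m mons_def)
qed

lemma Fk_trivial:
  assumes "c > Suc n \<or> c > p" "f \<in> Fk n p {c}"
  shows "f = 0"
proof (rule ext, rule ccontr)
  fix m :: mon assume "f m \<noteq> 0 m"
  then have M: "m \<in> mons n p {c}" using FkD[OF assms(2), of m] by (simp only: zero_fun_apply not_False_eq_True)
  obtain \<alpha> S where m: "m = (\<alpha>, S)" by (cases m)
  have "S \<subseteq> {..n}" "card S \<le> p" "card S = c"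
    using M by (auto simp: mons_def m)
  moreover from this have "card S \<le> Suc n" using card_mono[of "{..n}" S] by simp
  ultimately show False using assms(1) by linarith
qed

lemma dl_Fk0: "f \<in> Fk n p {0} \<Longrightarrow> dl n f = 0"
proof -
  assume f: "f \<in> Fk n p {0}"
  have "fan k f = 0" for k
  proof (rule ext, rule ccontr)
    fix m :: mon assume "fan k f m \<noteq> 0 m"
    moreover obtain \<alpha> S where m: "m = (\<alpha>, S)" by (cases m)
    ultimately have "f (\<alpha>, insert k S) \<noteq> 0" by (auto simp: fan_def split: if_splits)
    then have "(\<alpha>, insert k S) \<in> mons n p {0}" using FkD[OF f] by blast
    then show False using finite_subset[of "insert k S" "{..n}"] by (auto simp: mons_def)
  qed
  then show ?thesis by (simp add: dl_def)
qed

lemma comp_Wm: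
  assumes p: "p > 0" and f: "f \<in> EV n p"
  shows "comp n p i f \<in> Wm n p i"
proof -
  have e: "{b. Suc b = Suc i} = {i}" by auto
  obtain q where q: "p = Suc q" using p by (cases p) auto
  note f' = f[unfolded EV_def]
  show ?thesis
  proof (cases "even i")
    case True
    then have "restr (Suc i) f = 0" using restr_other[OF f'] by simp
    moreover have "dl n (dd n (restr i f)) \<in> Fk n p {i}"
      using dl_Fk[OF dd_Fk[OF restr_Fk[OF f'[unfolded q]]]] by (simp add: q e)
    ultimately have "comp n p i f \<in> Fk n p {i}" "dl n (comp n p i f) = 0"
      by (simp_all add: comp_def subsp_sc[OF subsp_Fk] dl_dl)
    then show ?thesis using True by (simp add: Wm_def)
  next
    case False
    then have "restr i f = 0" using restr_other[OF f'] by simp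
    moreover have "dd n (dl n (restr (Suc i) f)) \<in> Fk n p {Suc i}"
      using dd_Fk[OF dl_Fk[OF restr_Fk[OF f'[unfolded q], of "Suc i"]]] by (simp add: q)
    ultimately have "comp n p i f \<in> Fk n p {Suc i}" "dd n (comp n p i f) = 0"
      by (simp_all add: comp_def subsp_sc[OF subsp_Fk] dd_dd)
    then show ?thesis using False by (simp add: Wm_def)
  qed
qed

lemma dd_dl_sc:
  assumes "p > 0" "g \<in> Fk n p B"
  shows "sc (1 / of_nat p) (dd n (dl n g) + dl n (dd n g)) = g"
  using assms by (simp add: dd_dl Deg_Fk)

lemma comp_of_Wm:
  assumes p: "p > 0" and g: "g \<in> Wm n p j"
  shows "comp n p i g = (if i = j then g else 0)"
proof (cases "even j")
  case True
  then have g': "g \<in> Fk n p {j}" and d: "dl n g = 0" using g by (auto simp: Wm_def)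
  have r: "restr c g = (if c = j then g else 0)" for c
    using restr_same[OF g'] restr_other[OF g', of c] by auto
  show ?thesis using dd_dl_sc[OF p g'] by (auto simp: comp_def r d)
next
  case False
  then have g': "g \<in> Fk n p {Suc j}" and d: "dd n g = 0" using g by (auto simp: Wm_def)
  have r: "restr c g = (if c = Suc j then g else 0)" for c
    using restr_same[OF g'] restr_other[OF g', of c] by auto
  show ?thesis using dd_dl_sc[OF p g'] by (auto simp: comp_def r d)
qed

text \<open>The xi-degree \<open>i + 1\<close> would exceed the total degree \<open>p\<close> or the
  number \<open>n + 1\<close> of odd variables.\<close>

lemma comp_trivial:
  assumes p: "p > 0" and f: "f \<in> EV n p" and i: "i > n \<or> i \<ge> p"
  shows "comp n p i f = 0"
proof -
  obtain q where q: "p = Suc q" using p by (cases p) auto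
  note f' = f[unfolded EV_def]
  have "dd n (restr i f) \<in> Fk n p {Suc i}"
    using dd_Fk[OF restr_Fk[OF f'[unfolded q]]] by (simp add: q)
  then have "dd n (restr i f) = 0" using i by (intro Fk_trivial) auto
  moreover have "restr (Suc i) f = 0" using i by (intro Fk_trivial[OF _ restr_Fk[OF f']]) auto
  ultimately show ?thesis by (simp add: comp_def)
qed

lemma sum_restr:
  assumes f: "f \<in> Fk n p B"
  shows "(\<Sum>c\<le>Suc (Suc n). restr c f) = f"
proof (rule ext)
  fix m :: mon
  obtain \<alpha> S where m: "m = (\<alpha>, S)" by (cases m)
  show "(\<Sum>c\<le>Suc (Suc n). restr c f) m = f m"
  proof (cases "f m = 0")
    case True
    then have "restr c f m = 0" for c by (simp add: restr_def m)
    then show ?thesis using True by (simp add: sum_fun_apply)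
  next
    case False
    then have "m \<in> mons n p B" using FkD[OF f] by blast
    then have "card S \<le> Suc n" using card_mono[of "{..n}" S] by (auto simp: mons_def m)
    moreover have "restr c f m = (if c = card S then f m else 0)" for c
      by (auto simp: restr_def m)
    ultimately show ?thesis by (simp only: sum_fun_apply sum.delta finite_atMost atMost_iff le_Suc_eq simp_thms if_True)
  qed
qed

lemma sum_comp:
  assumes p: "p > 0" and f: "f \<in> EV n p"
  shows "(\<Sum>i\<in>{i. i \<le> n \<and> i < p}. comp n p i f) = f"
proof -
  note f' = f[unfolded EV_def]
  let ?C = "\<lambda>c. sc (1 / of_nat p) (dl n (dd n (restr c f)))"
  let ?D = "\<lambda>c. sc (1 / of_nat p) (dd n (dl n (restr c f)))"
  \<comment> \<open>Boundary terms: xi-degree \<open>n + 2\<close> is empty, and \<open>dl\<close>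
    vanishes in xi-degree 0. Adding them lets both sums below run over the same range.\<close>
  have C: "?C (Suc (Suc n)) = 0"
    using Fk_trivial[OF _ restr_Fk[OF f'], of "Suc (Suc n)"] by simp
  have D: "?D 0 = 0" by (simp add: dl_Fk0[OF restr_Fk[OF f']])
  have "(\<Sum>i\<in>{i. i \<le> n \<and> i < p}. comp n p i f) = (\<Sum>i\<le>Suc n. comp n p i f)"
    using comp_trivial[OF p f] by (intro sum.mono_neutral_left) auto
  also have "\<dots> = (\<Sum>i\<le>Suc n. ?C i) + (\<Sum>i\<le>Suc n. ?D (Suc i))"
    by (simp only: comp_def sc_add sum.distrib)
  also have "(\<Sum>i\<le>Suc n. ?C i) = (\<Sum>i\<le>Suc (Suc n). ?C i)"
    by (subst (2) sum.atMost_Suc) (simp only: C add_0_right)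
  also have "(\<Sum>i\<le>Suc n. ?D (Suc i)) = (\<Sum>i\<le>Suc (Suc n). ?D i)"
    by (subst (2) sum.atMost_Suc_shift) (simp only: D add_0)
  also have "(\<Sum>i\<le>Suc (Suc n). ?C i) + (\<Sum>i\<le>Suc (Suc n). ?D i) = (\<Sum>c\<le>Suc (Suc n). restr c f)"
    unfolding sum.distrib[symmetric]
  proof (rule sum.cong)
    show "?C c + ?D c = restr c f" for c
      using dd_dl_sc[OF p restr_Fk[OF f', of c]] by (simp only: sc_add add.commute)
  qed simp
  also have "\<dots> = f" by (rule sum_restr[OF f'])
  finally show ?thesis .
qed

section \<open>The dimension\<close>

text \<open>Indices below \<open>m\<close> instead of up to \<open>n\<close>, so that the recursion
  on the number of variables can start from none.\<close>

definition Mc :: "nat \<Rightarrow> nat \<Rightarrow> bool \<Rightarrow> mon set" where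
  "Mc m p \<epsilon> = {(\<alpha>, S). (\<forall>k\<ge>m. \<alpha> k = 0) \<and> S \<subseteq> {..<m} \<and> (\<Sum>k<m. \<alpha> k) + card S = p \<and> even (card S) = \<epsilon>}"

lemma Mc_Suc: "Mc (Suc n) p \<epsilon> = mons n p {b. even b = \<epsilon>}"
  by (auto simp: Mc_def mons_def lessThan_Suc_atMost Suc_le_eq)

lemma Mc_0: "Mc 0 p \<epsilon> = (if p = 0 \<and> \<epsilon> then {(\<lambda>_. 0, {})} else {})"
  by (auto simp: Mc_def)

lemma finite_Mc: "finite (Mc m p \<epsilon>)"
  by (cases m) (simp_all add: Mc_0 Mc_Suc finite_mons)

lemma card_Mc_0: "card (Mc m 0 \<epsilon>) = (if \<epsilon> then 1 else 0)"
proof -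
  have "Mc m 0 \<epsilon> = (if \<epsilon> then {(\<lambda>_. 0, {})} else {})"
  proof -
    have "\<alpha> = (\<lambda>_. 0) \<and> S = {}" if "(\<alpha>, S) \<in> Mc m 0 \<epsilon>" for \<alpha> S
    proof
      have S: "S \<subseteq> {..<m}" "card S = 0" "\<And>k. k \<ge> m \<Longrightarrow> \<alpha> k = 0" "(\<Sum>k<m. \<alpha> k) = 0"
        using that by (auto simp: Mc_def)
      then show "S = {}" using finite_subset[of S "{..<m}"] by auto
      have "\<alpha> k = 0" for k using S(3)[of k] S(4) by (cases "k < m") auto
      then show "\<alpha> = (\<lambda>_. 0)" by auto
    qed
    then have "Mc m 0 \<epsilon> \<subseteq> {(\<lambda>_. 0, {})}" by auto
    moreover have "(\<lambda>_. 0, {}) \<in> Mc m 0 \<epsilon> \<longleftrightarrow> \<epsilon>" by (auto simp: Mc_def)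
    ultimately show ?thesis by auto
  qed
  then show ?thesis by simp
qed

text \<open>The monomials are sorted by the last pair of variables: divisible by x_m, free of both,
  or containing xi_m but not x_m. Removing xi_m flips the parity.\<close>

lemma card_Mc_Suc:
  "card (Mc (Suc m) (Suc p) \<epsilon>) = card (Mc (Suc m) p \<epsilon>) + card (Mc m (Suc p) \<epsilon>) + card (Mc m p (\<not> \<epsilon>))"
proof -
  let ?A = "(\<lambda>(\<alpha>, S). (\<alpha>(m := Suc (\<alpha> m)), S :: nat set)) ` Mc (Suc m) p \<epsilon>"
  let ?B = "Mc m (Suc p) \<epsilon>"
  let ?C = "(\<lambda>(\<alpha> :: nat \<Rightarrow> nat, S). (\<alpha>, insert m S)) ` Mc m p (\<not> \<epsilon>)"
  have fin: "S \<subseteq> {..<m} \<Longrightarrow> finite S" for S :: "nat set" using finite_subset by blast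
  have "Mc (Suc m) (Suc p) \<epsilon> = ?A \<union> ?B \<union> ?C"
  proof (intro equalityI subsetI)
    fix x assume x: "x \<in> Mc (Suc m) (Suc p) \<epsilon>"
    obtain \<alpha> S where [simp]: "x = (\<alpha>, S)" by (cases x)
    show "x \<in> ?A \<union> ?B \<union> ?C"
    proof (cases "\<alpha> m = 0")
      case False
      then have "(\<alpha>(m := \<alpha> m - 1), S) \<in> Mc (Suc m) p \<epsilon>"
        using x mons_drop[of m m \<alpha> S p "{b. even b = \<epsilon>}"] by (simp add: Mc_Suc)
      then have "x \<in> ?A" using False by (intro image_eqI[of _ _ "(\<alpha>(m := \<alpha> m - 1), S)"]) auto
      then show ?thesis by blast
    next
      case a: True
      have al: "\<forall>k\<ge>m. \<alpha> k = 0" and S: "S \<subseteq> {..<Suc m}" and sm: "(\<Sum>k<m. \<alpha> k) + card S = Suc p"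
        and ev: "even (card S) = \<epsilon>"
        using x a by (simp_all add: Mc_def) (metis le_eq_less_or_eq Suc_leI)
      show ?thesis
      proof (cases "m \<in> S")
        case True
        have "card S = Suc (card (S - {m}))"
          using True finite_subset[OF S] by (intro card.remove) simp_all
        then have "(\<alpha>, S - {m}) \<in> Mc m p (\<not> \<epsilon>)"
          unfolding Mc_def using al S sm ev by auto
        then have "x \<in> ?C" using True by (intro image_eqI[of _ _ "(\<alpha>, S - {m})"]) auto
        then show ?thesis by blast
      next
        case False
        then have "S \<subseteq> {..<m}" using S by (auto simp: less_Suc_eq)
        then have "x \<in> ?B" unfolding Mc_def using al sm ev by simp
        then show ?thesis by blast
      qed
    qed
  next
    fix x assume "x \<in> ?A \<union> ?B \<union> ?C"
    then consider "x \<in> ?A" | "x \<in> ?B" | "x \<in> ?C" by blast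
    then show "x \<in> Mc (Suc m) (Suc p) \<epsilon>"
    proof cases
      case 1
      then show ?thesis using mons_bump[of m m _ _ p "{b. even b = \<epsilon>}"] by (auto simp: Mc_Suc)
    next
      case 2
      then show ?thesis by (auto simp: Mc_def)
    next
      case 3
      then obtain \<alpha> S where x: "x = (\<alpha>, insert m S)" and M: "(\<alpha>, S) \<in> Mc m p (\<not> \<epsilon>)" by auto
      then have "S \<subseteq> {..<m}" "m \<notin> S" by (auto simp: Mc_def)
      then have "card (insert m S) = Suc (card S)" using fin by simp
      then show ?thesis using M by (auto simp: x Mc_def)
    qed
  qed
  moreover have "?A \<inter> ?B = {}" "(?A \<union> ?B) \<inter> ?C = {}"
    by (auto simp: Mc_def)
  moreover have "inj_on (\<lambda>(\<alpha>, S). (\<alpha>(m := Suc (\<alpha> m)), S :: nat set)) (Mc (Suc m) p \<epsilon>)"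
  proof (rule inj_on_inverseI)
    show "(\<lambda>(\<alpha>, S). (\<alpha>(m := \<alpha> m - 1), S)) ((\<lambda>(\<alpha>, S). (\<alpha>(m := Suc (\<alpha> m)), S :: nat set)) x) = x" for x
      by (cases x) simp
  qed
  moreover have "inj_on (\<lambda>(\<alpha> :: nat \<Rightarrow> nat, S). (\<alpha>, insert m S)) (Mc m p (\<not> \<epsilon>))"
    by (rule inj_onI) (auto simp: Mc_def insert_ident)
  ultimately show ?thesis
    by (simp add: card_Un_disjoint finite_Mc card_image)
qed

definition Fd :: "nat \<Rightarrow> nat \<Rightarrow> nat" where
  "Fd q n = (\<Sum>i=0..n. (q choose i) * ((Suc q + n - i) choose (n - i)))"

abbreviation gp :: "rat fps" where
  "gp \<equiv> Abs_fps (\<lambda>_. 1)"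

lemma gp_pow_nth: "fps_nth (gp ^ Suc k) n = of_nat ((k + n) choose n)"
proof (induction k arbitrary: n)
  case (Suc k)
  have "fps_nth (gp ^ Suc (Suc k)) n = fps_nth (gp ^ Suc k * gp) n"
    by (simp only: power_Suc mult.commute)
  also have "\<dots> = (\<Sum>i=0..n. of_nat ((k + i) choose i))"
    by (simp only: fps_mult_nth Suc.IH) simp
  also have "\<dots> = of_nat ((Suc k + n) choose n)"
    using sum_choose_lower[of k n] by (simp flip: of_nat_sum add: atLeast0AtMost)
  finally show ?case .
qed simp

lemma Fd_fps: "of_nat (Fd q n) = fps_nth ((1 + fps_X) ^ q * gp ^ Suc (Suc q)) n"
proof -
  have "fps_nth ((1 + fps_X :: rat fps) ^ q) i = of_nat (q choose i)" for i
    by (simp add: fps_binomial_of_nat[symmetric] binomial_gbinomial)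
  then show ?thesis
    by (simp only: fps_mult_nth Fd_def gp_pow_nth of_nat_sum of_nat_mult) (simp add: Suc_diff_le le_add2 trans_le_add2)
qed

text \<open>The generating function in \<open>n\<close> is (1 + X)^q / (1 - X)^(q+2). Passing from
  \<open>q\<close> to \<open>q + 1\<close> multiplies it by (1 + X) / (1 - X), and clearing the
  denominator gives the recursion of \<open>card_Mc_Suc\<close>.\<close>

lemma Fd_rec: "Fd (Suc q) (Suc n) = Fd (Suc q) n + Fd q (Suc n) + Fd q n"
proof -
  let ?P = "\<lambda>q. (1 + fps_X :: rat fps) ^ q * gp ^ Suc (Suc q)"
  have gp: "(1 - fps_X) * gp = 1"
    unfolding fps_inverse_gp'[where 'a = rat, symmetric] by (rule inverse_mult_eq_1) simp
  have "(1 - fps_X) * ?P (Suc q) = ((1 - fps_X) * gp) * ((1 + fps_X) * ?P q)"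
    by (simp only: power_Suc mult_ac)
  then have "(1 - fps_X) * ?P (Suc q) = (1 + fps_X) * ?P q"
    by (simp only: gp mult_1)
  then have "fps_nth ((1 - fps_X) * ?P (Suc q)) (Suc n) = fps_nth ((1 + fps_X) * ?P q) (Suc n)"
    by (rule arg_cong)
  then have "fps_nth (?P (Suc q)) (Suc n) - fps_nth (?P (Suc q)) n = fps_nth (?P q) (Suc n) + fps_nth (?P q) n"
    by (simp only: ring_distribs mult_1 fps_add_nth fps_sub_nth fps_X_mult_nth nat.simps diff_Suc_1 if_False mult_1_left)
  then have "of_nat (Fd (Suc q) (Suc n)) = (of_nat (Fd (Suc q) n + Fd q (Suc n) + Fd q n) :: rat)"
    by (simp only: Fd_fps of_nat_add)
  then show ?thesis by (simp only: of_nat_eq_iff)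
qed

text \<open>In positive degree both parities have equally many monomials, so the parity flip in the
  recursion is harmless as long as the induction covers both.\<close>

lemma card_Mc: "card (Mc (Suc n) (Suc q) \<epsilon>) = Fd q n"
proof (induction n arbitrary: q \<epsilon>)
  case 0
  show ?case
  proof (induction q arbitrary: \<epsilon>)
    case 0
    show ?case by (simp add: card_Mc_Suc card_Mc_0 Mc_0 Fd_def)
  next
    case (Suc q)
    then show ?case by (subst card_Mc_Suc) (simp add: Mc_0 Fd_def)
  qed
next
  case (Suc n)
  show ?case
  proof (induction q arbitrary: \<epsilon>)
    case 0
    have "Fd 0 k = Suc k" for k
      unfolding Fd_def by (simp add: sum.atLeast_Suc_atMost binomial_eq_0)
    \<comment> \<open>The two degree-0 terms of the recursion have opposite parities and together
      contribute 1.\<close>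
    then show ?case by (subst card_Mc_Suc) (simp add: card_Mc_0 Suc.IH)
  next
    case (Suc q)
    show ?case by (subst card_Mc_Suc) (simp only: Suc.IH \<open>\<And>q \<epsilon>. card (Mc (Suc n) (Suc q) \<epsilon>) = Fd q n\<close> Fd_rec)
  qed
qed

lemma card_even_mons:
  assumes "p > 0"
  shows "card (mons n p (Collect even)) = (\<Sum>i=0..n. ((p - 1) choose i) * ((p + n - i) choose (n - i)))"
  using card_Mc[of n "p - 1" True] assms by (simp add: Mc_Suc Fd_def)

section \<open>Linear extension\<close>

lemma lookup_pscale [simp]: "Poly_Mapping.lookup (pscale c f) k = c * Poly_Mapping.lookup f k"
  by (simp add: pscale_def Poly_Mapping.map.rep_eq when_def)

lemma pscale_simps [simp]:
  "pscale 0 f = 0" "pscale c 0 = 0" "pscale 1 f = f" "pscale a (pscale b f) = pscale (a * b) f"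
  "pscale c (Poly_Mapping.single k d) = Poly_Mapping.single k (c * d)"
  by (auto intro!: poly_mapping_eqI simp: lookup_single when_def)

lemma pscale_add: "pscale c (f + g) = pscale c f + pscale c g" "pscale (a + b) f = pscale a f + pscale b f"
  by (auto intro!: poly_mapping_eqI simp: lookup_add algebra_simps)

lemma pscale_minus_one: "pscale (- 1) f = - f"
  by (auto intro!: poly_mapping_eqI)

lemma pscale_minus_left: "pscale (- c) f = - pscale c f"
  by (auto intro!: poly_mapping_eqI)

lemma keys_pscale: "Poly_Mapping.keys (pscale c f) \<subseteq> Poly_Mapping.keys f"
  by (auto simp: in_keys_iff)

lemma poly_mapping_sum_single:
  "f = (\<Sum>k\<in>Poly_Mapping.keys f. Poly_Mapping.single k (Poly_Mapping.lookup f k))"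
  by (rule poly_mapping_eqI) (simp add: lookup_sum lookup_single when_def in_keys_iff)

lemma pm_induct:
  assumes "P 0" "\<And>k c. P (Poly_Mapping.single k c)" "\<And>f g. P f \<Longrightarrow> P g \<Longrightarrow> P (f + g)"
  shows "P (f :: 'a \<Rightarrow>\<^sub>0 complex)"
proof -
  have "P (\<Sum>k\<in>A. Poly_Mapping.single k (Poly_Mapping.lookup f k))" if "finite A" for A
    using that by (induction A) (auto intro: assms)
  from this[of "Poly_Mapping.keys f"] show ?thesis
    by (simp flip: poly_mapping_sum_single)
qed

text \<open>Instantiated for finitely supported functions, complex numbers and the Fock space, so
  that \<open>lext\<close> is the linear extension from a basis into each of them.\<close>

locale scal =
  fixes s :: "complex \<Rightarrow> 'b \<Rightarrow> 'b :: ab_group_add"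
  assumes s_add_left: "s (a + b) x = s a x + s b x"
    and s_add_right: "s a (x + y) = s a x + s a y"
    and s_assoc: "s a (s b x) = s (a * b) x"
    and s_one: "s 1 x = x"
begin

lemma s_zero_left: "s 0 x = 0"
  using s_add_left[of 0 0 x] by simp

lemma s_zero_right: "s a 0 = 0"
  using s_add_right[of a 0 0] by simp

lemma s_sum_right: "s a (sum h I) = (\<Sum>i\<in>I. s a (h i))"
  by (induction I rule: infinite_finite_induct) (simp_all add: s_zero_right s_add_right)

lemma s_sum_left: "s (sum h I) x = (\<Sum>i\<in>I. s (h i) x)"
  by (induction I rule: infinite_finite_induct) (simp_all add: s_zero_left s_add_left)

lemma s_minus: "s (- 1) x = - x"
  using s_add_left[of "- 1" 1 x] by (simp add: s_zero_left s_one eq_neg_iff_add_eq_0)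

definition lext :: "('a \<Rightarrow> 'b) \<Rightarrow> ('a \<Rightarrow>\<^sub>0 complex) \<Rightarrow> 'b" where
  "lext g F = (\<Sum>k\<in>Poly_Mapping.keys F. s (Poly_Mapping.lookup F k) (g k))"

lemma lext_superset:
  assumes "finite A" "Poly_Mapping.keys F \<subseteq> A"
  shows "lext g F = (\<Sum>k\<in>A. s (Poly_Mapping.lookup F k) (g k))"
  unfolding lext_def using assms
  by (intro sum.mono_neutral_left) (auto simp: in_keys_iff s_zero_left)

lemma lext_add: "lext g (F + F') = lext g F + lext g F'"
proof -
  let ?A = "Poly_Mapping.keys F \<union> Poly_Mapping.keys F'"
  have "Poly_Mapping.keys (F + F') \<subseteq> ?A" by (rule keys_add)
  then show ?thesis
    by (simp add: lext_superset[of ?A] lookup_add s_add_left sum.distrib)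
qed

lemma lext_pscale: "lext g (pscale c F) = s c (lext g F)"
  using keys_pscale[of c F]
  by (simp add: lext_superset[of "Poly_Mapping.keys F"] s_sum_right s_assoc)

lemma lext_zero: "lext g 0 = 0"
  by (simp add: lext_def)

lemma lext_single: "lext g (Poly_Mapping.single k c) = s c (g k)"
  by (simp add: lext_def s_zero_left)

lemma lext_minus: "lext g (- F) = - lext g F"
  using lext_pscale[of g "- 1" F] by (simp add: pscale_minus_one s_minus)

lemma lext_diff: "lext g (F - F') = lext g F - lext g F'"
  using lext_add[of g F "- F'"] by (simp add: lext_minus)

lemma lext_sum: "lext g (sum h I) = (\<Sum>i\<in>I. lext g (h i))"
  by (induction I rule: infinite_finite_induct) (simp_all add: lext_zero lext_add)

end

interpretation pm: scal "pscale :: complex \<Rightarrow> ('a \<Rightarrow>\<^sub>0 complex) \<Rightarrow> 'a \<Rightarrow>\<^sub>0 complex"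
  by unfold_locales (simp_all add: pscale_add)

interpretation cx: scal "(*) :: complex \<Rightarrow> complex \<Rightarrow> complex"
  by unfold_locales (simp_all add: algebra_simps)

lemma pscale_diff: "pscale c (f - g) = pscale c f - pscale c g"
  by (rule poly_mapping_eqI) (simp add: lookup_minus right_diff_distrib)

section \<open>Quotients of vector spaces\<close>

lemma subspaceI:
  fixes V :: "(complex, 'v) module"
  assumes "vectorspace class_ring V" "N \<subseteq> carrier V" "\<zero>\<^bsub>V\<^esub> \<in> N"
    and "\<And>x y. x \<in> N \<Longrightarrow> y \<in> N \<Longrightarrow> x \<oplus>\<^bsub>V\<^esub> y \<in> N"
    and "\<And>c x. x \<in> N \<Longrightarrow> c \<odot>\<^bsub>V\<^esub> x \<in> N"
  shows "VectorSpace.subspace class_ring N V"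
proof -
  interpret vectorspace class_ring V by fact
  show ?thesis
    using assms by (intro VectorSpace.subspace.intro submodule.intro) (auto intro: module_axioms)
qed

lemma
  fixes V :: "(complex, 'v) module"
  assumes "VectorSpace.subspace class_ring N V"
  shows subspace_vs: "vectorspace class_ring V"
    and subspace_sub: "N \<subseteq> carrier V"
    and subspace_zero: "\<zero>\<^bsub>V\<^esub> \<in> N"
    and subspace_add: "x \<in> N \<Longrightarrow> y \<in> N \<Longrightarrow> x \<oplus>\<^bsub>V\<^esub> y \<in> N"
    and subspace_smult: "x \<in> N \<Longrightarrow> c \<odot>\<^bsub>V\<^esub> x \<in> N"
  using assms by (auto simp: VectorSpace.subspace_def submodule_def)

locale vquot =
  fixes V :: "(complex, 'v) module" and N :: "'v set"
  assumes sub: "VectorSpace.subspace class_ring N V"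
begin

sublocale vectorspace class_ring V
  rewrites "carrier class_ring = UNIV"
    and "monoid.mult class_ring = (*)"
    and "add class_ring = (+)"
    and "one class_ring = 1"
    and "zero class_ring = 0"
  using subspace_vs[OF sub] by auto

lemma abelian_sub: "abelian_subgroup N V"
proof (rule abelian_subgroupI3)
  show "additive_subgroup N V"
  proof (rule additive_subgroup.intro, rule subgroup.intro)
    show "inv\<^bsub>add_monoid V\<^esub> x \<in> N" if "x \<in> N" for x
    proof -
      have "\<ominus>\<^bsub>V\<^esub> x = (- 1) \<odot>\<^bsub>V\<^esub> x"
        using that subspace_sub[OF sub] smult_minus_1[of x] by (auto simp: class_ring_simps)
      then show ?thesis
        using subspace_smult[OF sub that, of "- 1"] by (simp add: a_inv_def)
    qed
  qed (use subspace_sub[OF sub] subspace_zero[OF sub] subspace_add[OF sub] in auto)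
  show "abelian_group V" by (rule M.abelian_group_axioms)
qed

sublocale abelian_subgroup N V
  by (rule abelian_sub)

lemma quot_carrier: "carrier (quot_vs V N) = (\<lambda>x. N +>\<^bsub>V\<^esub> x) ` carrier V"
  by (auto simp: quot_vs_def A_RCOSETS_def')

lemma quot_zero: "\<zero>\<^bsub>quot_vs V N\<^esub> = N +>\<^bsub>V\<^esub> \<zero>\<^bsub>V\<^esub>"
  by (simp add: quot_vs_def a_subset)

lemma quot_add:
  "x \<in> carrier V \<Longrightarrow> y \<in> carrier V \<Longrightarrow>
    (N +>\<^bsub>V\<^esub> x) \<oplus>\<^bsub>quot_vs V N\<^esub> (N +>\<^bsub>V\<^esub> y) = N +>\<^bsub>V\<^esub> (x \<oplus>\<^bsub>V\<^esub> y)"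
  by (simp add: quot_vs_def a_rcos_sum)

lemma coset_eq: "x \<in> carrier V \<Longrightarrow> y \<in> carrier V \<Longrightarrow> N +>\<^bsub>V\<^esub> x = N +>\<^bsub>V\<^esub> y \<longleftrightarrow> x \<ominus>\<^bsub>V\<^esub> y \<in> N"
  using a_rcos_module[of y x] a_repr_independence'[of x y] a_rcos_self[of x] by (auto simp: a_minus_def)

lemma coset_add_left: "h \<in> N \<Longrightarrow> x \<in> carrier V \<Longrightarrow> N +>\<^bsub>V\<^esub> (h \<oplus>\<^bsub>V\<^esub> x) = N +>\<^bsub>V\<^esub> x"
  by (metis a_Hcarr a_coset_add_assoc a_coset_join2 a_subset is_additive_subgroup additive_subgroup.a_subgroup)

text \<open>Operations on cosets are defined as unions over all representatives. If \<open>f\<close>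
  is additive for shifts by \<open>N\<close> and preserves \<open>N\<close>, all cosets in the union
  coincide.\<close>

lemma UN_coset:
  assumes x: "x \<in> carrier V" and f: "\<And>y. y \<in> carrier V \<Longrightarrow> f y \<in> carrier V"
    and f_add: "\<And>h y. h \<in> N \<Longrightarrow> y \<in> carrier V \<Longrightarrow> f (h \<oplus>\<^bsub>V\<^esub> y) = f h \<oplus>\<^bsub>V\<^esub> f y"
    and f_N: "\<And>h. h \<in> N \<Longrightarrow> f h \<in> N"
  shows "(\<Union>y\<in>N +>\<^bsub>V\<^esub> x. N +>\<^bsub>V\<^esub> f y) = N +>\<^bsub>V\<^esub> f x"
proof -
  have "N +>\<^bsub>V\<^esub> f y = N +>\<^bsub>V\<^esub> f x" if y: "y \<in> N +>\<^bsub>V\<^esub> x" for y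
  proof -
    obtain h where "h \<in> N" "y = h \<oplus>\<^bsub>V\<^esub> x" using y by (auto simp: a_r_coset_def')
    then show ?thesis by (simp add: f_add[OF _ x] coset_add_left f_N f x)
  qed
  then show ?thesis using a_rcos_self[OF x] by blast
qed

lemma quot_smult:
  assumes "x \<in> carrier V"
  shows "c \<odot>\<^bsub>quot_vs V N\<^esub> (N +>\<^bsub>V\<^esub> x) = N +>\<^bsub>V\<^esub> (c \<odot>\<^bsub>V\<^esub> x)"
  using UN_coset[of x "\<lambda>y. c \<odot>\<^bsub>V\<^esub> y"] assms smult_r_distr[of c] subspace_smult[OF sub] a_Hcarr
  by (simp add: quot_vs_def)

lemma quot_map_coset:
  assumes "x \<in> carrier V" "\<And>y. y \<in> carrier V \<Longrightarrow> f y \<in> carrier V"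
    and "\<And>x y. x \<in> carrier V \<Longrightarrow> y \<in> carrier V \<Longrightarrow> f (x \<oplus>\<^bsub>V\<^esub> y) = f x \<oplus>\<^bsub>V\<^esub> f y"
    and "\<And>h. h \<in> N \<Longrightarrow> f h \<in> N"
  shows "quot_map V N f (N +>\<^bsub>V\<^esub> x) = N +>\<^bsub>V\<^esub> f x"
  unfolding quot_map_def using assms a_Hcarr by (intro UN_coset) auto

lemma quot_vectorspace: "vectorspace class_ring (quot_vs V N)"
proof (rule vs_criteria)
  show "field (class_ring :: complex ring)" by (rule class_field)
  show "\<forall>v\<in>carrier (quot_vs V N). \<exists>w\<in>carrier (quot_vs V N). v \<oplus>\<^bsub>quot_vs V N\<^esub> w = \<zero>\<^bsub>quot_vs V N\<^esub>"
  proof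
    fix v assume "v \<in> carrier (quot_vs V N)"
    then obtain x where x: "x \<in> carrier V" "v = N +>\<^bsub>V\<^esub> x" by (auto simp: quot_carrier)
    then show "\<exists>w\<in>carrier (quot_vs V N). v \<oplus>\<^bsub>quot_vs V N\<^esub> w = \<zero>\<^bsub>quot_vs V N\<^esub>"
      by (intro bexI[of _ "N +>\<^bsub>V\<^esub> (\<ominus>\<^bsub>V\<^esub> x)"]) (auto simp: quot_add quot_zero quot_carrier M.r_neg)
  qed
  show "\<forall>v w. v \<in> carrier (quot_vs V N) \<and> w \<in> carrier (quot_vs V N) \<longrightarrow> v \<oplus>\<^bsub>quot_vs V N\<^esub> w = w \<oplus>\<^bsub>quot_vs V N\<^esub> v"
    by (auto simp: quot_carrier quot_add M.a_comm)
qed (auto simp: quot_carrier quot_zero quot_add quot_smult M.a_assoc smult_assoc1 smult_l_distr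
      smult_r_distr)

end

section \<open>Free vector spaces\<close>

lemma free_vs_simps:
  "carrier (free_vs S) = {f. Poly_Mapping.keys f \<subseteq> S}" "\<zero>\<^bsub>free_vs S\<^esub> = 0"
  "f \<oplus>\<^bsub>free_vs S\<^esub> g = f + g" "c \<odot>\<^bsub>free_vs S\<^esub> f = pscale c f"
  by (simp_all add: free_vs_def)

lemma free_vectorspace: "vectorspace class_ring (free_vs S)"
proof (rule vs_criteria)
  show "field (class_ring :: complex ring)" by (rule class_field)
  show "\<forall>v\<in>carrier (free_vs S). \<exists>w\<in>carrier (free_vs S). v \<oplus>\<^bsub>free_vs S\<^esub> w = \<zero>\<^bsub>free_vs S\<^esub>"
  proof
    fix v assume "v \<in> carrier (free_vs S)"
    then show "\<exists>w\<in>carrier (free_vs S). v \<oplus>\<^bsub>free_vs S\<^esub> w = \<zero>\<^bsub>free_vs S\<^esub>"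
      using keys_pscale[of "- 1" v]
      by (intro bexI[of _ "- v"]) (auto simp: free_vs_simps pscale_minus_one)
  qed
  show "\<forall>v w. v \<in> carrier (free_vs S) \<and> w \<in> carrier (free_vs S) \<longrightarrow> v \<oplus>\<^bsub>free_vs S\<^esub> w \<in> carrier (free_vs S)"
  proof (intro allI impI)
    fix v w assume "v \<in> carrier (free_vs S) \<and> w \<in> carrier (free_vs S)"
    then show "v \<oplus>\<^bsub>free_vs S\<^esub> w \<in> carrier (free_vs S)"
      using keys_add[of v w] by (auto simp: free_vs_simps)
  qed
  show "\<forall>c v. c \<in> carrier (class_ring :: complex ring) \<and> v \<in> carrier (free_vs S) \<longrightarrow> c \<odot>\<^bsub>free_vs S\<^esub> v \<in> carrier (free_vs S)"
  proof (intro allI impI)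
    fix c v assume "c \<in> carrier (class_ring :: complex ring) \<and> v \<in> carrier (free_vs S)"
    then show "c \<odot>\<^bsub>free_vs S\<^esub> v \<in> carrier (free_vs S)"
      using keys_pscale[of c v] by (auto simp: free_vs_simps)
  qed
qed (simp_all add: free_vs_simps pscale_add add_ac)

interpretation fk: scal "sc :: complex \<Rightarrow> ('a \<Rightarrow> complex) \<Rightarrow> 'a \<Rightarrow> complex"
  by unfold_locales (simp_all add: sc_add)

section \<open>The tensor algebra and its quotient\<close>

lemma scalar_mult: "scalar c * f = pscale c f"
  by (simp add: scalar_def pscale_def mult_map_scale_conv_mult)

lemma mult_scalar: "f * scalar c = pscale c f"
  by (induction f rule: pm_induct)
    (simp_all add: scalar_def mult_single distrib_right pscale_add mult.commute)

lemma mult_pscale: "f * pscale c g = pscale c (f * g)" "pscale c f * g = pscale c (f * g)" for f g :: free_alg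
proof -
  show "pscale c f * g = pscale c (f * g)"
    by (simp only: scalar_mult[symmetric] mult.assoc)
  have "f * pscale c g = (f * scalar c) * g"
    by (simp only: scalar_mult[symmetric] mult.assoc)
  then show "f * pscale c g = pscale c (f * g)"
    by (simp only: mult_scalar \<open>pscale c f * g = pscale c (f * g)\<close>)
qed

lemma scalar_one: "scalar 1 = 1" "scalar 0 = 0"
  by (simp_all add: scalar_def)

lemma embed_lext: "embed x = pm.lext (\<lambda>a. Poly_Mapping.single (Word [a]) 1) x"
  by (simp add: embed_def pm.lext_def)

lemma embed_pscale: "embed (pscale c x) = pscale c (embed x)"
  by (simp add: embed_lext pm.lext_pscale)

lemma embed_diff: "embed (x - y) = embed x - embed y"
  by (simp add: embed_lext pm.lext_diff)

lemma embed_minus: "embed (- x) = - embed x"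
  by (simp add: embed_lext pm.lext_minus)

lemma embed_zero: "embed 0 = 0"
  by (simp add: embed_lext pm.lext_zero)

lemma embed_single: "embed (Poly_Mapping.single a c) = Poly_Mapping.single (Word [a]) c"
  by (simp add: embed_lext pm.lext_single)

lemma embed_sum: "embed x = (\<Sum>a\<in>Poly_Mapping.keys x. pscale (Poly_Mapping.lookup x a) (embed (Poly_Mapping.single a 1)))"
  by (simp add: embed_single embed_def)

lemma tensor_alg_pscale: "f \<in> tensor_alg L \<Longrightarrow> pscale c f \<in> tensor_alg L"
  unfolding scalar_mult[symmetric] by (intro tensor_alg.intros)

lemma tensor_alg_zero: "0 \<in> tensor_alg L"
  using tensor_alg.intros(1)[of 0 L] by (simp add: scalar_one)

lemma tensor_alg_one: "1 \<in> tensor_alg L"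
  using tensor_alg.intros(1)[of 1 L] by (simp add: scalar_one)

lemma tensor_alg_minus: "f \<in> tensor_alg L \<Longrightarrow> - f \<in> tensor_alg L"
  using tensor_alg_pscale[of f L "- 1"] by (simp add: pscale_minus_one)

lemma tensor_alg_diff: "f \<in> tensor_alg L \<Longrightarrow> g \<in> tensor_alg L \<Longrightarrow> f - g \<in> tensor_alg L"
  using tensor_alg.intros(3)[of f L "- g"] tensor_alg_minus by simp

lemma tensor_ring_simps:
  "carrier (tensor_ring L) = tensor_alg L" "x \<otimes>\<^bsub>tensor_ring L\<^esub> y = x * y" "\<one>\<^bsub>tensor_ring L\<^esub> = 1"
  "\<zero>\<^bsub>tensor_ring L\<^esub> = 0" "x \<oplus>\<^bsub>tensor_ring L\<^esub> y = x + y"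
  by (simp_all add: tensor_ring_def)

lemma tensor_ring: "ring (tensor_ring L)"
proof (rule ringI)
  show "abelian_group (tensor_ring L)"
  proof (rule abelian_groupI)
    show "\<exists>y\<in>carrier (tensor_ring L). y \<oplus>\<^bsub>tensor_ring L\<^esub> x = \<zero>\<^bsub>tensor_ring L\<^esub>"
      if "x \<in> carrier (tensor_ring L)" for x
      using that tensor_alg_minus by (intro bexI[of _ "- x"]) (auto simp: tensor_ring_simps)
  qed (auto simp: tensor_ring_simps tensor_alg_zero add_ac intro: tensor_alg.intros)
  show "Group.monoid (tensor_ring L)"
    by (rule monoidI) (auto simp: tensor_ring_simps tensor_alg_one mult.assoc intro: tensor_alg.intros)
qed (auto simp: tensor_ring_simps distrib_left distrib_right)

lemma tensor_ring_a_inv: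
  assumes "x \<in> tensor_alg L"
  shows "\<ominus>\<^bsub>tensor_ring L\<^esub> x = - x"
proof -
  interpret ring "tensor_ring L" by (rule tensor_ring)
  show ?thesis
    using assms tensor_alg_minus[OF assms]
    by (intro minus_equality) (auto simp: tensor_ring_simps)
qed

text \<open>Closure under the bracket places the relators inside the carrier of
  \<open>tensor_ring L\<close>, as the facts about \<open>genideal\<close> demand.\<close>

locale superalg =
  fixes L :: "qelt set"
  assumes sbracket_closed: "x \<in> homogeneous L \<sigma> \<Longrightarrow> y \<in> homogeneous L \<theta> \<Longrightarrow> sbracket x y \<in> L"
begin

abbreviation relator :: "qelt \<Rightarrow> qelt \<Rightarrow> bit \<Rightarrow> bit \<Rightarrow> free_alg" where
  "relator x y \<sigma> \<theta> \<equiv> embed x * embed y - scalar (koszul \<sigma> \<theta>) * (embed y * embed x) - embed (sbracket x y)"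

lemma relator_closed:
  assumes "x \<in> homogeneous L \<sigma>" "y \<in> homogeneous L \<theta>"
  shows "relator x y \<sigma> \<theta> \<in> tensor_alg L"
proof -
  have "x \<in> L" "y \<in> L" using assms by (auto simp: homogeneous_def)
  then show ?thesis
    using sbracket_closed[OF assms] by (intro tensor_alg_diff tensor_alg.intros)
qed

lemma relators_subset:
  "{relator x y \<sigma> \<theta> | x y \<sigma> \<theta>. x \<in> homogeneous L \<sigma> \<and> y \<in> homogeneous L \<theta>} \<subseteq> carrier (tensor_ring L)"
  using relator_closed by (auto simp: tensor_ring_simps)

lemma env_ideal_ideal: "ideal (env_ideal L) (tensor_ring L)"
  unfolding env_ideal_def by (rule ring.genideal_ideal[OF tensor_ring relators_subset])

lemma relator_in_ideal:
  "x \<in> homogeneous L \<sigma> \<Longrightarrow> y \<in> homogeneous L \<theta> \<Longrightarrow> relator x y \<sigma> \<theta> \<in> env_ideal L"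
  using ring.genideal_self[OF tensor_ring relators_subset] unfolding env_ideal_def by blast

lemma env_carrier: "carrier (env L) = env_class L ` tensor_alg L"
  by (auto simp: env_def FactRing_def A_RCOSETS_def' env_class_def tensor_ring_simps)

lemma env_class_eq:
  assumes "f \<in> tensor_alg L" "g \<in> tensor_alg L"
  shows "env_class L f = env_class L g \<longleftrightarrow> f - g \<in> env_ideal L"
proof -
  interpret I: ideal "env_ideal L" "tensor_ring L" by (rule env_ideal_ideal)
  have "f \<ominus>\<^bsub>tensor_ring L\<^esub> g = f - g"
    using assms by (simp add: a_minus_def tensor_ring_a_inv tensor_ring_simps)
  then show ?thesis
    using I.a_rcos_module_minus[OF tensor_ring, of g f] I.a_repr_independence'[of f g] I.a_rcos_self[of f] assms
    by (auto simp: env_class_def tensor_ring_simps)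
qed

lemma env_add: "f \<in> tensor_alg L \<Longrightarrow> g \<in> tensor_alg L \<Longrightarrow>
    env_class L f \<oplus>\<^bsub>env L\<^esub> env_class L g = env_class L (f + g)"
proof -
  interpret I: ideal "env_ideal L" "tensor_ring L" by (rule env_ideal_ideal)
  show "f \<in> tensor_alg L \<Longrightarrow> g \<in> tensor_alg L \<Longrightarrow> ?thesis"
    using I.a_rcos_sum[of f g] by (simp add: env_def FactRing_def env_class_def tensor_ring_simps)
qed

lemma env_mult: "f \<in> tensor_alg L \<Longrightarrow> g \<in> tensor_alg L \<Longrightarrow>
    env_class L f \<otimes>\<^bsub>env L\<^esub> env_class L g = env_class L (f * g)"
  using ideal.rcoset_mult_add[OF env_ideal_ideal, of f g]
  by (simp add: env_def FactRing_def env_class_def tensor_ring_simps)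

text \<open>This is how an action of the free algebra is shown to descend to the enveloping algebra.
  Negatives in \<open>J\<close> come from multiplication by -1, which lies in the tensor
  algebra.\<close>

lemma ideal_minimal:
  assumes J: "J \<subseteq> tensor_alg L" "0 \<in> J" "\<And>f g. f \<in> J \<Longrightarrow> g \<in> J \<Longrightarrow> f + g \<in> J"
    and "\<And>f h. f \<in> J \<Longrightarrow> h \<in> tensor_alg L \<Longrightarrow> h * f \<in> J \<and> f * h \<in> J"
    and "\<And>x y \<sigma> \<theta>. x \<in> homogeneous L \<sigma> \<Longrightarrow> y \<in> homogeneous L \<theta> \<Longrightarrow> relator x y \<sigma> \<theta> \<in> J"
  shows "env_ideal L \<subseteq> J"
proof -
  have m: "- f \<in> J" if "f \<in> J" for f
    using assms(4)[OF that tensor_alg_minus[OF tensor_alg_one]] by simp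
  have "ideal J (tensor_ring L)"
  proof (rule idealI[OF tensor_ring])
    show "subgroup J (add_monoid (tensor_ring L))"
    proof (rule subgroup.intro)
      show "inv\<^bsub>add_monoid (tensor_ring L)\<^esub> x \<in> J" if "x \<in> J" for x
        using tensor_ring_a_inv[of x L] that J(1) m by (auto simp: a_inv_def)
    qed (use J in \<open>auto simp: tensor_ring_simps\<close>)
  qed (use assms(4) in \<open>auto simp: tensor_ring_simps\<close>)
  then show ?thesis
    unfolding env_ideal_def using assms(5) by (intro ring.genideal_minimal[OF tensor_ring]) auto
qed

end

lemma lookup_q_e: "Poly_Mapping.lookup (q_e i j \<sigma>) a = (if a = (i, j, \<sigma>) then 1 else 0)"
  by (simp add: q_e_def lookup_single when_def)

lemma keys_q_e: "Poly_Mapping.keys (q_e i j \<sigma>) = {(i, j, \<sigma>)}"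
  by (simp add: q_e_def)

lemma q_e_q_alg: "i \<le> n \<Longrightarrow> j \<le> n \<Longrightarrow> q_e i j \<sigma> \<in> q_alg n"
  by (simp add: q_alg_def qspan_def keys_q_e)

lemma q_e_homogeneous: "i \<le> n \<Longrightarrow> j \<le> n \<Longrightarrow> q_e i j \<sigma> \<in> homogeneous (q_alg n) \<sigma>"
  by (simp add: homogeneous_def q_e_q_alg keys_q_e)

lemma q_alg_keys: "x \<in> q_alg n \<longleftrightarrow> Poly_Mapping.keys x \<subseteq> qidx_set n"
  by (auto simp: q_alg_def qspan_def qidx_set_def)

lemma q_alg_zero: "0 \<in> q_alg n"
  by (simp add: q_alg_keys)

lemma q_alg_add: "x \<in> q_alg n \<Longrightarrow> y \<in> q_alg n \<Longrightarrow> x + y \<in> q_alg n"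
  using keys_add[of x y] by (auto simp: q_alg_keys)

lemma q_alg_pscale: "x \<in> q_alg n \<Longrightarrow> pscale c x \<in> q_alg n"
  using keys_pscale[of c x] by (auto simp: q_alg_keys)

lemma q_alg_diff: "x \<in> q_alg n \<Longrightarrow> y \<in> q_alg n \<Longrightarrow> x - y \<in> q_alg n"
  using q_alg_add[of x n "- y"] q_alg_pscale[of y n "- 1"] by (simp add: pscale_minus_one)

lemma q_alg_sum: "(\<And>i. i \<in> I \<Longrightarrow> h i \<in> q_alg n) \<Longrightarrow> sum h I \<in> q_alg n"
  by (induction I rule: infinite_finite_induct) (auto simp: q_alg_zero q_alg_add)

lemma basis_bracket_q_alg: "a \<in> qidx_set n \<Longrightarrow> b \<in> qidx_set n \<Longrightarrow> basis_bracket a b \<in> q_alg n"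
proof -
  assume "a \<in> qidx_set n" "b \<in> qidx_set n"
  moreover obtain i j \<sigma> k l \<theta> where [simp]: "a = (i, j, \<sigma>)" "b = (k, l, \<theta>)"
    by (cases a; cases b) auto
  ultimately have "(if j = k then q_e i l (\<sigma> + \<theta>) else 0) \<in> q_alg n"
    "pscale (koszul \<sigma> \<theta>) (if i = l then q_e k j (\<sigma> + \<theta>) else 0) \<in> q_alg n"
    by (auto simp: qidx_set_def q_alg_zero intro!: q_alg_pscale q_e_q_alg)
  from q_alg_diff[OF this] show ?thesis by simp
qed

lemma sbracket_q_alg: "x \<in> q_alg n \<Longrightarrow> y \<in> q_alg n \<Longrightarrow> sbracket x y \<in> q_alg n"
  unfolding sbracket_def by (intro q_alg_sum q_alg_pscale basis_bracket_q_alg) (auto simp: q_alg_keys)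

lemma sbracket_q_e: "sbracket (q_e i j \<sigma>) (q_e k l \<theta>) = basis_bracket (i, j, \<sigma>) (k, l, \<theta>)"
  by (simp add: sbracket_def keys_q_e lookup_q_e del: basis_bracket.simps)

interpretation qa: superalg "q_alg n"
  by unfold_locales (auto simp: homogeneous_def sbracket_q_alg)

section \<open>Action of the free algebra on the Fock space\<close>

fun wact :: "nat \<Rightarrow> nat \<Rightarrow> qidx list \<Rightarrow> fock \<Rightarrow> fock" where
  "wact n p [] v = v"
| "wact n p (a # w) v = rho n p a (wact n p w v)"

definition act :: "nat \<Rightarrow> nat \<Rightarrow> free_alg \<Rightarrow> fock \<Rightarrow> fock" where
  "act n p f v = fk.lext (\<lambda>w. wact n p (letters w) v) f"

lemma act_simps:
  "act n p (f + g) v = act n p f v + act n p g v" "act n p (f - g) v = act n p f v - act n p g v"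
  "act n p (pscale c f) v = sc c (act n p f v)" "act n p 0 v = 0"
  "act n p (Poly_Mapping.single w c) v = sc c (wact n p (letters w) v)"
  by (simp_all add: act_def fk.lext_add fk.lext_diff fk.lext_pscale fk.lext_zero fk.lext_single)

lemma act_scalar: "act n p (scalar c) v = sc c v"
  by (simp add: scalar_def act_simps zero_word_def)

lemma act_one: "act n p 1 v = v"
  using act_scalar[of n p 1 v] by (simp add: scalar_one)

lemma wact_append: "wact n p (u @ w) v = wact n p u (wact n p w v)"
  by (induction u) auto

lemma linop_wact: "linop (wact n p w)"
proof (induction w)
  case Nil
  then show ?case by (simp add: linop_def)
next
  case (Cons a w)
  then show ?case by (simp add: linop_def)
qed

lemma linop_act: "linop (act n p f)"
proof (induction f rule: pm_induct)
  case 1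
  then show ?case by (intro linopI) (simp_all only: act_simps add_0_left sc_simps)
next
  case (2 w c)
  then show ?case
    by (intro linopI) (simp_all only: act_simps linop_add[OF linop_wact] linop_sc[OF linop_wact] sc_add sc_simps mult.commute)
next
  case (3 f g)
  then show ?case
    by (intro linopI) (simp_all only: act_simps linop_add linop_sc sc_add add_ac)
qed

lemma act_mult: "act n p (f * g) v = act n p f (act n p g v)"
proof (induction f rule: pm_induct)
  case (2 w c)
  show ?case
  proof (induction g rule: pm_induct)
    case (2 w' c')
    then show ?case
      by (simp add: mult_single act_simps plus_word_def wact_append linop_sc[OF linop_wact])
  qed (simp_all only: act_simps distrib_left linop_zero[OF linop_act] linop_add[OF linop_act]
        mult_zero_right linop_zero[OF linop_wact] linop_add[OF linop_wact] sc_simps sc_add)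
qed (simp_all only: act_simps distrib_right mult_zero_left)

lemma act_embed: "act n p (embed x) v = (\<Sum>a\<in>Poly_Mapping.keys x. sc (Poly_Mapping.lookup x a) (rho n p a v))"
  unfolding embed_def act_def by (simp add: fk.lext_sum fk.lext_single)

lemma act_embed_lext: "act n p (embed x) v = fk.lext (\<lambda>a. rho n p a v) x"
  by (simp add: act_embed fk.lext_def)

lemma act_q_e: "act n p (embed (q_e i j \<sigma>)) v = rho n p (i, j, \<sigma>) v"
  by (simp add: act_embed_lext q_e_def fk.lext_single)

lemma act_EV:
  assumes "p > 0" "f \<in> tensor_alg (q_alg n)"
  shows "v \<in> EV n p \<Longrightarrow> act n p f v \<in> EV n p"
  using assms(2)
proof (induction f arbitrary: v)
  case (2 x)
  then show ?case
    unfolding act_embed using rho_EV[OF assms(1)]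
    by (intro subsp_sum[OF subsp_EV] subsp_sc[OF subsp_EV]) (auto simp: q_alg_keys)
qed (simp_all add: act_scalar act_simps act_mult subsp_sc[OF subsp_EV] subsp_add[OF subsp_EV])

lemma act_basis_bracket:
  assumes "p > 0" "a \<in> qidx_set n" "b \<in> qidx_set n" "v \<in> EV n p"
  shows "act n p (embed (basis_bracket a b)) v =
    rho n p a (rho n p b v) - sc (koszul (snd (snd a)) (snd (snd b))) (rho n p b (rho n p a v))"
proof -
  obtain i j \<sigma> k l \<theta> where [simp]: "a = (i, j, \<sigma>)" "b = (k, l, \<theta>)"
    by (cases a; cases b) auto
  have le: "i \<le> n" "j \<le> n" "k \<le> n" "l \<le> n" using assms by (auto simp: qidx_set_def)
  have "act n p (embed (basis_bracket a b)) v =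
      (if j = k then rho n p (i, l, \<sigma> + \<theta>) v else 0)
      - sc (koszul \<sigma> \<theta>) (if i = l then rho n p (k, j, \<sigma> + \<theta>) v else 0)"
    by (simp add: embed_diff embed_pscale act_simps act_q_e embed_zero if_distrib[of embed]
        if_distrib[of "\<lambda>f. act n p f v"] cong: if_cong)
  then show ?thesis
    using rho_bracket[OF assms(4)[unfolded EV_def] assms(1) le, of \<sigma> \<theta>] by simp
qed

lemma act_relator:
  assumes p: "p > 0" and v: "v \<in> EV n p"
    and x: "x \<in> homogeneous (q_alg n) \<sigma>" and y: "y \<in> homogeneous (q_alg n) \<theta>"
  shows "act n p (qa.relator x y \<sigma> \<theta>) v = 0"
proof -
  let ?x = "Poly_Mapping.lookup x" and ?y = "Poly_Mapping.lookup y"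
  have kx: "a \<in> qidx_set n" "snd (snd a) = \<sigma>" if "a \<in> Poly_Mapping.keys x" for a
    using x that by (auto simp: homogeneous_def q_alg_keys)
  have ky: "b \<in> qidx_set n" "snd (snd b) = \<theta>" if "b \<in> Poly_Mapping.keys y" for b
    using y that by (auto simp: homogeneous_def q_alg_keys)
  have 1: "act n p (embed x * embed y) v =
      (\<Sum>a\<in>Poly_Mapping.keys x. \<Sum>b\<in>Poly_Mapping.keys y. sc (?x a * ?y b) (rho n p a (rho n p b v)))"
    by (simp add: act_mult act_embed linop_sum[OF linop_rho] fk.s_sum_right)
  have "act n p (embed y * embed x) v =
      (\<Sum>b\<in>Poly_Mapping.keys y. \<Sum>a\<in>Poly_Mapping.keys x. sc (?x a * ?y b) (rho n p b (rho n p a v)))"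
    by (simp add: act_mult act_embed linop_sum[OF linop_rho] fk.s_sum_right mult.commute)
  then have 2: "act n p (embed y * embed x) v =
      (\<Sum>a\<in>Poly_Mapping.keys x. \<Sum>b\<in>Poly_Mapping.keys y. sc (?x a * ?y b) (rho n p b (rho n p a v)))"
    by (subst sum.swap)
  have "act n p (embed (sbracket x y)) v =
      (\<Sum>a\<in>Poly_Mapping.keys x. \<Sum>b\<in>Poly_Mapping.keys y. sc (?x a * ?y b) (act n p (embed (basis_bracket a b)) v))"
    by (simp add: sbracket_def act_embed_lext fk.lext_sum fk.lext_pscale)
  also have "\<dots> = (\<Sum>a\<in>Poly_Mapping.keys x. \<Sum>b\<in>Poly_Mapping.keys y.
      sc (?x a * ?y b) (rho n p a (rho n p b v)) - sc (koszul \<sigma> \<theta>) (sc (?x a * ?y b) (rho n p b (rho n p a v))))"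
    using kx ky by (intro sum.cong) (simp_all add: act_basis_bracket[OF p _ _ v] sc_diff mult.commute)
  finally show ?thesis
    by (simp add: act_simps scalar_mult 1 2 sum_subtractf fk.s_sum_right)
qed

text \<open>The annihilator of \<open>EV n p\<close> is an ideal containing the relators. For
  multiplication from the right, the factor acting first must preserve \<open>EV n p\<close>; the
  relators vanish there because the total degree is \<open>p\<close>.\<close>

lemma act_ideal:
  assumes p: "p > 0" and "f \<in> env_ideal (q_alg n)" and v: "v \<in> EV n p"
  shows "act n p f v = 0"
proof -
  let ?J = "{f \<in> tensor_alg (q_alg n). \<forall>v\<in>EV n p. act n p f v = 0}"
  have "env_ideal (q_alg n) \<subseteq> ?J"
  proof (rule qa.ideal_minimal)
    show "h * f \<in> ?J \<and> f * h \<in> ?J" if "f \<in> ?J" "h \<in> tensor_alg (q_alg n)" for f h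
      using that act_EV[OF p that(2)] by (auto simp: act_mult linop_zero[OF linop_act] intro: tensor_alg.intros)
    show "qa.relator x y \<sigma> \<theta> \<in> ?J"
      if "x \<in> homogeneous (q_alg n) \<sigma>" "y \<in> homogeneous (q_alg n) \<theta>" for x y \<sigma> \<theta>
      using act_relator[OF p _ that] qa.relator_closed[OF that] by blast
  qed (auto simp: act_simps tensor_alg_zero intro: tensor_alg.intros)
  then show ?thesis using assms by blast
qed

section \<open>The induced module\<close>

locale induced_module = superalg L for L +
  fixes H :: "qelt set" and \<chi> :: "qelt \<Rightarrow> complex"
  assumes sub_alg: "H \<subseteq> L"
begin

abbreviation "W \<equiv> tensor_free L"
abbreviation "R \<equiv> tensor_relations L H \<chi>"
abbreviation "Kr \<equiv> tensor_kernel L H \<chi>"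
abbreviation "cls \<equiv> env_class L"

lemma tensor_alg_sub: "f \<in> tensor_alg H \<Longrightarrow> f \<in> tensor_alg L"
  by (induction f rule: tensor_alg.induct) (use sub_alg in \<open>auto intro: tensor_alg.intros\<close>)

lemma W_simps:
  "carrier W = {f. Poly_Mapping.keys f \<subseteq> carrier (env L) \<times> UNIV}" "\<zero>\<^bsub>W\<^esub> = 0"
  "f \<oplus>\<^bsub>W\<^esub> g = f + g" "c \<odot>\<^bsub>W\<^esub> f = pscale c f"
  by (simp_all add: tensor_free_def free_vs_simps)

lemma W_vs: "vectorspace class_ring W"
  unfolding tensor_free_def by (rule free_vectorspace)

lemma W_add: "f \<in> carrier W \<Longrightarrow> g \<in> carrier W \<Longrightarrow> f + g \<in> carrier W"
  using keys_add[of f g] by (auto simp: W_simps)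

lemma W_pscale: "f \<in> carrier W \<Longrightarrow> pscale c f \<in> carrier W"
  using keys_pscale[of c f] by (auto simp: W_simps)

lemma W_diff: "f \<in> carrier W \<Longrightarrow> g \<in> carrier W \<Longrightarrow> f - g \<in> carrier W"
  using W_add[of f "- g"] W_pscale[of g "- 1"] by (simp add: pscale_minus_one)

lemma W_minus:
  assumes "f \<in> carrier W" "g \<in> carrier W"
  shows "f \<ominus>\<^bsub>W\<^esub> g = f - g"
proof -
  interpret vectorspace class_ring W by (rule W_vs)
  have "\<ominus>\<^bsub>W\<^esub> g = - g"
    using assms(2) W_pscale[OF assms(2), of "- 1"]
    by (intro M.minus_equality) (auto simp: W_simps pscale_minus_one)
  then show ?thesis by (simp add: a_minus_def W_simps)
qed

lemma pure_W: "f \<in> tensor_alg L \<Longrightarrow> pure_tensor (cls f) z \<in> carrier W"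
  by (simp add: W_simps pure_tensor_def env_carrier)

lemma env_mem: "u \<in> carrier (env L) \<Longrightarrow> \<exists>f\<in>tensor_alg L. u = cls f"
  by (auto simp: env_carrier)

text \<open>The relations in terms of representatives in the tensor algebra, where all later
  computations take place.\<close>

lemma R_cases:
  assumes "r \<in> R"
  obtains (add_left) f g z where "f \<in> tensor_alg L" "g \<in> tensor_alg L"
      "r = pure_tensor (cls (f + g)) z - pure_tensor (cls f) z - pure_tensor (cls g) z"
  | (add_right) f z z' where "f \<in> tensor_alg L"
      "r = pure_tensor (cls f) (z + z') - pure_tensor (cls f) z - pure_tensor (cls f) z'"
  | (scale_left) f c z where "f \<in> tensor_alg L"
      "r = pure_tensor (cls (pscale c f)) z - pscale c (pure_tensor (cls f) z)"
  | (scale_right) f c z where "f \<in> tensor_alg L"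
      "r = pure_tensor (cls f) (c * z) - pscale c (pure_tensor (cls f) z)"
  | (balanced) f h z where "f \<in> tensor_alg L" "h \<in> tensor_alg H"
      "r = pure_tensor (cls (f * h)) z - pure_tensor (cls f) (tensor_char \<chi> h * z)"
  using assms unfolding tensor_relations_def env_carrier
  by (elim UnE CollectE exE conjE imageE)
    (simp_all add: env_add env_mult tensor_alg_sub tensor_alg.intros(1) scalar_mult)

lemma R_intros:
  assumes "f \<in> tensor_alg L"
  shows "g \<in> tensor_alg L \<Longrightarrow> pure_tensor (cls (f + g)) z - pure_tensor (cls f) z - pure_tensor (cls g) z \<in> R"
    and "pure_tensor (cls f) (z + z') - pure_tensor (cls f) z - pure_tensor (cls f) z' \<in> R"
    and "pure_tensor (cls (pscale c f)) z - pscale c (pure_tensor (cls f) z) \<in> R"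
    and "pure_tensor (cls f) (c * z) - pscale c (pure_tensor (cls f) z) \<in> R"
    and "h \<in> tensor_alg H \<Longrightarrow> pure_tensor (cls (f * h)) z - pure_tensor (cls f) (tensor_char \<chi> h * z) \<in> R"
proof -
  have f: "cls f \<in> carrier (env L)" using assms by (auto simp: env_carrier)
  show "pure_tensor (cls (f + g)) z - pure_tensor (cls f) z - pure_tensor (cls g) z \<in> R" if "g \<in> tensor_alg L"
  proof -
    have "cls g \<in> carrier (env L)" using that by (auto simp: env_carrier)
    then show ?thesis
      unfolding tensor_relations_def env_add[OF assms that, symmetric] using f by blast
  qed
  show "pure_tensor (cls f) (z + z') - pure_tensor (cls f) z - pure_tensor (cls f) z' \<in> R"
    "pure_tensor (cls f) (c * z) - pscale c (pure_tensor (cls f) z) \<in> R"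
    unfolding tensor_relations_def using f by blast+
  have e: "cls (pscale c f) = cls (scalar c) \<otimes>\<^bsub>env L\<^esub> cls f"
    by (simp add: env_mult[OF tensor_alg.intros(1) assms] scalar_mult)
  show "pure_tensor (cls (pscale c f)) z - pscale c (pure_tensor (cls f) z) \<in> R"
    unfolding tensor_relations_def e using f by blast
  show "pure_tensor (cls (f * h)) z - pure_tensor (cls f) (tensor_char \<chi> h * z) \<in> R" if "h \<in> tensor_alg H"
    unfolding tensor_relations_def env_mult[OF assms tensor_alg_sub[OF that], symmetric] using f that by blast
qed

lemma R_carrier: "R \<subseteq> carrier W"
proof
  fix r assume "r \<in> R"
  then show "r \<in> carrier W"
    by (cases rule: R_cases)
      (use tensor_alg_sub in \<open>auto intro!: W_diff W_pscale pure_W tensor_alg.intros tensor_alg_pscale\<close>)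
qed

lemma Kr_subspace: "VectorSpace.subspace class_ring Kr W"
proof -
  interpret vectorspace class_ring W by (rule W_vs)
  show ?thesis
    unfolding tensor_kernel_def by (rule span_is_subspace[OF R_carrier])
qed

lemma R_Kr: "R \<subseteq> Kr"
proof -
  interpret vectorspace class_ring W by (rule W_vs)
  show ?thesis
    unfolding tensor_kernel_def by (rule in_own_span[OF R_carrier])
qed

lemma Kr_minimal:
  assumes "VectorSpace.subspace class_ring N W" "R \<subseteq> N"
  shows "Kr \<subseteq> N"
proof -
  interpret vectorspace class_ring W by (rule W_vs)
  show ?thesis
    unfolding tensor_kernel_def
    by (rule span_is_subset[OF assms(2)]) (use assms(1) in \<open>simp add: subspace_def\<close>)
qed

sublocale Q: vquot W Kr
  by (rule vquot.intro) (rule Kr_subspace)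

lemma ind_vs: "vectorspace class_ring (induced L H \<chi>)"
  unfolding induced_def by (rule Q.quot_vectorspace)

text \<open>The class of f tensor 1, that is, f applied to the generator of the induced
  module.\<close>

definition \<Theta> :: "free_alg \<Rightarrow> ind" where
  "\<Theta> f = Kr +>\<^bsub>W\<^esub> pure_tensor (cls f) 1"

lemma cls_W_eq:
  assumes "f \<in> carrier W" "g \<in> carrier W" "f - g \<in> Kr"
  shows "Kr +>\<^bsub>W\<^esub> f = Kr +>\<^bsub>W\<^esub> g"
  using assms by (simp add: Q.coset_eq W_minus)

lemma \<Theta>_carrier: "f \<in> tensor_alg L \<Longrightarrow> \<Theta> f \<in> carrier (induced L H \<chi>)"
  by (auto simp: induced_def Q.quot_carrier \<Theta>_def pure_W)

lemma \<Theta>_cong: "f \<in> tensor_alg L \<Longrightarrow> g \<in> tensor_alg L \<Longrightarrow> f - g \<in> env_ideal L \<Longrightarrow> \<Theta> f = \<Theta> g"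
  using env_class_eq[of f g] by (simp add: \<Theta>_def)

lemma \<Theta>_add:
  assumes "f \<in> tensor_alg L" "g \<in> tensor_alg L"
  shows "\<Theta> f \<oplus>\<^bsub>induced L H \<chi>\<^esub> \<Theta> g = \<Theta> (f + g)"
proof -
  have "pure_tensor (cls (f + g)) 1 - (pure_tensor (cls f) 1 + pure_tensor (cls g) 1) \<in> Kr"
    using R_intros(1)[OF assms, of 1] R_Kr by (auto simp: diff_diff_eq)
  then have "Kr +>\<^bsub>W\<^esub> pure_tensor (cls (f + g)) 1 = Kr +>\<^bsub>W\<^esub> (pure_tensor (cls f) 1 + pure_tensor (cls g) 1)"
    using assms by (intro cls_W_eq W_add pure_W tensor_alg.intros)
  then show ?thesis
    using assms by (simp add: induced_def \<Theta>_def Q.quot_add pure_W) (simp add: W_simps)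
qed

lemma \<Theta>_pscale:
  assumes "f \<in> tensor_alg L"
  shows "c \<odot>\<^bsub>induced L H \<chi>\<^esub> \<Theta> f = \<Theta> (pscale c f)"
proof -
  have "Kr +>\<^bsub>W\<^esub> pure_tensor (cls (pscale c f)) 1 = Kr +>\<^bsub>W\<^esub> (pscale c (pure_tensor (cls f) 1))"
    using R_intros(3)[OF assms, of c 1] R_Kr assms by (intro cls_W_eq W_pscale pure_W tensor_alg_pscale) auto
  then show ?thesis
    using assms by (simp add: induced_def \<Theta>_def Q.quot_smult pure_W) (simp add: W_simps)
qed

lemma pure_\<Theta>:
  assumes "f \<in> tensor_alg L"
  shows "Kr +>\<^bsub>W\<^esub> pure_tensor (cls f) z = \<Theta> (pscale z f)"
proof -
  have "Kr +>\<^bsub>W\<^esub> pure_tensor (cls f) z = Kr +>\<^bsub>W\<^esub> pscale z (pure_tensor (cls f) 1)"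
    using R_intros(4)[OF assms, of z 1] R_Kr assms by (intro cls_W_eq W_pscale pure_W) auto
  also have "\<dots> = z \<odot>\<^bsub>induced L H \<chi>\<^esub> \<Theta> f"
    using assms by (simp add: induced_def \<Theta>_def Q.quot_smult pure_W) (simp add: W_simps)
  finally show ?thesis by (simp add: \<Theta>_pscale[OF assms])
qed

lemma \<Theta>_balanced:
  assumes "f \<in> tensor_alg L" "h \<in> tensor_alg H"
  shows "\<Theta> (f * h) = \<Theta> (pscale (tensor_char \<chi> h) f)"
proof -
  have "\<Theta> (f * h) = Kr +>\<^bsub>W\<^esub> pure_tensor (cls f) (tensor_char \<chi> h * 1)"
    unfolding \<Theta>_def
    using R_intros(5)[OF assms, of 1] R_Kr assms tensor_alg_sub[OF assms(2)]
    by (intro cls_W_eq pure_W tensor_alg.intros(4)) auto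
  then show ?thesis by (simp add: pure_\<Theta>[OF assms(1)])
qed

text \<open>A complex number in the second factor moves to the first, so every sum of pure tensors
  collapses to a single f tensor 1.\<close>

lemma \<Theta>_surj: "carrier (induced L H \<chi>) = \<Theta> ` tensor_alg L"
proof
  show "carrier (induced L H \<chi>) \<subseteq> \<Theta> ` tensor_alg L"
  proof
    fix X assume "X \<in> carrier (induced L H \<chi>)"
    then obtain F where F: "F \<in> carrier W" "X = Kr +>\<^bsub>W\<^esub> F"
      by (auto simp: induced_def Q.quot_carrier)
    \<comment> \<open>Induction over partial sums; membership in the carrier is carried along
      because addition of cosets requires it.\<close>
    have "(\<Sum>k\<in>A. Poly_Mapping.single k (Poly_Mapping.lookup F k)) \<in> carrier W \<and>
        Kr +>\<^bsub>W\<^esub> (\<Sum>k\<in>A. Poly_Mapping.single k (Poly_Mapping.lookup F k)) \<in> \<Theta> ` tensor_alg L"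
      if "finite A" "A \<subseteq> Poly_Mapping.keys F" for A
      using that
    proof (induction A rule: finite_induct)
      case empty
      have "Kr +>\<^bsub>W\<^esub> 0 = \<Theta> (pscale 0 1)"
        using \<Theta>_pscale[OF tensor_alg_one, of 0] Q.quot_smult[OF pure_W[OF tensor_alg_one], of 0 1]
        by (simp add: \<Theta>_def induced_def W_simps del: pscale_simps(1)) simp
      then show ?case using tensor_alg_zero by (auto simp: W_simps)
    next
      case (insert k A)
      let ?S = "\<Sum>k\<in>A. Poly_Mapping.single k (Poly_Mapping.lookup F k)"
      obtain u z where k: "k = (u, z)" by (cases k)
      then have "u \<in> carrier (env L)" using insert.prems F(1) by (auto simp: W_simps)
      then obtain f where f: "f \<in> tensor_alg L" "u = cls f" using env_mem by blast
      have sg: "Poly_Mapping.single k (Poly_Mapping.lookup F k) = pscale (Poly_Mapping.lookup F k) (pure_tensor (cls f) z)"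
        by (simp add: pure_tensor_def k f)
      obtain g where g: "g \<in> tensor_alg L" "Kr +>\<^bsub>W\<^esub> ?S = \<Theta> g" and S: "?S \<in> carrier W"
        using insert by auto
      let ?f = "pscale (Poly_Mapping.lookup F k) (pscale z f)"
      note fT = tensor_alg_pscale[OF f(1), of z] tensor_alg_pscale[OF tensor_alg_pscale[OF f(1)], of "Poly_Mapping.lookup F k" z]
      have "Kr +>\<^bsub>W\<^esub> pscale (Poly_Mapping.lookup F k) (pure_tensor (cls f) z) = \<Theta> ?f"
        using Q.quot_smult[OF pure_W[OF f(1)], of "Poly_Mapping.lookup F k" z] \<Theta>_pscale[OF fT(1)]
        by (simp add: pure_\<Theta>[OF f(1)] W_simps flip: induced_def)
      moreover have "(Kr +>\<^bsub>W\<^esub> pscale (Poly_Mapping.lookup F k) (pure_tensor (cls f) z)) \<oplus>\<^bsub>induced L H \<chi>\<^esub> (Kr +>\<^bsub>W\<^esub> ?S)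
          = Kr +>\<^bsub>W\<^esub> (pscale (Poly_Mapping.lookup F k) (pure_tensor (cls f) z) + ?S)"
        using Q.quot_add[OF W_pscale[OF pure_W[OF f(1)]] S, of "Poly_Mapping.lookup F k" z]
        by (simp only: W_simps(3) induced_def)
      ultimately have eq: "Kr +>\<^bsub>W\<^esub> (pscale (Poly_Mapping.lookup F k) (pure_tensor (cls f) z) + ?S) = \<Theta> (?f + g)"
        by (simp only: g(2) \<Theta>_add[OF fT(2) g(1)])
      have "?f + g \<in> tensor_alg L" by (rule tensor_alg.intros(3)[OF fT(2) g(1)])
      then show ?case
        unfolding sum.insert[OF insert.hyps] sg eq
        using W_add[OF W_pscale[OF pure_W[OF f(1)]] S] by blast
    qed
    from this[of "Poly_Mapping.keys F"] show "X \<in> \<Theta> ` tensor_alg L"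
      by (simp add: F(2) flip: poly_mapping_sum_single)
  qed
qed (use \<Theta>_carrier in auto)

text \<open>The universal property of the tensor product: bilinearity and balancedness annihilate
  each generating relation, hence their span.\<close>

lemma lext_kernel:
  assumes s: "scal s"
    and "\<And>f g z. f \<in> tensor_alg L \<Longrightarrow> g \<in> tensor_alg L \<Longrightarrow> b (cls (f + g), z) = b (cls f, z) + b (cls g, z)"
    and "\<And>f z z'. f \<in> tensor_alg L \<Longrightarrow> b (cls f, z + z') = b (cls f, z) + b (cls f, z')"
    and "\<And>f c z. f \<in> tensor_alg L \<Longrightarrow> b (cls (pscale c f), z) = s c (b (cls f, z))"
    and "\<And>f c z. f \<in> tensor_alg L \<Longrightarrow> b (cls f, c * z) = s c (b (cls f, z))"
    and "\<And>f h z. f \<in> tensor_alg L \<Longrightarrow> h \<in> tensor_alg H \<Longrightarrow> b (cls (f * h), z) = b (cls f, tensor_char \<chi> h * z)"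
    and "F \<in> Kr"
  shows "scal.lext s b F = 0"
proof -
  interpret scal s by (rule s)
  let ?N = "{F \<in> carrier W. lext b F = 0}"
  have "VectorSpace.subspace class_ring ?N W"
  proof (rule subspaceI[OF W_vs])
    show "\<zero>\<^bsub>W\<^esub> \<in> ?N" by (simp add: W_simps lext_zero)
  qed (auto simp: W_simps(2-) W_add W_pscale lext_add lext_pscale s_zero_right)
  moreover have "R \<subseteq> ?N"
  proof
    fix r assume r: "r \<in> R"
    then have "lext b r = 0"
      by (cases rule: R_cases) (simp_all add: lext_diff lext_pscale pure_tensor_def lext_single s_one assms(2-6) del: pscale_simps)
    then show "r \<in> ?N" using r R_carrier by auto
  qed
  ultimately show ?thesis using Kr_minimal assms(7) by blast
qed

lemma \<Theta>_act:
  assumes x: "x \<in> L" and f: "f \<in> tensor_alg L"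
  shows "induced_act L H \<chi> x (\<Theta> f) = \<Theta> (embed x * f)"
proof -
  let ?b = "\<lambda>(u, z). pure_tensor (cls (embed x) \<otimes>\<^bsub>env L\<^esub> u) z"
  have ex: "embed x \<in> tensor_alg L" using x by (rule tensor_alg.intros)
  have fn_eq: "(\<lambda>F. \<Sum>(u, z)\<in>Poly_Mapping.keys F. pscale (Poly_Mapping.lookup F (u, z))
      (pure_tensor (cls (embed x) \<otimes>\<^bsub>env L\<^esub> u) z)) = pm.lext ?b"
    by (auto simp: pm.lext_def fun_eq_iff case_prod_beta intro!: sum.cong)
  have b: "?b (cls g, z) = pure_tensor (cls (embed x * g)) z" if "g \<in> tensor_alg L" for g z
    using env_mult[OF ex that] by simp
  have car: "pm.lext ?b F \<in> carrier W" if "F \<in> carrier W" for F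
  proof -
    have b_car: "?b k \<in> carrier W" if k: "k \<in> Poly_Mapping.keys F" for k
    proof -
      obtain u z where uz: "k = (u, z)" by (cases k)
      then have "u \<in> carrier (env L)" using k \<open>F \<in> carrier W\<close> by (auto simp: W_simps)
      then obtain g where g: "g \<in> tensor_alg L" "u = cls g" using env_mem by blast
      show ?thesis unfolding uz g(2) b[OF g(1)] by (intro pure_W tensor_alg.intros(4) ex g)
    qed
    have "(\<Sum>k\<in>A. pscale (Poly_Mapping.lookup F k) (?b k)) \<in> carrier W"
      if "finite A" "A \<subseteq> Poly_Mapping.keys F" for A
      using that
    proof (induction A rule: finite_induct)
      case empty
      show ?case by (simp add: W_simps)
    next
      case (insert k A)
      then show ?case
        using W_add[OF W_pscale[OF b_car[of k]]] by simp
    qed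
    then show ?thesis by (simp add: pm.lext_def)
  qed
  have ker: "pm.lext ?b F \<in> Kr" if F: "F \<in> Kr" for F
  proof -
    let ?N = "{F \<in> carrier W. pm.lext ?b F \<in> Kr}"
    have "VectorSpace.subspace class_ring ?N W"
    proof (rule subspaceI[OF W_vs])
      show "\<zero>\<^bsub>W\<^esub> \<in> ?N" using subspace_zero[OF Kr_subspace] by (simp add: W_simps pm.lext_zero)
      show "F \<oplus>\<^bsub>W\<^esub> G \<in> ?N" if "F \<in> ?N" "G \<in> ?N" for F G
        using that subspace_add[OF Kr_subspace, of "pm.lext ?b F" "pm.lext ?b G"] W_add[of F G]
        by (simp add: W_simps(2-) pm.lext_add)
      show "c \<odot>\<^bsub>W\<^esub> F \<in> ?N" if "F \<in> ?N" for c F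
        using that subspace_smult[OF Kr_subspace, of "pm.lext ?b F" c] W_pscale[of F c]
        by (simp add: W_simps(2-) pm.lext_pscale)
    qed auto
    \<comment> \<open>Left multiplication by \<open>embed x\<close> sends each relation to a
      relation of the same kind.\<close>
    moreover have "R \<subseteq> ?N"
    proof
      fix r assume r: "r \<in> R"
      then have "pm.lext ?b r \<in> R"
      proof (cases rule: R_cases)
        case (add_left f g z)
        then show ?thesis
          using R_intros(1)[of "embed x * f" "embed x * g" z]
          by (simp add: pm.lext_diff pure_tensor_def[of "cls _"] pm.lext_single b[unfolded split] env_mult[OF ex] tensor_alg.intros ex distrib_left)
      next
        case (add_right f z z')
        then show ?thesis
          using R_intros(2)[of "embed x * f" z z']
          by (simp add: pm.lext_diff pure_tensor_def[of "cls _"] pm.lext_single env_mult[OF ex] tensor_alg.intros ex)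
      next
        case (scale_left f c z)
        then show ?thesis
          using R_intros(3)[of "embed x * f" c z]
          by (simp add: pm.lext_diff pm.lext_pscale pure_tensor_def[of "cls _"] pm.lext_single env_mult[OF ex] tensor_alg.intros ex mult_pscale tensor_alg_pscale)
      next
        case (scale_right f c z)
        then show ?thesis
          using R_intros(4)[of "embed x * f" c z]
          by (simp add: pm.lext_diff pm.lext_pscale pure_tensor_def[of "cls _"] pm.lext_single env_mult[OF ex] tensor_alg.intros ex)
      next
        case (balanced f h z)
        then show ?thesis
          using R_intros(5)[of "embed x * f" h z]
          by (simp add: pm.lext_diff pure_tensor_def[of "cls _"] pm.lext_single env_mult[OF ex] tensor_alg.intros tensor_alg_sub ex mult.assoc)
      qed
      then show "r \<in> ?N" using r R_carrier R_Kr by auto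
    qed
    ultimately show ?thesis using Kr_minimal F by blast
  qed
  have "induced_act L H \<chi> x (\<Theta> f) = Kr +>\<^bsub>W\<^esub> pm.lext ?b (pure_tensor (cls f) 1)"
    unfolding induced_act_def fn_eq \<Theta>_def
    by (rule Q.quot_map_coset[OF pure_W[OF f] car _ ker]) (simp_all add: W_simps(3) pm.lext_add)
  also have "\<dots> = \<Theta> (embed x * f)"
    using env_mult[OF ex f] by (simp add: pure_tensor_def pm.lext_single \<Theta>_def)
  finally show ?thesis .
qed

end

text \<open>The excluded pairs are exactly i \<ge> 1, j = 0; their generators lower the weight of
  e_00.\<close>

definition par_idx :: "nat \<Rightarrow> qidx set" where
  "par_idx n = {(i, j, \<sigma>). i \<le> n \<and> j \<le> n \<and> (j = 0 \<longrightarrow> i = 0)}"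

lemma parabolic_keys:
  assumes "x \<in> parabolic n"
  shows "Poly_Mapping.keys x \<subseteq> par_idx n"
proof -
  obtain a b c where x: "x = (a + b) + c" and a: "a \<in> qspan ({0} \<times> {0})" and b: "b \<in> qspan ({1..n} \<times> {1..n})"
    and c: "c \<in> qspan ({0} \<times> {1..n})"
    using assms by (auto simp: parabolic_def G_tilde_def P_alg_def)
  have "Poly_Mapping.keys a \<subseteq> par_idx n" "Poly_Mapping.keys b \<subseteq> par_idx n" "Poly_Mapping.keys c \<subseteq> par_idx n"
    using a b c by (auto simp: qspan_def par_idx_def)
  then show ?thesis
    using keys_add[of "a + b" c] keys_add[of a b] x by blast
qed

lemma par_idx_sub: "par_idx n \<subseteq> qidx_set n"
  by (auto simp: par_idx_def qidx_set_def)

lemma parabolic_sub: "parabolic n \<subseteq> q_alg n"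
  using parabolic_keys par_idx_sub by (fastforce simp: q_alg_keys)

lemma single_parabolic:
  assumes "a \<in> par_idx n"
  shows "Poly_Mapping.single a 1 \<in> parabolic n"
proof -
  obtain i j \<sigma> where a: "a = (i, j, \<sigma>)" by (cases a)
  have z: "0 \<in> qspan S" for S by (simp add: qspan_def)
  have q: "Poly_Mapping.single a 1 \<in> qspan S" if "(i, j) \<in> S" for S using that by (simp add: qspan_def a)
  consider "i = 0 \<and> j = 0" | "i \<ge> 1 \<and> j \<ge> 1" | "i = 0 \<and> j \<ge> 1"
    using assms by (cases "j = 0"; cases "i = 0") (auto simp: par_idx_def a)
  then show ?thesis
  proof cases
    case 1
    then have "Poly_Mapping.single a 1 + 0 \<in> G_tilde n"
      unfolding G_tilde_def using q[of "{0} \<times> {0}"] z by blast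
    then have "(Poly_Mapping.single a 1 + 0) + 0 \<in> parabolic n"
      unfolding parabolic_def P_alg_def using z by blast
    then show ?thesis by simp
  next
    case 2
    then have qn: "(i, j) \<in> {1..n} \<times> {1..n}" using assms by (auto simp: par_idx_def a)
    have "0 + Poly_Mapping.single a 1 \<in> G_tilde n"
      unfolding G_tilde_def using q[of "{1..n} \<times> {1..n}"] z qn by blast
    then have "(0 + Poly_Mapping.single a 1) + 0 \<in> parabolic n"
      unfolding parabolic_def P_alg_def using z by blast
    then show ?thesis by simp
  next
    case 3
    have "0 + 0 \<in> G_tilde n" unfolding G_tilde_def using z by blast
    moreover have "Poly_Mapping.single a 1 \<in> P_alg n"
      unfolding P_alg_def using q[of "{0} \<times> {1..n}"] 3 assms by (auto simp: par_idx_def a)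
    ultimately have "(0 + 0) + Poly_Mapping.single a 1 \<in> parabolic n"
      unfolding parabolic_def by blast
    then show ?thesis by simp
  qed
qed

section \<open>The vector x_0^p and the inducing character\<close>

lemma v0_ban: "k \<noteq> 0 \<Longrightarrow> ban k (v0 p) = 0"
proof (rule ext)
  fix m :: mon assume "k \<noteq> 0"
  obtain \<alpha> S where m: "m = (\<alpha>, S)" by (cases m)
  have "\<alpha>(k := Suc (\<alpha> k)) \<noteq> (\<lambda>k. if k = 0 then p else 0)"
  proof
    assume "\<alpha>(k := Suc (\<alpha> k)) = (\<lambda>k. if k = 0 then p else 0)"
    from fun_cong[OF this, of k] show False using \<open>k \<noteq> 0\<close> by simp
  qed
  then show "ban k (v0 p) m = 0 m" by (simp add: m ban_def v0_def basis_fn_def)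
qed

lemma v0_fan: "fan k (v0 p) = 0"
  by (rule ext) (auto simp: fan_def v0_def basis_fn_def)

lemma v0_weight: "E0 0 0 (v0 p) = sc (of_nat p) (v0 p)"
proof (rule ext)
  fix m :: mon
  obtain \<alpha> S where m: "m = (\<alpha>, S)" by (cases m)
  show "E0 0 0 (v0 p) m = sc (of_nat p) (v0 p) m"
  proof (cases "m = (\<lambda>k. if k = 0 then p else 0, {})")
    case True
    then have "\<alpha> 0 = p" "S = {}" by (simp_all add: m)
    then show ?thesis by (simp add: E0_def number_ops sc_apply m)
  next
    case False
    then have "v0 p (\<alpha>, S) = 0" by (simp add: v0_def basis_fn_def m)
    then show ?thesis by (simp add: E0_def number_ops sc_apply m)
  qed
qed

text \<open>No variable but x_0 occurs in x_0^p, so \<open>dl\<close> vanishes and \<open>dd\<close>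
  reduces to its term of index 0, which is also all that remains of \<open>E1 0 0\<close>.\<close>

lemma v0_JJ: "JJ n (v0 p) = E1 0 0 (v0 p)"
proof -
  have t: "fcr k (ban k (v0 p)) = (if k = 0 then fcr 0 (ban 0 (v0 p)) else 0)" for k
    by (cases "k = 0") (simp_all only: v0_ban fock_lin simp_thms if_True if_False)
  have "dd n (v0 p) = (\<Sum>k\<le>n. if k = 0 then fcr 0 (ban 0 (v0 p)) else 0)"
    unfolding dd_def by (rule sum.cong[OF refl t])
  then have "dd n (v0 p) = fcr 0 (ban 0 (v0 p))"
    by (simp only: sum.delta finite_atMost atMost_iff le0 if_True)
  moreover have "dl n (v0 p) = 0"
    unfolding dl_def by (intro sum.neutral ballI) (simp only: v0_fan fock_lin)
  ultimately show ?thesis by (simp only: JJ_def E1_def v0_fan fock_lin diff_zero add_0_left)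
qed

lemma v0_char_single:
  "v0_char p (Poly_Mapping.single a 1) = (if a = (0, 0, 0) then of_nat p else if a = (0, 0, 1) then csq p else 0)"
  by (auto simp: v0_char_def lookup_single when_def csq_def)

lemma rho_v0:
  assumes p: "p > 0" and a: "a \<in> par_idx n"
  shows "rho n p a (v0 p) = sc (v0_char p (Poly_Mapping.single a 1)) (v0 p)"
proof -
  obtain i j \<sigma> where aa: "a = (i, j, \<sigma>)" by (cases a)
  have le: "i \<le> n" "j \<le> n" using a by (auto simp: par_idx_def aa)
  show ?thesis
  proof (cases "j = 0")
    case False
    have "E0 i j (v0 p) = 0" by (simp add: E0_def v0_ban[OF False] v0_fan)
    moreover have "E1 i j (v0 p) = 0" by (simp add: E1_def v0_ban[OF False] v0_fan)
    then have "E1 i j (JJ n (v0 p)) = 0" using E_JJ(2)[OF le, of "v0 p"] by simp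
    ultimately show ?thesis using False by (simp add: rho_def aa v0_char_single)
  next
    case True
    then have i: "i = 0" using a by (auto simp: par_idx_def aa)
    show ?thesis
    proof (cases "\<sigma> = 0")
      case s: True
      show ?thesis by (simp only: aa i True s rho_simps v0_weight v0_char_single simp_thms if_True)
    next
      case False
      then have s: "\<sigma> = 1" by simp
      \<comment> \<open>On x_0^p the operator \<open>E1 0 0\<close> may be replaced by
        \<open>JJ\<close>, so anticommuting gives minus the square of \<open>JJ\<close>, the scalar
        \<open>p\<close>. Division by sqrt p leaves the eigenvalue sqrt p.\<close>
      have "E1 0 0 (JJ n (v0 p)) = - JJ n (JJ n (v0 p))"
        using E_JJ(2)[of 0 n 0 "v0 p"] v0_JJ[of n p] by simp
      also have "\<dots> = sc (csq p * csq p) (v0 p)"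
        using JJ_JJ_Fk[OF v0_EV[unfolded EV_def], of n p] by (simp only: sc_minus minus_minus csq_square)
      finally have "rho n p a (v0 p) = sc (1 / csq p) (sc (csq p * csq p) (v0 p))"
        by (simp only: aa i True s rho_simps)
      also have "\<dots> = sc (csq p) (v0 p)"
        using csq_nonzero[OF p] by (simp only: sc_simps) simp
      finally show ?thesis by (simp add: aa i True s v0_char_single)
    qed
  qed
qed

definition wchar :: "(qelt \<Rightarrow> complex) \<Rightarrow> qidx list \<Rightarrow> complex" where
  "wchar \<chi> w = prod_list (map (\<lambda>a. \<chi> (Poly_Mapping.single a 1)) w)"

lemma tensor_char_lext: "tensor_char \<chi> f = cx.lext (\<lambda>w. wchar \<chi> (letters w)) f"
  by (simp add: tensor_char_def cx.lext_def wchar_def q_e_def case_prod_unfold)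

lemma tensor_char_mult: "tensor_char \<chi> (f * g) = tensor_char \<chi> f * tensor_char \<chi> g"
proof (induction f rule: pm_induct)
  case (2 w c)
  show ?case
  proof (induction g rule: pm_induct)
    case (2 w' c')
    then show ?case
      by (simp add: mult_single tensor_char_lext cx.lext_single plus_word_def wchar_def)
  qed (simp_all add: tensor_char_lext cx.lext_add cx.lext_zero distrib_left)
qed (simp_all add: tensor_char_lext cx.lext_add cx.lext_zero distrib_right)

text \<open>Both sides are multiplicative, so \<open>rho_v0\<close> on generators suffices. The
  result makes the map out of the induced module balanced.\<close>

lemma act_tensor_char:
  assumes p: "p > 0" and "h \<in> tensor_alg (parabolic n)"
  shows "act n p h (v0 p) = sc (tensor_char (v0_char p) h) (v0 p)"
  using assms(2)
proof (induction h)
  case (1 c)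
  then show ?case
    by (simp add: act_scalar) (simp add: scalar_def tensor_char_lext cx.lext_single zero_word_def wchar_def)
next
  case (2 x)
  have "act n p (embed x) (v0 p) =
      (\<Sum>a\<in>Poly_Mapping.keys x. sc (Poly_Mapping.lookup x a * v0_char p (Poly_Mapping.single a 1)) (v0 p))"
    unfolding act_embed
    using parabolic_keys[OF 2] by (intro sum.cong) (auto simp: rho_v0[OF p])
  also have "\<dots> = sc (\<Sum>a\<in>Poly_Mapping.keys x. Poly_Mapping.lookup x a * v0_char p (Poly_Mapping.single a 1)) (v0 p)"
    by (rule fk.s_sum_left[symmetric])
  also have "(\<Sum>a\<in>Poly_Mapping.keys x. Poly_Mapping.lookup x a * v0_char p (Poly_Mapping.single a 1))
      = tensor_char (v0_char p) (embed x)"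
    by (simp add: tensor_char_lext embed_def cx.lext_sum cx.lext_single wchar_def)
  finally show ?case .
next
  case (3 f g)
  then show ?case by (simp add: act_simps tensor_char_lext cx.lext_add sc_add)
next
  case (4 f g)
  then show ?case
    by (simp only: act_mult linop_sc[OF linop_act] sc_simps tensor_char_mult mult.commute)
qed

locale Vp =
  fixes n p :: nat
  assumes p_pos: "p > 0"
begin

sublocale induced_module "q_alg n" "parabolic n" "v0_char p"
  by (intro_locales; unfold_locales) (rule parabolic_sub)

abbreviation "T \<equiv> tensor_alg (q_alg n)"

lemmas T_intros = tensor_alg.intros tensor_alg_zero tensor_alg_one tensor_alg_pscale tensor_alg_diff tensor_alg_minus

definition \<Phi> :: "free_alg \<Rightarrow> fock" where
  "\<Phi> f = act n p f (v0 p)"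

lemma \<Phi>_EV: "f \<in> T \<Longrightarrow> \<Phi> f \<in> EV n p"
  unfolding \<Phi>_def by (rule act_EV[OF p_pos _ v0_EV])

lemma \<Phi>_simps:
  "\<Phi> (f + g) = \<Phi> f + \<Phi> g" "\<Phi> (f - g) = \<Phi> f - \<Phi> g" "\<Phi> (pscale c f) = sc c (\<Phi> f)" "\<Phi> 0 = 0"
  "\<Phi> (f * g) = act n p f (\<Phi> g)" "\<Phi> 1 = v0 p"
  by (simp_all only: \<Phi>_def act_simps act_mult act_one)

lemma \<Phi>_ideal: "f - g \<in> env_ideal (q_alg n) \<Longrightarrow> \<Phi> f = \<Phi> g"
  using act_ideal[OF p_pos, of "f - g" n "v0 p"] v0_EV by (simp only: \<Phi>_def act_simps right_minus_eq)

text \<open>Well-definedness of the homomorphism from the induced module to the Fock space that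
  sends f v_0 to f x_0^p.\<close>

lemma \<Theta>_\<Phi>:
  assumes f: "f \<in> T" and g: "g \<in> T" and eq: "\<Theta> f = \<Theta> g"
  shows "\<Phi> f = \<Phi> g"
proof -
  \<comment> \<open>\<open>b\<close> picks a representative of the class \<open>u\<close>; by
    \<open>\<Phi>_ideal\<close> its value does not depend on the choice.\<close>
  define b where "b = (\<lambda>(u, z). sc z (\<Phi> (SOME f. f \<in> T \<and> cls f = u)))"
  have b: "b (cls h, z) = sc z (\<Phi> h)" if h: "h \<in> T" for h z
  proof -
    have "(SOME f. f \<in> T \<and> cls f = cls h) \<in> T \<and> cls (SOME f. f \<in> T \<and> cls f = cls h) = cls h"
      using h by (intro someI[of "\<lambda>f. f \<in> T \<and> cls f = cls h"]) simp
    then have "\<Phi> (SOME f. f \<in> T \<and> cls f = cls h) = \<Phi> h"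
      using qa.env_class_eq h by (intro \<Phi>_ideal) blast
    then show ?thesis by (simp add: b_def)
  qed
  have "pure_tensor (cls f) 1 - pure_tensor (cls g) 1 \<in> Kr"
    using eq f g by (simp add: \<Theta>_def Q.coset_eq pure_W W_minus)
  then have "fk.lext b (pure_tensor (cls f) 1 - pure_tensor (cls g) 1) = 0"
  proof (rule lext_kernel[OF fk.scal_axioms, rotated -1])
    show "b (cls (f * h), z) = b (cls f, tensor_char (v0_char p) h * z)"
      if "f \<in> T" "h \<in> tensor_alg (parabolic n)" for f h z
    proof -
      have "\<Phi> (f * h) = sc (tensor_char (v0_char p) h) (\<Phi> f)"
        unfolding \<Phi>_def act_mult act_tensor_char[OF p_pos that(2)] linop_sc[OF linop_act] ..
      moreover have "f * h \<in> T" using that tensor_alg_sub by (intro T_intros(4))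
      ultimately show ?thesis using that by (simp add: b mult.commute)
    qed
  qed (simp_all add: b T_intros \<Phi>_simps sc_add mult.commute)
  then show ?thesis
    using f g by (simp add: fk.lext_diff pure_tensor_def fk.lext_single b)
qed

lemma \<Theta>_act': "x \<in> q_alg n \<Longrightarrow> f \<in> T \<Longrightarrow> Vbar_act n p x (\<Theta> f) = \<Theta> (embed x * f)"
  unfolding Vbar_act_def by (rule \<Theta>_act)

lemma \<Theta>_mult_cong:
  assumes "h \<in> T"
  shows "f \<in> T \<Longrightarrow> g \<in> T \<Longrightarrow> \<Theta> f = \<Theta> g \<Longrightarrow> \<Theta> (h * f) = \<Theta> (h * g)"
  using assms
proof (induction h arbitrary: f g)
  case (1 c)
  then show ?case by (simp add: scalar_mult flip: \<Theta>_pscale)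
next
  case (2 x)
  then show ?case by (simp flip: \<Theta>_act')
next
  case (3 h k)
  then have "\<Theta> (h * f) = \<Theta> (h * g)" "\<Theta> (k * f) = \<Theta> (k * g)" by blast+
  moreover have "h * f \<in> T" "k * f \<in> T" "h * g \<in> T" "k * g \<in> T"
    using "3.hyps" "3.prems" by (auto intro: tensor_alg.intros(4))
  ultimately show ?case by (simp only: distrib_right \<Theta>_add[symmetric])
next
  case (4 h k)
  then have "\<Theta> (h * (k * f)) = \<Theta> (h * (k * g))" by (meson tensor_alg.intros(4))
  then show ?case by (simp only: mult.assoc)
qed

lemma \<Theta>_add_cong:
  assumes "f \<in> T" "g \<in> T" "f' \<in> T" "g' \<in> T" "\<Theta> f = \<Theta> f'" "\<Theta> g = \<Theta> g'"
  shows "\<Theta> (f + g) = \<Theta> (f' + g')"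
  using assms by (simp flip: \<Theta>_add)

lemma \<Theta>_pscale_cong: "f \<in> T \<Longrightarrow> g \<in> T \<Longrightarrow> \<Theta> f = \<Theta> g \<Longrightarrow> \<Theta> (pscale c f) = \<Theta> (pscale c g)"
  by (simp flip: \<Theta>_pscale)

section \<open>Weights in the induced module\<close>

definition gen :: "qidx \<Rightarrow> free_alg" where
  "gen a = embed (Poly_Mapping.single a 1)"

lemma gen_T: "a \<in> qidx_set n \<Longrightarrow> gen a \<in> T"
  unfolding gen_def by (rule T_intros(2)) (simp add: q_alg_keys)

lemma \<Theta>_commute:
  assumes a: "a \<in> qidx_set n" and b: "b \<in> qidx_set n" and f: "f \<in> T"
  shows "\<Theta> (gen a * (gen b * f)) =
    \<Theta> (pscale (koszul (snd (snd a)) (snd (snd b))) (gen b * (gen a * f)) + embed (basis_bracket a b) * f)"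
proof -
  obtain i j \<sigma> k l \<theta> where aa: "a = (i, j, \<sigma>)" and bb: "b = (k, l, \<theta>)"
    by (cases a; cases b) auto
  have ha: "q_e i j \<sigma> \<in> homogeneous (q_alg n) \<sigma>" and hb: "q_e k l \<theta> \<in> homogeneous (q_alg n) \<theta>"
    using a b by (auto simp: aa bb qidx_set_def intro: q_e_homogeneous)
  have r: "qa.relator (q_e i j \<sigma>) (q_e k l \<theta>) \<sigma> \<theta> \<in> env_ideal (q_alg n)"
    by (rule qa.relator_in_ideal[OF ha hb])
  then have "qa.relator (q_e i j \<sigma>) (q_e k l \<theta>) \<sigma> \<theta> * f \<in> env_ideal (q_alg n)"
    using ideal.I_r_closed[OF qa.env_ideal_ideal r, of f] f by (simp add: tensor_ring_simps)
  moreover have "qa.relator (q_e i j \<sigma>) (q_e k l \<theta>) \<sigma> \<theta> * f = gen a * (gen b * f) -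
      (pscale (koszul \<sigma> \<theta>) (gen b * (gen a * f)) + embed (basis_bracket a b) * f)"
    by (simp add: sbracket_q_e aa bb gen_def q_e_def[symmetric] left_diff_distrib distrib_right scalar_mult mult_pscale mult.assoc
        diff_diff_eq del: basis_bracket.simps)
  moreover have "embed (basis_bracket a b) \<in> T"
    using basis_bracket_q_alg[OF a b] by (rule T_intros(2))
  ultimately show ?thesis
    using gen_T[OF a] gen_T[OF b] f by (intro \<Theta>_cong) (simp_all add: aa bb T_intros)
qed

lemma \<Theta>_gen_one: "a \<in> par_idx n \<Longrightarrow> \<Theta> (gen a) = \<Theta> (pscale (v0_char p (Poly_Mapping.single a 1)) 1)"
proof -
  assume a: "a \<in> par_idx n"
  then have "gen a \<in> tensor_alg (parabolic n)"
    unfolding gen_def by (intro tensor_alg.intros(2) single_parabolic)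
  from \<Theta>_balanced[OF T_intros(6) this]
  show ?thesis
    by (simp add: gen_def embed_single tensor_char_lext cx.lext_single wchar_def)
qed

text \<open>
  \<open>low k\<close> contains, up to the kernel of \<open>\<Theta>\<close>, the products of at most \<open>k\<close> generators \<open>e\<^sub>i\<^sub>0\<close> with \<open>i \<ge> 1\<close>;
  each of them lowers the weight of \<open>e\<^sub>0\<^sub>0\<close> by one.
\<close>

inductive low :: "nat \<Rightarrow> free_alg \<Rightarrow> bool" where
  low_one: "low 0 1"
| low_Suc: "low k f \<Longrightarrow> low (Suc k) f"
| low_gen: "low k f \<Longrightarrow> 1 \<le> i \<Longrightarrow> i \<le> n \<Longrightarrow> low (Suc k) (gen (i, 0, \<sigma>) * f)"
| low_add: "low k f \<Longrightarrow> low k g \<Longrightarrow> low k (f + g)"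
| low_pscale: "low k f \<Longrightarrow> low k (pscale c f)"
| low_cong: "low k f \<Longrightarrow> g \<in> T \<Longrightarrow> \<Theta> g = \<Theta> f \<Longrightarrow> low k g"

lemma low_T: "low k f \<Longrightarrow> f \<in> T"
  by (induction rule: low.induct) (auto simp: qidx_set_def intro!: T_intros(3,4,6,7) gen_T)

lemma low_mono: "low k f \<Longrightarrow> k \<le> k' \<Longrightarrow> low k' f"
  by (induction k') (auto simp: le_Suc_eq intro: low_Suc)

lemma low_zero: "low k 0"
  using low_pscale[OF low_mono[OF low_one], of k 0] by simp

lemma low_sum: "(\<And>i. i \<in> I \<Longrightarrow> low k (h i)) \<Longrightarrow> low k (sum h I)"
  by (induction I rule: infinite_finite_induct) (auto simp: low_zero low_add)

lemma low_embed:
  assumes "x \<in> q_alg n" "\<And>a. a \<in> qidx_set n \<Longrightarrow> low k (gen a * f)"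
  shows "low k (embed x * f)"
proof -
  have "embed x * f = (\<Sum>a\<in>Poly_Mapping.keys x. pscale (Poly_Mapping.lookup x a) (gen a * f))"
    by (subst embed_sum) (simp only: sum_distrib_right mult_pscale gen_def)
  then show ?thesis
    using assms by (auto simp: q_alg_keys intro!: low_sum low_pscale)
qed

text \<open>A parabolic generator is moved to the right. Past e_i0 it leaves a bracket, a
  combination of single generators applied to the shorter product \<open>f\<close>, which stays
  within the bound \<open>Suc k\<close>. At the end it reaches the generator of the module and
  becomes a scalar.\<close>

lemma low_gen_mult:
  "low k f \<Longrightarrow> (\<forall>a\<in>par_idx n. low k (gen a * f))"
proof (induction rule: low.induct)
  case low_one
  show ?case
  proof
    fix a assume a: "a \<in> par_idx n"
    then have "\<Theta> (gen a * 1) = \<Theta> (pscale (v0_char p (Poly_Mapping.single a 1)) 1)"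
      by (simp add: \<Theta>_gen_one)
    then show "low 0 (gen a * 1)"
      using a par_idx_sub by (intro low_cong[OF low_pscale[OF low.low_one]] T_intros(4,6) gen_T) auto
  qed
next
  case (low_gen k f i \<sigma>)
  show ?case
  proof
    fix a assume a: "a \<in> par_idx n"
    let ?b = "(i, 0, \<sigma>)"
    have fT: "f \<in> T" using low_gen.hyps(1) by (rule low_T)
    have aq: "a \<in> qidx_set n" and bq: "?b \<in> qidx_set n"
      using a par_idx_sub low_gen.hyps by (auto simp: qidx_set_def)
    \<comment> \<open>A single generator raises the bound for \<open>f\<close> by at most one:
      parabolic ones by the induction hypothesis, the others by the rule for e_i0.\<close>
    have any: "low (Suc k) (gen c * f)" if c: "c \<in> qidx_set n" for c
    proof (cases "c \<in> par_idx n")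
      case True
      then show ?thesis using low_gen.IH low_Suc by blast
    next
      case False
      then obtain i' \<sigma>' where "c = (i', 0, \<sigma>')" "1 \<le> i'" "i' \<le> n"
        using c by (auto simp: par_idx_def qidx_set_def Suc_le_eq)
      then show ?thesis using low.low_gen[OF low_gen.hyps(1)] by blast
    qed
    have "low (Suc k) (gen ?b * (gen a * f))"
      using low_gen.IH a low_gen.hyps by (intro low.low_gen) auto
    then have L: "low (Suc k) (pscale (koszul (snd (snd a)) (snd (snd ?b))) (gen ?b * (gen a * f)) + embed (basis_bracket a ?b) * f)"
      using basis_bracket_q_alg[OF aq bq] any by (intro low_add low_pscale low_embed)
    show "low (Suc k) (gen a * (gen ?b * f))"
      by (rule low.low_cong[OF L _ \<Theta>_commute[OF aq bq fT]]) (intro T_intros(4) gen_T aq bq fT)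
  qed
next
  case (low_cong k f g)
  show ?case
  proof
    fix a assume a: "a \<in> par_idx n"
    then have aT: "gen a \<in> T" using par_idx_sub gen_T by blast
    show "low k (gen a * g)"
    proof (rule low.low_cong[of k "gen a * f"])
      show "low k (gen a * f)" using low_cong.IH a by blast
      show "gen a * g \<in> T" by (intro T_intros(4) aT low_cong.hyps)
      show "\<Theta> (gen a * g) = \<Theta> (gen a * f)"
        using low_cong.hyps low_T by (intro \<Theta>_mult_cong aT)
    qed
  qed
qed (auto simp: distrib_left mult_pscale intro: low.intros)

lemma low_gen_any:
  assumes "low k f" "a \<in> qidx_set n"
  shows "low (Suc k) (gen a * f)"
proof (cases "a \<in> par_idx n")
  case True
  then show ?thesis using low_gen_mult[OF assms(1)] low_Suc by blast
next
  case False
  then obtain i \<sigma> where "a = (i, 0, \<sigma>)" "1 \<le> i" "i \<le> n"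
    using assms(2) by (auto simp: par_idx_def qidx_set_def Suc_le_eq)
  then show ?thesis using low_gen[OF assms(1)] by blast
qed

lemma low_mult:
  assumes "h \<in> T"
  shows "low k f \<Longrightarrow> \<exists>k'. low k' (h * f)"
  using assms
proof (induction h arbitrary: k f)
  case (1 c)
  then show ?case using low_pscale by (auto simp: scalar_mult)
next
  case (2 x)
  then show ?case using low_embed[of x "Suc k" f] low_gen_any by blast
next
  case (3 g h)
  obtain k1 k2 where "low k1 (g * f)" "low k2 (h * f)" using 3 by blast
  then have "low (max k1 k2) (g * f)" "low (max k1 k2) (h * f)" by (auto intro: low_mono)
  then show ?case by (auto simp: distrib_right intro: low_add)
next
  case (4 g h)
  then show ?case by (metis mult.assoc)
qed

lemma T_low: "f \<in> T \<Longrightarrow> \<exists>k. low k f"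
  using low_mult[of f 0 1] low_one by simp

definition shift :: "complex \<Rightarrow> free_alg" where
  "shift c = gen (0, 0, 0) - scalar c"

text \<open>The product of e_00 - (p - j) over j = 1, ..., k: zero on the weights p - 1, ..., p - k
  and equal to k! on the weight p.\<close>

primrec lowering :: "nat \<Rightarrow> free_alg" where
  "lowering 0 = 1"
| "lowering (Suc k) = shift (of_nat p - of_nat (Suc k)) * lowering k"

lemma gen0_T: "gen (0, 0, 0) \<in> T"
  by (rule gen_T) (simp add: qidx_set_def)

lemma shift_T: "shift c \<in> T"
  unfolding shift_def by (intro T_intros gen0_T)

lemma lowering_T: "lowering k \<in> T"
  by (induction k) (auto intro: T_intros shift_T)

lemma shift_mult: "shift c * f = gen (0, 0, 0) * f - pscale c f"
  by (simp add: shift_def left_diff_distrib scalar_mult)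

lemma shift_commute: "shift a * (shift b * f) = shift b * (shift a * f)"
  unfolding shift_mult right_diff_distrib mult_pscale pscale_diff pscale_simps(4)
  by (simp add: algebra_simps)

text \<open>The bracket of e_00 with e_i0 is - e_i0, so passing e_i0 raises the subtracted constant
  by one.\<close>

lemma \<Theta>_shift_gen:
  assumes f: "f \<in> T" and i: "1 \<le> i" "i \<le> n"
  shows "\<Theta> (shift c * (gen (i, 0, \<sigma>) * f)) = \<Theta> (gen (i, 0, \<sigma>) * (shift (c + 1) * f))"
proof -
  let ?b = "(i, 0, \<sigma>)"
  have q: "(0, 0, 0) \<in> qidx_set n" "?b \<in> qidx_set n" using i by (auto simp: qidx_set_def)
  have br: "basis_bracket (0, 0, 0) ?b = - Poly_Mapping.single ?b 1"
    using i by (simp add: koszul_def q_e_def)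
  have "\<Theta> (gen (0, 0, 0) * (gen ?b * f)) = \<Theta> (gen ?b * (gen (0, 0, 0) * f) - gen ?b * f)"
    using \<Theta>_commute[OF q f] by (simp add: br koszul_def embed_minus gen_def del: basis_bracket.simps)
  then have "\<Theta> (gen (0, 0, 0) * (gen ?b * f) + pscale (- c) (gen ?b * f)) =
      \<Theta> ((gen ?b * (gen (0, 0, 0) * f) - gen ?b * f) + pscale (- c) (gen ?b * f))"
    using gen_T[OF q(1)] gen_T[OF q(2)] f by (intro \<Theta>_add_cong T_intros) auto
  moreover have "shift c * (gen ?b * f) = gen (0, 0, 0) * (gen ?b * f) + pscale (- c) (gen ?b * f)"
    by (simp add: shift_mult pscale_minus_left)
  moreover have "gen ?b * (shift (c + 1) * f) = (gen ?b * (gen (0, 0, 0) * f) - gen ?b * f) + pscale (- c) (gen ?b * f)"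
    by (simp add: shift_mult right_diff_distrib distrib_left mult_pscale pscale_minus_left pscale_add)
  ultimately show ?thesis by (simp only:)
qed

lemma \<Theta>_shift_one: "\<Theta> (shift c) = \<Theta> (pscale (of_nat p - c) 1)"
proof -
  have "\<Theta> (gen (0, 0, 0)) = \<Theta> (pscale (of_nat p) 1)"
    using \<Theta>_gen_one[of "(0, 0, 0)"] by (simp add: par_idx_def v0_char_single)
  then have "\<Theta> (gen (0, 0, 0) + pscale (- c) 1) = \<Theta> (pscale (of_nat p) 1 + pscale (- c) 1)"
    using gen0_T by (intro \<Theta>_add_cong T_intros) auto
  moreover have "gen (0, 0, 0) + pscale (- c) 1 = shift c"
    using shift_mult[of c 1] by (simp add: pscale_minus_left)
  moreover have "pscale (of_nat p) 1 + pscale (- c) 1 = pscale (of_nat p - c) (1 :: free_alg)"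
    by (simp only: pscale_add(2)[symmetric] diff_conv_add_uminus)
  ultimately show ?thesis by (simp only:)
qed

text \<open>The subtracted constants p - 1, ..., p - k - 1 all go up by one and become p, ..., p -
  k. The factor with constant p is the one that kills the generator of the module.\<close>

lemma \<Theta>_lowering_gen:
  assumes f: "f \<in> T" and i: "1 \<le> i" "i \<le> n"
  shows "\<Theta> (lowering (Suc k) * (gen (i, 0, \<sigma>) * f)) = \<Theta> (gen (i, 0, \<sigma>) * (shift (of_nat p) * (lowering k * f)))"
proof -
  have g: "gen (i, 0, \<sigma>) \<in> T" using i by (intro gen_T) (simp add: qidx_set_def)
  show ?thesis
  proof (induction k)
    case 0
    show ?case using \<Theta>_shift_gen[OF f i, of "of_nat p - 1"] by simp
  next
    case (Suc k)
    let ?c = "of_nat p - of_nat (Suc (Suc k)) :: complex"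
    have "\<Theta> (shift ?c * (lowering (Suc k) * (gen (i, 0, \<sigma>) * f))) =
        \<Theta> (shift ?c * (gen (i, 0, \<sigma>) * (shift (of_nat p) * (lowering k * f))))"
      using Suc.IH by (intro \<Theta>_mult_cong shift_T T_intros(4) lowering_T f g)
    also have "\<dots> = \<Theta> (gen (i, 0, \<sigma>) * (shift (?c + 1) * (shift (of_nat p) * (lowering k * f))))"
      by (intro \<Theta>_shift_gen i T_intros(4) shift_T lowering_T f)
    also have "?c + 1 = of_nat p - of_nat (Suc k)" by simp
    finally show ?case
      by (simp add: mult.assoc shift_commute[of _ "of_nat p"])
  qed
qed

text \<open>By induction \<open>lowering k\<close> reduces \<open>f\<close> to a multiple of the
  generator. A further e_i0 leaves \<open>shift (of_nat p)\<close> acting on that multiple, which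
  gives zero; a further factor without an e_i0 only rescales.\<close>

lemma low_lowering: "low k f \<Longrightarrow> \<exists>c. \<Theta> (lowering k * f) = \<Theta> (pscale c 1)"
proof (induction rule: low.induct)
  case low_one
  then show ?case by (intro exI[of _ 1]) simp
next
  case (low_Suc k f)
  then obtain c where c: "\<Theta> (lowering k * f) = \<Theta> (pscale c 1)" by blast
  have fT: "f \<in> T" using low_Suc low_T by blast
  let ?s = "of_nat p - of_nat (Suc k) :: complex"
  have "\<Theta> (shift ?s * (lowering k * f)) = \<Theta> (shift ?s * pscale c 1)"
    using c by (intro \<Theta>_mult_cong shift_T T_intros lowering_T fT)
  also have "\<dots> = \<Theta> (pscale c (shift ?s))" by (simp add: mult_pscale)
  also have "\<dots> = \<Theta> (pscale c (pscale (of_nat p - ?s) 1))"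
    using \<Theta>_shift_one by (intro \<Theta>_pscale_cong shift_T T_intros)
  finally show ?case by (auto simp: mult.assoc)
next
  case (low_gen k f i \<sigma>)
  then obtain c where c: "\<Theta> (lowering k * f) = \<Theta> (pscale c 1)" by blast
  have fT: "f \<in> T" using low_gen low_T by blast
  have g: "gen (i, 0, \<sigma>) \<in> T" using low_gen.hyps by (intro gen_T) (simp add: qidx_set_def)
  have "\<Theta> (shift (of_nat p) * (lowering k * f)) = \<Theta> (shift (of_nat p) * pscale c 1)"
    using c by (intro \<Theta>_mult_cong shift_T T_intros lowering_T fT)
  also have "\<dots> = \<Theta> (pscale c (shift (of_nat p)))" by (simp add: mult_pscale)
  also have "\<dots> = \<Theta> (pscale c (pscale (of_nat p - of_nat p) 1))"
    using \<Theta>_shift_one by (intro \<Theta>_pscale_cong shift_T T_intros)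
  finally have "\<Theta> (gen (i, 0, \<sigma>) * (shift (of_nat p) * (lowering k * f))) = \<Theta> (gen (i, 0, \<sigma>) * 0)"
    by (intro \<Theta>_mult_cong g T_intros shift_T lowering_T fT) simp
  then show ?case
    using \<Theta>_lowering_gen[OF fT low_gen.hyps(2,3), of k \<sigma>] by (intro exI[of _ 0]) simp
next
  case (low_add k f g)
  then obtain c d where c: "\<Theta> (lowering k * f) = \<Theta> (pscale c 1)" "\<Theta> (lowering k * g) = \<Theta> (pscale d 1)" by blast
  have "f \<in> T" "g \<in> T" using low_add low_T by blast+
  then have "\<Theta> (lowering k * f + lowering k * g) = \<Theta> (pscale c 1 + pscale d 1)"
    using c by (intro \<Theta>_add_cong T_intros lowering_T)
  then show ?case by (intro exI[of _ "c + d"]) (simp add: distrib_left pscale_add)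
next
  case (low_pscale k f d)
  then obtain c where c: "\<Theta> (lowering k * f) = \<Theta> (pscale c 1)" by blast
  have "f \<in> T" using low_pscale low_T by blast
  then have "\<Theta> (pscale d (lowering k * f)) = \<Theta> (pscale d (pscale c 1))"
    using c by (intro \<Theta>_pscale_cong T_intros lowering_T)
  then show ?case by (intro exI[of _ "d * c"]) (simp add: mult_pscale)
next
  case (low_cong k f g)
  then obtain c where c: "\<Theta> (lowering k * f) = \<Theta> (pscale c 1)" by blast
  have "\<Theta> (lowering k * g) = \<Theta> (lowering k * f)"
    using low_cong.hyps low_T[OF low_cong.hyps(1)] by (intro \<Theta>_mult_cong lowering_T)
  then show ?case using c by (intro exI[of _ c]) (rule trans)
qed

text \<open>On the weight p the factor of index j contributes p - (p - j) = j.\<close>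

lemma \<Phi>_lowering: "act n p (lowering k) (v0 p) = sc (fact k) (v0 p)"
proof (induction k)
  case 0
  then show ?case by (simp only: lowering.simps act_one fact_0 sc_simps)
next
  case (Suc k)
  have "act n p (gen (0, 0, 0)) (v0 p) = sc (of_nat p) (v0 p)"
    using act_q_e[of n p 0 0 0 "v0 p"] by (simp only: gen_def q_e_def rho_simps v0_weight)
  then have "act n p (shift c) (v0 p) = sc (of_nat p - c) (v0 p)" for c
    by (simp only: shift_def act_simps act_scalar sc_diff)
  then show ?case
    by (simp only: lowering.simps act_mult Suc linop_sc[OF linop_act] sc_simps) (simp add: mult.commute)
qed

end

lemma subsp_span_basis:
  assumes "subsp U" "f \<in> Fk n p B" "\<And>m. m \<in> mons n p B \<Longrightarrow> basis_fn m \<in> U"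
  shows "f \<in> U"
proof -
  have "f = (\<Sum>m\<in>mons n p B. sc (f m) (basis_fn m))"
  proof
    fix m
    have "(\<Sum>m'\<in>mons n p B. sc (f m') (basis_fn m')) m = (\<Sum>m'\<in>mons n p B. if m' = m then f m else 0)"
      unfolding sum_fun_apply by (rule sum.cong) (auto simp: sc_def basis_fn_def)
    also have "\<dots> = f m"
      using FkD[OF assms(2), of m] by (simp add: finite_mons) blast
    finally show "f m = (\<Sum>m\<in>mons n p B. sc (f m) (basis_fn m)) m" by simp
  qed
  moreover have "(\<Sum>m\<in>mons n p B. sc (f m) (basis_fn m)) \<in> U"
    using assms by (intro subsp_sum subsp_sc)
  ultimately show ?thesis by simp
qed

section \<open>The irreducible quotient\<close>

text \<open>A linear identification of a function space with a module record, through which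
  subspaces, sums and the dimension are transported.\<close>

locale fock_iso =
  fixes V :: "(complex, 'v) module" and D :: "fock set" and \<iota> :: "fock \<Rightarrow> 'v"
  assumes V_vs: "vectorspace class_ring V"
    and D: "subsp D"
    and bij: "bij_betw \<iota> D (carrier V)"
    and iota_add: "f \<in> D \<Longrightarrow> g \<in> D \<Longrightarrow> \<iota> (f + g) = \<iota> f \<oplus>\<^bsub>V\<^esub> \<iota> g"
    and iota_sc: "f \<in> D \<Longrightarrow> \<iota> (sc c f) = c \<odot>\<^bsub>V\<^esub> \<iota> f"
begin

sublocale VS: vectorspace class_ring V
  rewrites "carrier class_ring = UNIV"
    and "monoid.mult class_ring = (*)"
    and "add class_ring = (+)"
    and "one class_ring = 1"
    and "zero class_ring = 0"
  using V_vs by auto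

lemma iota_carrier: "f \<in> D \<Longrightarrow> \<iota> f \<in> carrier V"
  using bij by (auto simp: bij_betw_def)

lemma iota_inj: "f \<in> D \<Longrightarrow> g \<in> D \<Longrightarrow> \<iota> f = \<iota> g \<Longrightarrow> f = g"
  using bij by (auto simp: bij_betw_def inj_on_def)

lemma iota_surj: "v \<in> carrier V \<Longrightarrow> \<exists>f\<in>D. v = \<iota> f"
  using bij by (auto simp: bij_betw_def)

lemma iota_zero: "\<iota> 0 = \<zero>\<^bsub>V\<^esub>"
  using iota_sc[OF subsp_zero[OF D], of 0] iota_carrier[OF subsp_zero[OF D]] by simp

lemma iota_sum:
  assumes "finite I" "\<And>i. i \<in> I \<Longrightarrow> h i \<in> D"
  shows "(\<Oplus>\<^bsub>V\<^esub>i\<in>I. \<iota> (h i)) = \<iota> (sum h I)"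
  using assms
proof (induction I rule: finite_induct)
  case empty
  show ?case by (simp only: sum.empty VS.M.finsum_empty iota_zero)
next
  case (insert i I)
  have "(\<Oplus>\<^bsub>V\<^esub>j\<in>insert i I. \<iota> (h j)) = \<iota> (h i) \<oplus>\<^bsub>V\<^esub> (\<Oplus>\<^bsub>V\<^esub>j\<in>I. \<iota> (h j))"
    using insert by (intro VS.M.finsum_insert) (auto simp: iota_carrier)
  also have "\<dots> = \<iota> (h i) \<oplus>\<^bsub>V\<^esub> \<iota> (sum h I)"
    using insert by simp
  also have "\<dots> = \<iota> (h i + sum h I)"
    using insert by (intro iota_add[symmetric] subsp_sum[OF D]) auto
  finally show ?case by (simp only: sum.insert[OF insert.hyps])
qed

lemma subspace_image:
  assumes "subsp U" "U \<subseteq> D"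
  shows "VectorSpace.subspace class_ring (\<iota> ` U) V"
proof (rule subspaceI[OF V_vs])
  show "\<iota> ` U \<subseteq> carrier V" using assms iota_carrier by auto
  show "\<zero>\<^bsub>V\<^esub> \<in> \<iota> ` U" using iota_zero subsp_zero[OF assms(1)] by (metis image_eqI)
  show "x \<oplus>\<^bsub>V\<^esub> y \<in> \<iota> ` U" if xy: "x \<in> \<iota> ` U" "y \<in> \<iota> ` U" for x y
  proof -
    obtain f g where "f \<in> U" "g \<in> U" "x = \<iota> f" "y = \<iota> g" using xy by blast
    then show ?thesis using iota_add[of f g] subsp_add[OF assms(1)] assms(2) by (metis image_eqI subsetD)
  qed
  show "c \<odot>\<^bsub>V\<^esub> x \<in> \<iota> ` U" if x: "x \<in> \<iota> ` U" for c x
  proof -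
    obtain f where "f \<in> U" "x = \<iota> f" using x by blast
    then show ?thesis using iota_sc[of f c] subsp_sc[OF assms(1)] assms(2) by (metis image_eqI subsetD)
  qed
qed

lemma subsp_preimage:
  assumes "VectorSpace.subspace class_ring N V"
  shows "subsp {f \<in> D. \<iota> f \<in> N}" "\<iota> ` {f \<in> D. \<iota> f \<in> N} = N"
proof -
  show "subsp {f \<in> D. \<iota> f \<in> N}"
    unfolding subsp_def
    using subsp_zero[OF D] subsp_add[OF D] subsp_sc[OF D] iota_zero iota_add iota_sc
      subspace_zero[OF assms] subspace_add[OF assms] subspace_smult[OF assms] by simp
  show "\<iota> ` {f \<in> D. \<iota> f \<in> N} = N"
    using iota_surj subspace_sub[OF assms] by blast
qed

lemma fin_dim_dim:
  assumes D': "D = Fk n p B"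
  shows "VS.fin_dim" "VS.dim = card (mons n p B)"
proof -
  let ?B = "(\<lambda>m. \<iota> (basis_fn m)) ` mons n p B"
  have bD: "m \<in> mons n p B \<Longrightarrow> basis_fn m \<in> D" for m
    unfolding D' by (rule basis_fn_Fk)
  have binj: "inj_on (\<lambda>m. \<iota> (basis_fn m)) (mons n p B)"
  proof (rule inj_onI)
    fix m m' assume "m \<in> mons n p B" "m' \<in> mons n p B" "\<iota> (basis_fn m) = \<iota> (basis_fn m')"
    then have "basis_fn m = basis_fn m'" using iota_inj bD by blast
    then have "basis_fn m m = basis_fn m' m" by simp
    then show "m = m'" by (simp add: basis_fn_def split: if_splits)
  qed
  have fin: "finite ?B" using finite_mons by blast
  have car: "?B \<subseteq> carrier V" using bD iota_carrier by blast
  have span_sub: "VectorSpace.subspace class_ring (VS.span ?B) V"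
    by (rule VS.span_is_subspace[OF car])
  have gen: "VS.span ?B = carrier V"
  proof
    show "VS.span ?B \<subseteq> carrier V" using subspace_sub[OF span_sub] .
    show "carrier V \<subseteq> VS.span ?B"
    proof
      fix v assume "v \<in> carrier V"
      then obtain f where f: "f \<in> D" "v = \<iota> f" using iota_surj by blast
      have "f \<in> {f \<in> D. \<iota> f \<in> VS.span ?B}"
      proof (rule subsp_span_basis[OF subsp_preimage(1)[OF span_sub]])
        show "f \<in> Fk n p B" using f D' by simp
        show "basis_fn m \<in> {f \<in> D. \<iota> f \<in> VS.span ?B}" if "m \<in> mons n p B" for m
          using bD[OF that] VS.in_own_span[OF car] that by blast
      qed
      then show "v \<in> VS.span ?B" using f by simp
    qed
  qed
  have li: "VS.lin_indpt ?B"
  proof (rule VS.finite_lin_indpt2[OF fin car])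
    fix a assume z: "VS.lincomb a ?B = \<zero>\<^bsub>V\<^esub>"
    let ?h = "\<lambda>m. sc (a (\<iota> (basis_fn m))) (basis_fn m)"
    have "VS.lincomb a ?B = (\<Oplus>\<^bsub>V\<^esub>m\<in>mons n p B. a (\<iota> (basis_fn m)) \<odot>\<^bsub>V\<^esub> \<iota> (basis_fn m))"
      unfolding VS.lincomb_def using car by (intro VS.M.finsum_reindex binj) auto
    also have "\<dots> = (\<Oplus>\<^bsub>V\<^esub>m\<in>mons n p B. \<iota> (?h m))"
      using bD iota_carrier by (intro VS.M.finsum_cong) (auto simp: iota_sc simp_implies_def)
    also have "\<dots> = \<iota> (sum ?h (mons n p B))"
      by (rule iota_sum[OF finite_mons]) (intro subsp_sc[OF D] bD)
    finally have "\<iota> (sum ?h (mons n p B)) = \<iota> 0" using z iota_zero by simp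
    then have s: "sum ?h (mons n p B) = 0"
      by (intro iota_inj subsp_sum[OF D] subsp_sc[OF D] bD subsp_zero[OF D])
    have "a (\<iota> (basis_fn m)) = 0" if m: "m \<in> mons n p B" for m
    proof -
      have "sum ?h (mons n p B) m = (\<Sum>m'\<in>mons n p B. if m' = m then a (\<iota> (basis_fn m)) else 0)"
        unfolding sum_fun_apply by (rule sum.cong) (auto simp: sc_def basis_fn_def)
      then show ?thesis using s m by (simp add: finite_mons)
    qed
    then show "\<forall>v\<in>?B. a v = 0" by auto
  qed
  show "VS.fin_dim" unfolding VS.fin_dim_def using fin car gen by blast
  have "VS.basis ?B" unfolding VS.basis_def using li gen car by blast
  then have "VS.dim = card ?B" by (rule VS.dim_basis[OF fin])
  then show "VS.dim = card (mons n p B)" using card_image[OF binj] by simp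
qed

end

lemma gl_alg_single: "k \<le> n \<Longrightarrow> l \<le> n \<Longrightarrow> q_e k l 0 \<in> gl_alg n"
  by (simp add: gl_alg_def q_e_homogeneous)

lemma gl_alg_keys:
  assumes "x \<in> gl_alg n"
  shows "x \<in> q_alg n" "a \<in> Poly_Mapping.keys x \<Longrightarrow> \<exists>k l. a = (k, l, 0) \<and> k \<le> n \<and> l \<le> n"
proof -
  show x: "x \<in> q_alg n" using assms by (simp add: gl_alg_def homogeneous_def)
  assume a: "a \<in> Poly_Mapping.keys x"
  obtain k l \<tau> where t: "a = (k, l, \<tau>)" by (cases a)
  have "k \<le> n" "l \<le> n" using x a by (auto simp: q_alg_keys qidx_set_def t)
  moreover have "\<tau> = 0" using assms a by (fastforce simp: gl_alg_def homogeneous_def t)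
  ultimately show "\<exists>k l. a = (k, l, 0) \<and> k \<le> n \<and> l \<le> n" by (simp add: t)
qed

context Vp
begin

abbreviation "VB \<equiv> Vbar n p"

lemma VB_vs: "vectorspace class_ring VB"
  unfolding Vbar_def by (rule ind_vs)

lemma VB_carrier: "carrier VB = \<Theta> ` T"
  unfolding Vbar_def by (rule \<Theta>_surj)

lemma \<Theta>_VB: "f \<in> T \<Longrightarrow> \<Theta> f \<in> carrier VB"
  by (auto simp: VB_carrier)

lemma VB_ops:
  "f \<in> T \<Longrightarrow> g \<in> T \<Longrightarrow> \<Theta> f \<oplus>\<^bsub>VB\<^esub> \<Theta> g = \<Theta> (f + g)" "f \<in> T \<Longrightarrow> c \<odot>\<^bsub>VB\<^esub> \<Theta> f = \<Theta> (pscale c f)"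
  unfolding Vbar_def by (rule \<Theta>_add \<Theta>_pscale; assumption)+

lemma VB_zero: "\<zero>\<^bsub>VB\<^esub> = \<Theta> 0"
proof -
  interpret vectorspace class_ring VB by (rule VB_vs)
  have "\<Theta> 1 \<in> carrier VB" using T_intros(6) by (auto simp: VB_carrier)
  then have "(0 :: complex) \<odot>\<^bsub>VB\<^esub> \<Theta> 1 = \<zero>\<^bsub>VB\<^esub>"
    using lmult_0[of "\<Theta> 1"] by simp
  then show ?thesis using VB_ops(2)[OF T_intros(6), of 0] by simp
qed

lemma VB_minus:
  assumes "f \<in> T" "g \<in> T"
  shows "\<Theta> f \<ominus>\<^bsub>VB\<^esub> \<Theta> g = \<Theta> (f - g)"
proof -
  interpret vectorspace class_ring VB by (rule VB_vs)
  have ng: "- g \<in> T" by (rule T_intros(9)[OF assms(2)])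
  have "\<Theta> (- g) \<oplus>\<^bsub>VB\<^esub> \<Theta> g = \<zero>\<^bsub>VB\<^esub>"
    by (simp only: VB_ops(1)[OF ng assms(2)] VB_zero add.left_inverse)
  then have "\<ominus>\<^bsub>VB\<^esub> \<Theta> g = \<Theta> (- g)"
    by (rule M.minus_equality[OF _ \<Theta>_VB[OF assms(2)] \<Theta>_VB[OF ng]])
  then show ?thesis by (simp only: a_minus_def VB_ops(1)[OF assms(1) ng] add_uminus_conv_diff)
qed

lemma act_gen: "act n p (gen a) v = rho n p a v"
  by (simp add: gen_def act_embed_lext fk.lext_single)

section \<open>The maximal submodule as a kernel\<close>

definition N0 :: "ind set" where
  "N0 = \<Theta> ` {f \<in> T. \<Phi> f = 0}"

lemma N0_iff: "f \<in> T \<Longrightarrow> \<Theta> f \<in> N0 \<longleftrightarrow> \<Phi> f = 0"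
proof
  assume f: "f \<in> T" and "\<Theta> f \<in> N0"
  then obtain g where g: "g \<in> T" "\<Phi> g = 0" "\<Theta> f = \<Theta> g" unfolding N0_def by (elim imageE CollectE conjE)
  show "\<Phi> f = 0" by (simp only: \<Theta>_\<Phi>[OF f g(1,3)] g(2))
qed (unfold N0_def, intro imageI CollectI conjI)

lemma N0_subspace: "VectorSpace.subspace class_ring N0 VB"
proof (rule subspaceI[OF VB_vs])
  show "N0 \<subseteq> carrier VB" by (auto simp: N0_def VB_carrier)
  show "\<zero>\<^bsub>VB\<^esub> \<in> N0" using N0_iff[OF T_intros(5)] by (simp add: VB_zero \<Phi>_simps)
  show "x \<oplus>\<^bsub>VB\<^esub> y \<in> N0" if x: "x \<in> N0" and y: "y \<in> N0" for x y
  proof -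
    obtain f g where fg: "f \<in> T" "\<Phi> f = 0" "x = \<Theta> f" "g \<in> T" "\<Phi> g = 0" "y = \<Theta> g"
      using x y unfolding N0_def by blast
    then have "\<Phi> (f + g) = 0" by (simp only: \<Phi>_simps add_0_left)
    then show ?thesis using fg N0_iff[OF T_intros(3)[of f "q_alg n" g]] by (simp add: VB_ops)
  qed
  show "c \<odot>\<^bsub>VB\<^esub> x \<in> N0" if x: "x \<in> N0" for c x
  proof -
    obtain f where f: "f \<in> T" "\<Phi> f = 0" "x = \<Theta> f" using x unfolding N0_def by blast
    then have "\<Phi> (pscale c f) = 0" by (simp only: \<Phi>_simps sc_simps)
    then show ?thesis using f N0_iff[OF T_intros(7)[of f "q_alg n" c]] by (simp add: VB_ops)
  qed
qed

lemma N0_act: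
  assumes "x \<in> q_alg n" "w \<in> N0"
  shows "Vbar_act n p x w \<in> N0"
proof -
  obtain f where f: "f \<in> T" "\<Phi> f = 0" "w = \<Theta> f" using assms(2) unfolding N0_def by blast
  have "\<Phi> (embed x * f) = 0" by (simp only: \<Phi>_simps f(2) linop_zero[OF linop_act])
  then show ?thesis
    using N0_iff[OF T_intros(4)[OF T_intros(2)[OF assms(1)] f(1)]] by (simp add: f(3) \<Theta>_act'[OF assms(1) f(1)])
qed

lemma N0_proper: "N0 \<noteq> carrier VB"
proof
  assume "N0 = carrier VB"
  then have "\<Theta> 1 \<in> N0" using T_intros(6) by (auto simp: VB_carrier)
  then show False using N0_iff[OF T_intros(6)] v0_nonzero by (simp add: \<Phi>_simps)
qed

lemma submodule_mult:
  assumes N: "invariant_subspace (q_alg n) VB (Vbar_act n p) N" and "h \<in> T"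
  shows "f \<in> T \<Longrightarrow> \<Theta> f \<in> N \<Longrightarrow> \<Theta> (h * f) \<in> N"
  using assms(2)
proof (induction h arbitrary: f)
  note sN = N[unfolded invariant_subspace_def, THEN conjunct1]
  {
    case (1 c)
    then show ?case using subspace_smult[OF sN, of "\<Theta> f" c] by (simp add: scalar_mult VB_ops)
  next
    case (2 x)
    then show ?case using N unfolding invariant_subspace_def by (metis \<Theta>_act')
  next
    case (3 g h)
    then have "\<Theta> (g * f) \<oplus>\<^bsub>VB\<^esub> \<Theta> (h * f) \<in> N" by (intro subspace_add[OF sN]) blast+
    moreover have "g * f \<in> T" "h * f \<in> T" using "3.hyps" "3.prems" by (auto intro: tensor_alg.intros(4))
    ultimately show ?case by (simp only: VB_ops distrib_right)
  next
    case (4 g h)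
    have "h * f \<in> T" using "4.hyps" "4.prems" by (intro tensor_alg.intros(4))
    then show ?case using 4 by (simp only: mult.assoc)
  }
qed

text \<open>
  A submodule on which \<open>\<Phi>\<close> does not vanish contains a vector mapped to \<open>v0\<close>; the operator
  \<open>lowering k\<close> annihilates its components of lower weight and turns it into a multiple of the generator.
\<close>

lemma submodule_le_N0:
  assumes N: "invariant_subspace (q_alg n) VB (Vbar_act n p) N" and proper: "N \<noteq> carrier VB"
  shows "N \<subseteq> N0"
proof (rule ccontr)
  assume "\<not> N \<subseteq> N0"
  have sN: "VectorSpace.subspace class_ring N VB" using N by (simp add: invariant_subspace_def)
  let ?N' = "{f \<in> T. \<Theta> f \<in> N}"
  have img: "\<exists>f\<in>?N'. w = \<Theta> f" if "w \<in> N" for w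
    using that subspace_sub[OF sN] by (auto simp: VB_carrier)
  obtain w where "w \<in> N" "w \<notin> N0" using \<open>\<not> N \<subseteq> N0\<close> by blast
  then obtain f0 where f0: "f0 \<in> ?N'" "\<Phi> f0 \<noteq> 0" using img[of w] N0_iff by auto
  have sub: "subsp (\<Phi> ` ?N')"
    unfolding subsp_def
  proof (intro conjI ballI allI)
    show "0 \<in> \<Phi> ` ?N'"
      using subspace_zero[OF sN] T_intros(5) by (intro image_eqI[of _ _ 0]) (simp_all add: \<Phi>_simps VB_zero)
  next
    fix x y assume "x \<in> \<Phi> ` ?N'" "y \<in> \<Phi> ` ?N'"
    then obtain f g where fg: "f \<in> T" "\<Theta> f \<in> N" "x = \<Phi> f" "g \<in> T" "\<Theta> g \<in> N" "y = \<Phi> g" by blast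
    have "\<Theta> (f + g) \<in> N" using subspace_add[OF sN fg(2,5)] fg by (simp add: VB_ops)
    moreover have "f + g \<in> T" using fg by (intro T_intros(3))
    ultimately show "x + y \<in> \<Phi> ` ?N'"
      unfolding fg(3,6) \<Phi>_simps(1)[symmetric] by blast
  next
    fix c x assume "x \<in> \<Phi> ` ?N'"
    then obtain f where f: "f \<in> T" "\<Theta> f \<in> N" "x = \<Phi> f" by blast
    have "\<Theta> (pscale c f) \<in> N" using subspace_smult[OF sN f(2), of c] f by (simp add: VB_ops)
    moreover have "pscale c f \<in> T" using f by (intro T_intros(7))
    ultimately show "sc c x \<in> \<Phi> ` ?N'"
      unfolding f(3) \<Phi>_simps(3)[symmetric] by blast
  qed
  have "\<Phi> ` ?N' = EV n p"
  proof (rule EV_simple[OF p_pos sub])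
    show "\<Phi> ` ?N' \<subseteq> EV n p" using \<Phi>_EV by auto
    show "rho n p a x \<in> \<Phi> ` ?N'" if a: "a \<in> qidx_set n" and x: "x \<in> \<Phi> ` ?N'" for a x
    proof -
      obtain f where f: "f \<in> T" "\<Theta> f \<in> N" "x = \<Phi> f" using x by blast
      have "\<Theta> (gen a * f) \<in> N" by (rule submodule_mult[OF N gen_T[OF a] f(1,2)])
      moreover have "gen a * f \<in> T" by (intro T_intros(4) gen_T a f)
      moreover have "rho n p a x = \<Phi> (gen a * f)" by (simp only: f(3) \<Phi>_simps act_gen)
      ultimately show ?thesis by blast
    qed
    show "\<Phi> ` ?N' \<noteq> {0}" using f0 by blast
  qed
  then have "v0 p \<in> \<Phi> ` ?N'" using v0_EV by blast
  then obtain f where f: "f \<in> T" "\<Theta> f \<in> N" "\<Phi> f = v0 p" by force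
  obtain k where "low k f" using T_low[OF f(1)] by blast
  then obtain c where c: "\<Theta> (lowering k * f) = \<Theta> (pscale c 1)" using low_lowering by blast
  \<comment> \<open>Comparing images in the Fock space identifies \<open>c\<close> as k!, so it is
    nonzero and the generator itself lies in \<open>N\<close>.\<close>
  have "\<Phi> (lowering k * f) = sc (fact k) (v0 p)" by (simp only: \<Phi>_simps f(3) \<Phi>_lowering)
  moreover have "\<Phi> (lowering k * f) = \<Phi> (pscale c 1)"
    using c by (intro \<Theta>_\<Phi> T_intros lowering_T f(1))
  ultimately have "sc (fact k) (v0 p) = sc c (v0 p)" by (simp only: \<Phi>_simps)
  moreover have "v0 p (\<lambda>k. if k = 0 then p else 0, {}) = 1" by (simp add: v0_def basis_fn_def)
  ultimately have "c = fact k" using sc_apply[of _ "v0 p"] by (metis mult.right_neutral)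
  then have "c \<noteq> 0" by simp
  have "\<Theta> (lowering k * f) \<in> N" by (rule submodule_mult[OF N lowering_T f(1,2)])
  then have "\<Theta> (scalar (1 / c) * pscale c 1) \<in> N"
    unfolding c by (intro submodule_mult[OF N] T_intros)
  then have one: "\<Theta> 1 \<in> N" using \<open>c \<noteq> 0\<close> by (simp add: scalar_mult)
  have "carrier VB \<subseteq> N"
  proof
    fix v assume "v \<in> carrier VB"
    then obtain h where "h \<in> T" "v = \<Theta> h" by (auto simp: VB_carrier)
    then show "v \<in> N" using submodule_mult[OF N _ T_intros(6) one, of h] by simp
  qed
  then show False using proper subspace_sub[OF sN] by blast
qed

lemma N0_invariant: "invariant_subspace (q_alg n) VB (Vbar_act n p) N0"
  unfolding invariant_subspace_def using N0_subspace N0_act by blast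

text \<open>\<open>N0\<close> contains every proper submodule, so it is the only maximal one and the
  definite description denotes it.\<close>

lemma M_max_eq: "M_max n p = N0"
  unfolding M_max_def
proof (rule the_equality)
  show "maximal N0 (\<lambda>N. invariant_subspace (q_alg n) VB (Vbar_act n p) N \<and> N \<noteq> carrier VB)"
    unfolding maximal_def using N0_invariant N0_proper submodule_le_N0 by blast
  show "M = N0" if "maximal M (\<lambda>N. invariant_subspace (q_alg n) VB (Vbar_act n p) N \<and> N \<noteq> carrier VB)" for M
    using that N0_invariant N0_proper submodule_le_N0 unfolding maximal_def by metis
qed

lemma N0_vquot: "vquot VB N0"
  by (rule vquot.intro) (rule N0_subspace)

section \<open>The quotient as the even Fock component\<close>

abbreviation "VI \<equiv> V_irr n p"

definition cst :: "free_alg \<Rightarrow> ind set" where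
  "cst f = N0 +>\<^bsub>VB\<^esub> \<Theta> f"

lemma V_irr_eq: "VI = quot_vs VB N0"
  by (simp add: V_irr_def M_max_eq)

lemma cst_eq: "f \<in> T \<Longrightarrow> g \<in> T \<Longrightarrow> cst f = cst g \<longleftrightarrow> \<Phi> f = \<Phi> g"
  using vquot.coset_eq[OF N0_vquot \<Theta>_VB \<Theta>_VB, of f g] N0_iff[OF T_intros(8)[of f "q_alg n" g]]
  by (simp add: cst_def VB_minus \<Phi>_simps)

lemma VI_carrier: "carrier VI = cst ` T"
  unfolding V_irr_eq vquot.quot_carrier[OF N0_vquot] by (auto simp: VB_carrier cst_def)

lemma VI_ops:
  "f \<in> T \<Longrightarrow> g \<in> T \<Longrightarrow> cst f \<oplus>\<^bsub>VI\<^esub> cst g = cst (f + g)"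
  "f \<in> T \<Longrightarrow> c \<odot>\<^bsub>VI\<^esub> cst f = cst (pscale c f)"
  using vquot.quot_add[OF N0_vquot \<Theta>_VB \<Theta>_VB, of f g] vquot.quot_smult[OF N0_vquot \<Theta>_VB, of f c]
  by (simp_all add: V_irr_eq cst_def VB_ops)

lemma VI_act:
  assumes x: "x \<in> q_alg n" and f: "f \<in> T"
  shows "V_act n p x (cst f) = cst (embed x * f)"
proof -
  have ex: "embed x \<in> T" using x by (rule T_intros(2))
  have "V_act n p x (cst f) = N0 +>\<^bsub>VB\<^esub> Vbar_act n p x (\<Theta> f)"
    unfolding V_act_def M_max_eq cst_def
  proof (rule vquot.quot_map_coset[OF N0_vquot \<Theta>_VB[OF f]])
    show "Vbar_act n p x y \<in> carrier VB" if "y \<in> carrier VB" for y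
      using that \<Theta>_act'[OF x] T_intros(4)[OF ex] by (auto simp: VB_carrier)
    show "Vbar_act n p x (y \<oplus>\<^bsub>VB\<^esub> z) = Vbar_act n p x y \<oplus>\<^bsub>VB\<^esub> Vbar_act n p x z"
      if yz: "y \<in> carrier VB" "z \<in> carrier VB" for y z
    proof -
      obtain g h where gh: "g \<in> T" "y = \<Theta> g" "h \<in> T" "z = \<Theta> h" using yz by (auto simp: VB_carrier)
      have "g + h \<in> T" "embed x * g \<in> T" "embed x * h \<in> T"
        using gh ex by (auto intro: tensor_alg.intros)
      then show ?thesis using gh by (simp add: VB_ops \<Theta>_act'[OF x] distrib_left)
    qed
    show "Vbar_act n p x h \<in> N0" if "h \<in> N0" for h by (rule N0_act[OF x that])
  qed
  then show ?thesis by (simp add: \<Theta>_act'[OF x f] cst_def)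
qed

text \<open>The image is a nonzero submodule of a simple module.\<close>

lemma \<Phi>_surj: "\<Phi> ` T = EV n p"
proof (rule EV_simple[OF p_pos])
  show "subsp (\<Phi> ` T)"
    unfolding subsp_def
  proof (intro conjI ballI allI)
    show "0 \<in> \<Phi> ` T" using T_intros(5) \<Phi>_simps(4) by (metis image_eqI)
    show "x + y \<in> \<Phi> ` T" if "x \<in> \<Phi> ` T" "y \<in> \<Phi> ` T" for x y
      using that T_intros(3) \<Phi>_simps(1) by (smt (verit) imageE image_eqI)
    show "sc c x \<in> \<Phi> ` T" if "x \<in> \<Phi> ` T" for c x
      using that T_intros(7) \<Phi>_simps(3) by (smt (verit) imageE image_eqI)
  qed
  show "\<Phi> ` T \<subseteq> EV n p" using \<Phi>_EV by auto
  show "rho n p a x \<in> \<Phi> ` T" if a: "a \<in> qidx_set n" and x: "x \<in> \<Phi> ` T" for a x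
  proof -
    obtain f where f: "f \<in> T" "x = \<Phi> f" using x by blast
    then have "rho n p a x = \<Phi> (gen a * f)" by (simp only: \<Phi>_simps act_gen)
    then show ?thesis using T_intros(4)[OF gen_T[OF a] f(1)] by blast
  qed
  have "v0 p \<in> \<Phi> ` T" using T_intros(6) \<Phi>_simps(6) by (metis image_eqI)
  then show "\<Phi> ` T \<noteq> {0}" using v0_nonzero by blast
qed

text \<open>The inverse of the isomorphism induced by \<open>\<Phi>\<close>; by
  \<open>cst_eq\<close> the choice of preimage does not matter.\<close>

definition \<iota> :: "fock \<Rightarrow> ind set" where
  "\<iota> e = cst (SOME f. f \<in> T \<and> \<Phi> f = e)"

lemma iota_\<Phi>: "f \<in> T \<Longrightarrow> \<iota> (\<Phi> f) = cst f"
proof -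
  assume f: "f \<in> T"
  then have "(SOME g. g \<in> T \<and> \<Phi> g = \<Phi> f) \<in> T \<and> \<Phi> (SOME g. g \<in> T \<and> \<Phi> g = \<Phi> f) = \<Phi> f"
    by (intro someI[of "\<lambda>g. g \<in> T \<and> \<Phi> g = \<Phi> f"]) simp
  then show ?thesis unfolding \<iota>_def using cst_eq f by blast
qed

lemma EV_obtain: "e \<in> EV n p \<Longrightarrow> \<exists>f\<in>T. e = \<Phi> f"
  using \<Phi>_surj by blast

lemma iota_act:
  assumes "x \<in> q_alg n" "e \<in> EV n p"
  shows "V_act n p x (\<iota> e) = \<iota> (act n p (embed x) e)"
proof -
  obtain f where f: "f \<in> T" "e = \<Phi> f" using EV_obtain[OF assms(2)] by blast
  have "embed x * f \<in> T" by (intro T_intros(4) T_intros(2) assms f)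
  then show ?thesis
    using iota_\<Phi>[of "embed x * f"] by (simp only: f(2) iota_\<Phi>[OF f(1)] VI_act[OF assms(1) f(1)] \<Phi>_simps)
qed

sublocale F: fock_iso VI "EV n p" \<iota>
proof (rule fock_iso.intro)
  show "vectorspace class_ring VI"
    unfolding V_irr_eq by (rule vquot.quot_vectorspace[OF N0_vquot])
  show "subsp (EV n p)" by (rule subsp_EV)
  show "bij_betw \<iota> (EV n p) (carrier VI)"
  proof (rule bij_betwI')
    show "\<iota> x = \<iota> y \<longleftrightarrow> x = y" if "x \<in> EV n p" "y \<in> EV n p" for x y
      using that EV_obtain cst_eq iota_\<Phi> by metis
    show "\<iota> x \<in> carrier VI" if "x \<in> EV n p" for x
      using EV_obtain[OF that] iota_\<Phi> by (auto simp: VI_carrier)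
    show "\<exists>x\<in>EV n p. y = \<iota> x" if "y \<in> carrier VI" for y
      using that iota_\<Phi> \<Phi>_EV by (auto simp: VI_carrier)
  qed
  show "\<iota> (e + e') = \<iota> e \<oplus>\<^bsub>VI\<^esub> \<iota> e'" if ee: "e \<in> EV n p" "e' \<in> EV n p" for e e'
  proof -
    obtain f g where fg: "f \<in> T" "e = \<Phi> f" "g \<in> T" "e' = \<Phi> g" using ee EV_obtain by blast
    then have "f + g \<in> T" by (intro T_intros(3))
    from iota_\<Phi>[OF this] show ?thesis
      by (simp only: fg(2,4) iota_\<Phi>[OF fg(1)] iota_\<Phi>[OF fg(3)] VI_ops(1)[OF fg(1,3)] \<Phi>_simps)
  qed
  show "\<iota> (sc c e) = c \<odot>\<^bsub>VI\<^esub> \<iota> e" if e: "e \<in> EV n p" for e c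
  proof -
    obtain f where f: "f \<in> T" "e = \<Phi> f" using e EV_obtain by blast
    then have "pscale c f \<in> T" by (intro T_intros(7))
    from iota_\<Phi>[OF this] show ?thesis
      by (simp only: f(2) iota_\<Phi>[OF f(1)] VI_ops(2)[OF f(1)] \<Phi>_simps)
  qed
qed

definition Wc :: "nat \<Rightarrow> ind set set" where
  "Wc i = \<iota> ` Wm n p i"

lemma gl_act_Wm:
  assumes "x \<in> gl_alg n" "f \<in> N" "subsp N" "\<And>k l f. k \<le> n \<Longrightarrow> l \<le> n \<Longrightarrow> f \<in> N \<Longrightarrow> E0 k l f \<in> N"
  shows "act n p (embed x) f \<in> N"
  unfolding act_embed
proof (intro subsp_sum[OF assms(3)] subsp_sc[OF assms(3)])
  fix a assume "a \<in> Poly_Mapping.keys x"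
  then obtain k l where "a = (k, l, 0)" "k \<le> n" "l \<le> n" using gl_alg_keys(2)[OF assms(1)] by blast
  then show "rho n p a f \<in> N" using assms(2,4) by (simp add: rho_simps)
qed

lemma act_q_e0: "f \<in> EV n p \<Longrightarrow> k \<le> n \<Longrightarrow> l \<le> n \<Longrightarrow> V_act n p (q_e k l 0) (\<iota> f) = \<iota> (E0 k l f)"
  using iota_act[OF q_e_q_alg, of k l f 0] by (simp only: act_q_e rho_simps)

lemma Wc_irreducible:
  assumes i: "i \<le> n" "i < p"
  shows "irreducible_gl_submodule n VI (V_act n p) (Wc i)"
  unfolding irreducible_gl_submodule_def
proof (intro conjI allI impI)
  note E0W = E0_Wm[OF p_pos]
  show "invariant_subspace (gl_alg n) VI (V_act n p) (Wc i)"
    unfolding invariant_subspace_def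
  proof (intro conjI ballI)
    show "VectorSpace.subspace class_ring (Wc i) VI"
      unfolding Wc_def by (rule F.subspace_image[OF subsp_Wm Wm_EV])
    fix x w assume x: "x \<in> gl_alg n" and "w \<in> Wc i"
    then obtain f where f: "f \<in> Wm n p i" "w = \<iota> f" by (auto simp: Wc_def)
    have "act n p (embed x) f \<in> Wm n p i"
      by (rule gl_act_Wm[OF x f(1) subsp_Wm]) (rule E0W)
    then show "V_act n p x w \<in> Wc i"
      using iota_act[OF gl_alg_keys(1)[OF x], of f] f Wm_EV[of n p i] by (auto simp: Wc_def)
  qed
  have "\<iota> (hwv n p i) \<noteq> \<iota> 0"
    using F.iota_inj[of "hwv n p i" 0] hwv_Wm[OF i] Wm_EV[of n p i] hwv_nonzero[OF i] subsp_zero[OF subsp_EV] by auto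
  then show "Wc i \<noteq> {\<zero>\<^bsub>VI\<^esub>}"
    using hwv_Wm[OF i] by (auto simp: Wc_def F.iota_zero)
  fix N assume N: "invariant_subspace (gl_alg n) VI (V_act n p) N \<and> N \<subseteq> Wc i"
  then have sN: "VectorSpace.subspace class_ring N VI" by (simp add: invariant_subspace_def)
  \<comment> \<open>The preimage of \<open>N\<close> in the Fock space, where irreducibility is
    already known.\<close>
  let ?N' = "{f \<in> EV n p. \<iota> f \<in> N}"
  have sub: "?N' \<subseteq> Wm n p i"
  proof
    fix f assume f: "f \<in> ?N'"
    then obtain g where "g \<in> Wm n p i" "\<iota> f = \<iota> g" using N by (auto simp: Wc_def)
    then show "f \<in> Wm n p i" using F.iota_inj[of f g] f Wm_EV[of n p i] by auto
  qed
  show "N = {\<zero>\<^bsub>VI\<^esub>} \<or> N = Wc i"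
  proof (cases "?N' = {0}")
    case True
    then show ?thesis using F.subsp_preimage(2)[OF sN] by (auto simp: F.iota_zero)
  next
    case False
    have "?N' = Wm n p i"
    proof (rule Wm_irreducible[OF i F.subsp_preimage(1)[OF sN] sub _ False])
      show "E0 k l f \<in> ?N'" if kl: "k \<le> n" "l \<le> n" and f: "f \<in> ?N'" for k l f
      proof (intro CollectI conjI)
        have fE: "f \<in> EV n p" and fN: "\<iota> f \<in> N" using f by blast+
        have "V_act n p (q_e k l 0) (\<iota> f) \<in> N"
          using N gl_alg_single[OF kl] fN unfolding invariant_subspace_def by blast
        then show "\<iota> (E0 k l f) \<in> N" by (simp only: act_q_e0[OF fE kl])
        have "E0 k l f \<in> Wm n p i" by (rule E0W[OF subsetD[OF sub f] kl])
        then show "E0 k l f \<in> EV n p" by (rule subsetD[OF Wm_EV])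
      qed
    qed
    then show ?thesis using F.subsp_preimage(2)[OF sN] by (simp add: Wc_def)
  qed
qed

lemma Wc_highest_weight:
  assumes i: "i \<le> n" "i < p"
  shows "has_highest_weight n VI (V_act n p) (Wc i) (hook_weight p i)"
  unfolding has_highest_weight_def
proof (intro bexI conjI allI impI)
  have h: "hwv n p i \<in> EV n p" using hwv_Wm[OF i] Wm_EV by blast
  show "\<iota> (hwv n p i) \<in> Wc i" using hwv_Wm[OF i] by (simp add: Wc_def)
  show "\<iota> (hwv n p i) \<noteq> \<zero>\<^bsub>VI\<^esub>"
    using F.iota_inj[of "hwv n p i" 0] h hwv_nonzero[OF i] subsp_zero[OF subsp_EV] by (auto simp: F.iota_zero[symmetric])
  show "V_act n p (q_e k l 0) (\<iota> (hwv n p i)) = \<zero>\<^bsub>VI\<^esub>" if "k < l \<and> l \<le> n" for k l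
    using act_q_e0[OF h, of k l] that hwv_singular[OF i, of k l] by (simp add: F.iota_zero)
  show "V_act n p (q_e k k 0) (\<iota> (hwv n p i)) = of_int (hook_weight p i k) \<odot>\<^bsub>VI\<^esub> \<iota> (hwv n p i)" if "k \<le> n" for k
    using act_q_e0[OF h that that] hwv_weight[OF i that] F.iota_sc[OF h] by simp
qed

lemma Wc_direct_sum: "internal_direct_sum VI {i. i \<le> n \<and> i < p} Wc"
  unfolding internal_direct_sum_def
proof (intro conjI ballI)
  let ?I = "{i. i \<le> n \<and> i < p}"
  have finI: "finite ?I" by simp
  show "VectorSpace.subspace class_ring (Wc i) VI" for i
    unfolding Wc_def by (rule F.subspace_image[OF subsp_Wm Wm_EV])
  fix v assume "v \<in> carrier VI"
  then obtain e where e: "e \<in> EV n p" "v = \<iota> e" using F.iota_surj by blast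
  \<comment> \<open>Existence comes from the projections of a preimage of \<open>v\<close>;
    \<open>restrict\<close> gives the family the default value outside the index set that the
    extensional product requires.\<close>
  let ?g = "restrict (\<lambda>i. \<iota> (comp n p i e)) ?I"
  show "\<exists>!f. f \<in> (\<Pi>\<^sub>E i\<in>?I. Wc i) \<and> v = (\<Oplus>\<^bsub>VI\<^esub>i\<in>?I. f i)"
  proof (rule ex1I[of _ ?g])
    have c: "comp n p i e \<in> Wm n p i" for i by (rule comp_Wm[OF p_pos e(1)])
    then have cE: "comp n p i e \<in> EV n p" for i using Wm_EV by blast
    have "(\<Oplus>\<^bsub>VI\<^esub>i\<in>?I. ?g i) = (\<Oplus>\<^bsub>VI\<^esub>i\<in>?I. \<iota> (comp n p i e))"
      using cE F.iota_carrier by (intro F.VS.M.finsum_cong) (auto simp: simp_implies_def)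
    also have "\<dots> = \<iota> (\<Sum>i\<in>?I. comp n p i e)" by (rule F.iota_sum[OF finI]) (rule cE)
    finally show "?g \<in> (\<Pi>\<^sub>E i\<in>?I. Wc i) \<and> v = (\<Oplus>\<^bsub>VI\<^esub>i\<in>?I. ?g i)"
      using c by (auto simp: sum_comp[OF p_pos e(1)] e(2) Wc_def)
  next
    fix f assume f: "f \<in> (\<Pi>\<^sub>E i\<in>?I. Wc i) \<and> v = (\<Oplus>\<^bsub>VI\<^esub>i\<in>?I. f i)"
    have "\<forall>i\<in>?I. \<exists>w. w \<in> Wm n p i \<and> f i = \<iota> w" using f by (auto simp: Wc_def PiE_def Pi_def)
    then obtain w where w: "\<And>i. i \<in> ?I \<Longrightarrow> w i \<in> Wm n p i" "\<And>i. i \<in> ?I \<Longrightarrow> f i = \<iota> (w i)"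
      by metis
    have wE: "w i \<in> EV n p" if "i \<in> ?I" for i using w(1)[OF that] Wm_EV by blast
    have "(\<Oplus>\<^bsub>VI\<^esub>i\<in>?I. f i) = (\<Oplus>\<^bsub>VI\<^esub>i\<in>?I. \<iota> (w i))"
      using wE F.iota_carrier w(2) by (intro F.VS.M.finsum_cong) (auto simp: simp_implies_def)
    also have "\<dots> = \<iota> (\<Sum>i\<in>?I. w i)" by (rule F.iota_sum[OF finI wE])
    finally have "\<iota> e = \<iota> (\<Sum>i\<in>?I. w i)" using f e(2) by simp
    then have ew: "e = (\<Sum>i\<in>?I. w i)"
      by (intro F.iota_inj e(1) subsp_sum[OF subsp_EV] wE)
    \<comment> \<open>Uniqueness: the projection \<open>comp n p j\<close> reads off the summand of
      index \<open>j\<close> from any decomposition.\<close>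
    have "comp n p j e = w j" if j: "j \<in> ?I" for j
    proof -
      have "comp n p j e = (\<Sum>i\<in>?I. comp n p j (w i))"
        unfolding ew by (rule linop_sum[OF linop_comp_proj])
      also have "\<dots> = (\<Sum>i\<in>?I. if i = j then w j else 0)"
        by (rule sum.cong) (auto simp: comp_of_Wm[OF p_pos w(1)])
      also have "\<dots> = w j" using j by (subst sum.delta[OF finI]) simp
      finally show ?thesis .
    qed
    then have "f i = ?g i" if "i \<in> ?I" for i using w(2) that by simp
    moreover have "?g \<in> (\<Pi>\<^sub>E i\<in>?I. Wc i)" using comp_Wm[OF p_pos e(1)] by (auto simp: Wc_def)
    ultimately show "f = ?g" using f by (intro PiE_ext[of f ?I Wc ?g]) blast+
  qed
qed

end

theorem proposition5:
  fixes n p :: nat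
  assumes "n \<ge> 1" and "p \<ge> 1"
  shows "(\<exists>W :: nat \<Rightarrow> ind set set.
            internal_direct_sum (V_irr n p) {i. i \<le> n \<and> i < p} W \<and>
            (\<forall>i. i \<le> n \<and> i < p \<longrightarrow>
               irreducible_gl_submodule n (V_irr n p) (V_act n p) (W i) \<and>
               has_highest_weight n (V_irr n p) (V_act n p) (W i) (hook_weight p i)))
       \<and> vectorspace.fin_dim class_ring (V_irr n p)
       \<and> vectorspace.dim class_ring (V_irr n p)
           = (\<Sum>i=0..n. ((p - 1) choose i) * ((p + n - i) choose (n - i)))"
proof -
  interpret Vp n p by unfold_locales (use assms in simp)
  show ?thesis
    using Wc_direct_sum Wc_irreducible Wc_highest_weight F.fin_dim_dim[OF EV_def]
    unfolding card_even_mons[OF p_pos] by (intro conjI exI[of _ Wc]) blast+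
qed

end
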